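(* Let $S$ be an Ore semigroup with enveloping group $G = S^{-1}S$, and let $\alpha$ be an action of $S$ by injective (not necessarily unital) endomorphisms of a unital C*-algebra $A$. Then there exists a C*-dynamical system $(B,G,\beta)$, unique up to isomorphism, consisting of an action $\beta$ of $G$ by automorphisms of a C*-algebra $B$ and an embedding (injective *-homomorphism) $i: A\to B$ such that (1) $\beta$ dilates $\alpha$, that is, $\beta_s\circ i = i\circ\alpha_s$ for all $s\in S$; and (2) $(B,G,\beta)$ is minimal, that is, $\bigcup_{s\in S}\beta_s^{-1}(i(A))$ is dense in $B$.
   Context: An Ore semigroup is a (discrete) cancellative semigroup $S$ such that $Ss\cap St\neq\emptyset$ for all $s,t\in S$. By the theorem of Ore and Dubreil, such an $S$ embeds in a group $G$, unique up to canonical isomorphism, with $G=S^{-1}S=\{s^{-1}t: s,t\in S\}$; this $G$ is called the enveloping group of $S$, and $S$ is regarded as a subsemigroup of $G$. An action of $S$ by endomorphisms of $A$ is a family $(\alpha_s)_{s\in S}$ of *-endomorphisms of $A$ with $\alpha_s\circ\alpha_t=\alpha_{st}$; they need not preserve the unit of $A$. An action of $G$ by automorphisms of $B$ is a group homomorphism $\beta:G\to\operatorname{Aut}(B)$. The C*-algebra $B$ need not be unital. Uniqueness up to isomorphism means: if $(B',G,\beta')$ with embedding $i':A\to B'$ also satisfies (1) and (2), then there is a *-isomorphism $\theta:B\to B'$ with $\theta\circ i=i'$ and $\theta\circ\beta_g=\beta'_g\circ\theta$ for all $g\in G$. *)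

theory Defs
  imports
    Complex_Main
    "HOL-Analysis.Abstract_Metric_Spaces"
    "HOL-Algebra.Group_Action"
    "HOL-Algebra.Module"
begin

definition complex_ring :: "complex ring" where
  "complex_ring = \<lparr>carrier = UNIV, mult = (*), one = 1, zero = 0, add = (+)\<rparr>"

text \<open>
  C*-algebras are carrier-based, since the dilation space has to be constructed from the given
  data and so cannot be a type-class instance. The field \<open>one\<close> inherited from the ring record
  is unconstrained in a general C*-algebra; it is the unit only in the unital case below.
\<close>

record 'a cstar = "(complex, 'a) module" +
  star :: "'a \<Rightarrow> 'a"
  nrm :: "'a \<Rightarrow> real"

text \<open>
  The cut-off outside the carrier is needed because the locale \<open>Metric_space\<close> demands
  nonnegativity and symmetry on the whole type.
\<close>

definition cstar_dist :: "('a, 'm) cstar_scheme \<Rightarrow> 'a \<Rightarrow> 'a \<Rightarrow> real" where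
  "cstar_dist A x y =
    (if x \<in> carrier A \<and> y \<in> carrier A then nrm A (x \<ominus>\<^bsub>A\<^esub> y) else 0)"

locale cstar_algebra = Module.module complex_ring A
  for A :: "('a, 'm) cstar_scheme" (structure) +
  assumes mult_closed:
      "\<lbrakk>x \<in> carrier A; y \<in> carrier A\<rbrakk> \<Longrightarrow> x \<otimes> y \<in> carrier A"
    and mult_assoc:
      "\<lbrakk>x \<in> carrier A; y \<in> carrier A; z \<in> carrier A\<rbrakk> \<Longrightarrow> (x \<otimes> y) \<otimes> z = x \<otimes> (y \<otimes> z)"
    and mult_distrib_right:
      "\<lbrakk>x \<in> carrier A; y \<in> carrier A; z \<in> carrier A\<rbrakk> \<Longrightarrow> (x \<oplus> y) \<otimes> z = x \<otimes> z \<oplus> y \<otimes> z"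
    and mult_distrib_left:
      "\<lbrakk>x \<in> carrier A; y \<in> carrier A; z \<in> carrier A\<rbrakk> \<Longrightarrow> z \<otimes> (x \<oplus> y) = z \<otimes> x \<oplus> z \<otimes> y"
    and smult_mult_left:
      "\<lbrakk>x \<in> carrier A; y \<in> carrier A\<rbrakk> \<Longrightarrow> (c \<odot> x) \<otimes> y = c \<odot> (x \<otimes> y)"
    and smult_mult_right:
      "\<lbrakk>x \<in> carrier A; y \<in> carrier A\<rbrakk> \<Longrightarrow> x \<otimes> (c \<odot> y) = c \<odot> (x \<otimes> y)"
    and star_closed: "x \<in> carrier A \<Longrightarrow> star A x \<in> carrier A"
    and star_star: "x \<in> carrier A \<Longrightarrow> star A (star A x) = x"
    and star_add:
      "\<lbrakk>x \<in> carrier A; y \<in> carrier A\<rbrakk> \<Longrightarrow> star A (x \<oplus> y) = star A x \<oplus> star A y"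
    and star_smult: "x \<in> carrier A \<Longrightarrow> star A (c \<odot> x) = cnj c \<odot> star A x"
    and star_mult:
      "\<lbrakk>x \<in> carrier A; y \<in> carrier A\<rbrakk> \<Longrightarrow> star A (x \<otimes> y) = star A y \<otimes> star A x"
    and nrm_nonneg: "x \<in> carrier A \<Longrightarrow> 0 \<le> nrm A x"
    and nrm_eq_0: "x \<in> carrier A \<Longrightarrow> nrm A x = 0 \<longleftrightarrow> x = \<zero>"
    and nrm_triangle:
      "\<lbrakk>x \<in> carrier A; y \<in> carrier A\<rbrakk> \<Longrightarrow> nrm A (x \<oplus> y) \<le> nrm A x + nrm A y"
    and nrm_smult: "x \<in> carrier A \<Longrightarrow> nrm A (c \<odot> x) = cmod c * nrm A x"
    and nrm_mult:
      "\<lbrakk>x \<in> carrier A; y \<in> carrier A\<rbrakk> \<Longrightarrow> nrm A (x \<otimes> y) \<le> nrm A x * nrm A y"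
    and nrm_star_mult: "x \<in> carrier A \<Longrightarrow> nrm A (star A x \<otimes> x) = (nrm A x)\<^sup>2"
    and complete: "Metric_space.mcomplete (carrier A) (cstar_dist A)"

locale unital_cstar_algebra = cstar_algebra A + Group.monoid A
  for A :: "('a, 'm) cstar_scheme" (structure)

lemma (in cstar_algebra) Metric_space_cstar_dist:
  "Metric_space (carrier A) (cstar_dist A)"
proof -
  have smult_m1: "(-1) \<odot> x = \<ominus> x" if x: "x \<in> carrier A" for x
  proof -
    have cl: "c \<odot> x \<in> carrier A" for c
      using smult_closed[of c x] x by (simp add: complex_ring_def)
    have "0 \<odot> x \<oplus> 0 \<odot> x = 0 \<odot> x"
      using smult_l_distr[of 0 0 x] x by (simp add: complex_ring_def)
    then have z: "0 \<odot> x = \<zero>"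
      using cl[of 0] by (metis M.add.l_cancel_one)
    have "(-1) \<odot> x \<oplus> x = \<zero>"
      using smult_l_distr[of "-1" 1 x] smult_one[of x] x z by (simp add: complex_ring_def)
    then show ?thesis
      using M.minus_equality[of "(-1) \<odot> x" x] x cl by simp
  qed
  have swap: "nrm A (x \<ominus> y) = nrm A (y \<ominus> x)"
    if "x \<in> carrier A" "y \<in> carrier A" for x y
  proof -
    have "x \<ominus> y = \<ominus> (y \<ominus> x)"
      using that by (simp add: M.minus_eq M.minus_add M.a_comm)
    then show ?thesis
      using nrm_smult[of "y \<ominus> x" "-1"] that by (simp add: smult_m1)
  qed
  have tri: "nrm A (x \<ominus> z) \<le> nrm A (x \<ominus> y) + nrm A (y \<ominus> z)"
    if "x \<in> carrier A" "y \<in> carrier A" "z \<in> carrier A" for x y z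
  proof -
    have "(x \<ominus> y) \<oplus> (y \<ominus> z) = x \<ominus> z"
      using that by (simp add: M.minus_eq M.a_assoc M.r_neg1)
    then show ?thesis
      using nrm_triangle[of "x \<ominus> y" "y \<ominus> z"] that by simp
  qed
  have eq: "x \<ominus> y = \<zero> \<longleftrightarrow> x = y" if "x \<in> carrier A" "y \<in> carrier A" for x y
    using that M.minus_equality[of x "\<ominus> y"] by (auto simp: M.minus_eq M.r_neg)
  show ?thesis
    by unfold_locales (auto simp: cstar_dist_def nrm_nonneg swap tri nrm_eq_0 eq)
qed

definition star_hom :: "('a, 'm) cstar_scheme \<Rightarrow> ('b, 'n) cstar_scheme \<Rightarrow> ('a \<Rightarrow> 'b) set" where
  "star_hom A B = {h \<in> carrier A \<rightarrow> carrier B.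
     (\<forall>x\<in>carrier A. \<forall>y\<in>carrier A. h (x \<oplus>\<^bsub>A\<^esub> y) = h x \<oplus>\<^bsub>B\<^esub> h y) \<and>
     (\<forall>c. \<forall>x\<in>carrier A. h (c \<odot>\<^bsub>A\<^esub> x) = c \<odot>\<^bsub>B\<^esub> h x) \<and>
     (\<forall>x\<in>carrier A. \<forall>y\<in>carrier A. h (x \<otimes>\<^bsub>A\<^esub> y) = h x \<otimes>\<^bsub>B\<^esub> h y) \<and>
     (\<forall>x\<in>carrier A. h (star A x) = star B (h x))}"

text \<open>Only the fields \<open>carrier\<close> and \<open>mult\<close> of the record are used: no identity is assumed.\<close>

locale ore_semigroup =
  fixes S :: "('s, 'm) monoid_scheme" (structure)
  assumes m_closed: "\<lbrakk>s \<in> carrier S; t \<in> carrier S\<rbrakk> \<Longrightarrow> s \<otimes> t \<in> carrier S"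
    and m_assoc:
      "\<lbrakk>r \<in> carrier S; s \<in> carrier S; t \<in> carrier S\<rbrakk> \<Longrightarrow> (r \<otimes> s) \<otimes> t = r \<otimes> (s \<otimes> t)"
    and l_cancel:
      "\<lbrakk>r \<in> carrier S; s \<in> carrier S; t \<in> carrier S; r \<otimes> s = r \<otimes> t\<rbrakk> \<Longrightarrow> s = t"
    and r_cancel:
      "\<lbrakk>r \<in> carrier S; s \<in> carrier S; t \<in> carrier S; s \<otimes> r = t \<otimes> r\<rbrakk> \<Longrightarrow> s = t"
    and ore:
      "\<lbrakk>s \<in> carrier S; t \<in> carrier S\<rbrakk> \<Longrightarrow>
        (\<lambda>x. x \<otimes> s) ` carrier S \<inter> (\<lambda>x. x \<otimes> t) ` carrier S \<noteq> {}"

text \<open>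
  The inclusion of the semigroup in its enveloping group is an explicit embedding \<open>j\<close>; a
  subsemigroup of a group is the case where \<open>j\<close> is the identity.
\<close>

definition enveloping_group ::
  "('s, 'm) monoid_scheme \<Rightarrow> ('g, 'n) monoid_scheme \<Rightarrow> ('s \<Rightarrow> 'g) \<Rightarrow> bool" where
  "enveloping_group S G j \<longleftrightarrow>
     Group.group G \<and> j \<in> hom S G \<and> inj_on j (carrier S) \<and>
     carrier G = {inv\<^bsub>G\<^esub> (j s) \<otimes>\<^bsub>G\<^esub> j t |s t. s \<in> carrier S \<and> t \<in> carrier S}"

definition endomorphism_action ::
  "('s, 'm) monoid_scheme \<Rightarrow> ('a, 'n) cstar_scheme \<Rightarrow> ('s \<Rightarrow> 'a \<Rightarrow> 'a) \<Rightarrow> bool" where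
  "endomorphism_action S A \<alpha> \<longleftrightarrow>
     (\<forall>s\<in>carrier S. \<alpha> s \<in> star_hom A A) \<and>
     (\<forall>s\<in>carrier S. \<forall>t\<in>carrier S. \<forall>x\<in>carrier A. \<alpha> s (\<alpha> t x) = \<alpha> (s \<otimes>\<^bsub>S\<^esub> t) x)"

text \<open>
  \<open>group_action\<close> makes \<open>\<beta>\<close> a homomorphism into the group of bijections of the carrier, whose
  elements are extensional functions; each \<open>\<beta> g\<close> is thus a *-automorphism of \<open>B\<close>.
\<close>

definition cstar_dynamical_system ::
  "('b, 'n) cstar_scheme \<Rightarrow> ('g, 'm) monoid_scheme \<Rightarrow> ('g \<Rightarrow> 'b \<Rightarrow> 'b) \<Rightarrow> bool" where
  "cstar_dynamical_system B G \<beta> \<longleftrightarrow>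
     cstar_algebra B \<and> group_action G (carrier B) \<beta> \<and>
     (\<forall>g\<in>carrier G. \<beta> g \<in> star_hom B B)"

definition dilates ::
  "('s, 'm) monoid_scheme \<Rightarrow> ('s \<Rightarrow> 'g) \<Rightarrow> ('a, 'k) cstar_scheme \<Rightarrow> ('s \<Rightarrow> 'a \<Rightarrow> 'a) \<Rightarrow>
   ('g \<Rightarrow> 'b \<Rightarrow> 'b) \<Rightarrow> ('a \<Rightarrow> 'b) \<Rightarrow> bool" where
  "dilates S j A \<alpha> \<beta> i \<longleftrightarrow>
     (\<forall>s\<in>carrier S. \<forall>a\<in>carrier A. \<beta> (j s) (i a) = i (\<alpha> s a))"

definition minimal_system ::
  "('s, 'm) monoid_scheme \<Rightarrow> ('s \<Rightarrow> 'g) \<Rightarrow> ('a, 'k) cstar_scheme \<Rightarrow>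
   ('b, 'l) cstar_scheme \<Rightarrow> ('g \<Rightarrow> 'b \<Rightarrow> 'b) \<Rightarrow> ('a \<Rightarrow> 'b) \<Rightarrow> bool" where
  "minimal_system S j A B \<beta> i \<longleftrightarrow>
     Metric_space.mtopology (carrier B) (cstar_dist B) closure_of
       (\<Union>s\<in>carrier S. {b \<in> carrier B. \<beta> (j s) b \<in> i ` carrier A}) = carrier B"

definition minimal_dilation ::
  "('s, 'm) monoid_scheme \<Rightarrow> ('g, 'n) monoid_scheme \<Rightarrow> ('s \<Rightarrow> 'g) \<Rightarrow>
   ('a, 'k) cstar_scheme \<Rightarrow> ('s \<Rightarrow> 'a \<Rightarrow> 'a) \<Rightarrow>
   ('b, 'l) cstar_scheme \<Rightarrow> ('g \<Rightarrow> 'b \<Rightarrow> 'b) \<Rightarrow> ('a \<Rightarrow> 'b) \<Rightarrow> bool" where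
  "minimal_dilation S G j A \<alpha> B \<beta> i \<longleftrightarrow>
     cstar_dynamical_system B G \<beta> \<and>
     i \<in> star_hom A B \<and> inj_on i (carrier A) \<and>
     dilates S j A \<alpha> \<beta> i \<and> minimal_system S j A B \<beta> i"

text \<open>
  The two systems below may live on different types. For existence a single ambient type has to
  be named: \<open>('s \<Rightarrow> 'a) set\<close> is large enough, as the completed inductive limit of copies of
  \<open>A\<close> indexed by \<open>S\<close> embeds in bounded functions \<open>S \<rightarrow> A\<close> modulo those vanishing along the
  directed set \<open>S\<close>.
\<close>

definition isomorphic_dilations ::
  "('g, 'n) monoid_scheme \<Rightarrow> ('a, 'k) cstar_scheme \<Rightarrow>
   ('b, 'l) cstar_scheme \<Rightarrow> ('g \<Rightarrow> 'b \<Rightarrow> 'b) \<Rightarrow> ('a \<Rightarrow> 'b) \<Rightarrow>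
   ('c, 'h) cstar_scheme \<Rightarrow> ('g \<Rightarrow> 'c \<Rightarrow> 'c) \<Rightarrow> ('a \<Rightarrow> 'c) \<Rightarrow> bool" where
  "isomorphic_dilations G A B \<beta> i B' \<beta>' i' \<longleftrightarrow>
     (\<exists>\<theta> \<in> star_hom B B'. bij_betw \<theta> (carrier B) (carrier B') \<and>
        (\<forall>a\<in>carrier A. \<theta> (i a) = i' a) \<and>
        (\<forall>g\<in>carrier G. \<forall>b\<in>carrier B. \<theta> (\<beta> g b) = \<beta>' g (\<theta> b)))"

end

(*
  An injective *-homomorphism h between C*-algebras is isometric. It is contractive because a
  self-adjoint x with norm < 1 is the real part of the unitary x + i sqrt(1 - x^2), which acts as a
  multiplier. It is bounded below because a function vanishing exactly on [-s, s], approximated by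
  polynomials, would otherwise produce a nonzero element of the kernel; this needs
  ||p(x)|| <= sup |p|, which follows from Cauchy's estimate for the coefficients of p((z + 1/z)/2)
  and the C*-identity applied to high powers of p.

  Existence: an element b of the dilation is represented by a function f : S -> A for which i(f(x))
  is asymptotically equal to beta_x(b) along the left ideals Ss. The algebra B consists of all limits
  of functions x |-> alpha_r(a), x = rs, modulo functions tending to 0, and G acts by right
  translation.

  Uniqueness: for two minimal dilations, beta_s^-1(i(a)) |-> beta'_s^-1(i'(a)) is isometric, so the
  closure of its graph is the graph of an isomorphism.
*)

theory Submission
  imports Defs "HOL-Complex_Analysis.Complex_Analysis"
begin

section \<open>Elementary properties of C*-algebras\<close>

text \<open>The norm is given only on A. Comparing the copies of A attached to different s needs
  \<open>\<alpha> s\<close> to preserve it, and comparing two dilations needs the same of the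
  embeddings; so isometry is derived from the C*-axioms, by polynomials and without spectra. The
  dilation algebra need not have a unit, so 1 - z and the constant term of a polynomial occur only
  as operators w |-> w - z w and w |-> c w on the algebra. The adjoint of such an operator T is
  expressed by star(T u) v = star(u) T'(v). The Ore property enters in two forms: a common multiple
  p s = q t brings two elements to one index, and G = S^-1 S yields for g and s an equation b g = a
  s, through which g acts on indices. S may lack an identity, so i(a) is not the copy of a at index
  1; it appears at every index s as \<open>\<alpha> s a\<close>. B is not obtained by completing a
  limit: the algebra of functions is closed under approximation along the filter from the start. The
  price is that representatives are controlled only eventually, on ideals that vary with the
  function.\<close>

context cstar_algebra
begin

lemma smult_in_carrier [simp, intro]: "x \<in> carrier A \<Longrightarrow> c \<odot> x \<in> carrier A"
  using smult_closed[of c x] by (simp add: complex_ring_def)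

lemma smult_add_left: "x \<in> carrier A \<Longrightarrow> (c + d) \<odot> x = c \<odot> x \<oplus> d \<odot> x"
  using smult_l_distr[of c d x] by (simp add: complex_ring_def)

lemma smult_add_right:
  "\<lbrakk>x \<in> carrier A; y \<in> carrier A\<rbrakk> \<Longrightarrow> c \<odot> (x \<oplus> y) = c \<odot> x \<oplus> c \<odot> y"
  using smult_r_distr[of c x y] by (simp add: complex_ring_def)

lemma smult_smult [simp]: "x \<in> carrier A \<Longrightarrow> c \<odot> (d \<odot> x) = (c * d) \<odot> x"
  using smult_assoc1[of c d x] by (simp add: complex_ring_def)

lemma smult_1 [simp]: "x \<in> carrier A \<Longrightarrow> 1 \<odot> x = x"
  using smult_one[of x] by (simp add: complex_ring_def)

lemma smult_0 [simp]: "x \<in> carrier A \<Longrightarrow> 0 \<odot> x = \<zero>"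
  using smult_l_null[of x] by (simp add: complex_ring_def)

lemma smult_zero [simp]: "c \<odot> \<zero> = \<zero>"
  using smult_r_null[of c] by (simp add: complex_ring_def)

lemma a_inv_eq_smult: "x \<in> carrier A \<Longrightarrow> \<ominus> x = (-1) \<odot> x"
proof -
  assume x: "x \<in> carrier A"
  have "(-1) \<odot> x \<oplus> x = \<zero>"
    using smult_add_left[of x "-1" 1] x by simp
  then show ?thesis
    using M.minus_equality[of "(-1) \<odot> x" x] x by simp
qed

lemma minus_eq_smult:
  "\<lbrakk>x \<in> carrier A; y \<in> carrier A\<rbrakk> \<Longrightarrow> x \<ominus> y = x \<oplus> (-1) \<odot> y"
  by (simp add: M.minus_eq a_inv_eq_smult)

lemma a_inv_zero [simp]: "\<ominus> \<zero> = \<zero>"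
  by (simp add: a_inv_eq_smult)

lemma zero_mult [simp]: "x \<in> carrier A \<Longrightarrow> \<zero> \<otimes> x = \<zero>"
  using smult_mult_left[of \<zero> x 0] by (simp add: mult_closed)

lemma mult_zero [simp]: "x \<in> carrier A \<Longrightarrow> x \<otimes> \<zero> = \<zero>"
  using smult_mult_right[of x \<zero> 0] by (simp add: mult_closed)

lemma star_zero [simp]: "star A \<zero> = \<zero>"
  using star_smult[of \<zero> 0] by (simp add: star_closed)

lemma l_minus: "\<lbrakk>x \<in> carrier A; y \<in> carrier A\<rbrakk> \<Longrightarrow> (\<ominus> x) \<otimes> y = \<ominus> (x \<otimes> y)"
  by (simp add: a_inv_eq_smult smult_mult_left mult_closed)

lemma r_minus: "\<lbrakk>x \<in> carrier A; y \<in> carrier A\<rbrakk> \<Longrightarrow> x \<otimes> (\<ominus> y) = \<ominus> (x \<otimes> y)"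
  by (simp add: a_inv_eq_smult smult_mult_right mult_closed)

lemma smult_minus: "x \<in> carrier A \<Longrightarrow> c \<odot> (\<ominus> x) = \<ominus> (c \<odot> x)"
  by (simp add: a_inv_eq_smult)

lemma star_minus: "x \<in> carrier A \<Longrightarrow> star A (\<ominus> x) = \<ominus> (star A x)"
  by (simp add: a_inv_eq_smult star_smult star_closed)

lemmas carrier_closed = M.a_closed M.zero_closed M.a_inv_closed M.minus_closed smult_in_carrier
  mult_closed star_closed

text \<open>Sums and products are expanded, with scalars and signs collected in front of each
  monomial. Scalars are not added, so equations such as x + x = 2x and relations between - k and k
  are handled outside \<open>algebra\<close>.\<close>

lemmas cstar_simprules
  [algebra cstar "zero A" "add A" "a_inv A" "a_minus A" "module.smult A" "monoid.mult A" "star A"] =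
  carrier_closed M.a_assoc M.l_zero M.l_neg M.a_comm M.minus_eq M.r_zero M.r_neg M.r_neg2
  M.r_neg1 M.minus_add M.minus_minus a_inv_zero M.a_lcomm
  mult_assoc mult_distrib_left mult_distrib_right zero_mult mult_zero l_minus r_minus
  smult_add_right smult_zero smult_minus smult_mult_left smult_mult_right smult_smult
  star_add star_mult star_star star_zero star_smult star_minus

lemma minus_add_minus:
  "\<lbrakk>x \<in> carrier A; y \<in> carrier A; z \<in> carrier A\<rbrakk> \<Longrightarrow> (x \<ominus> y) \<oplus> (y \<ominus> z) = x \<ominus> z"
  by algebra

lemma minus_self [simp]: "x \<in> carrier A \<Longrightarrow> x \<ominus> x = \<zero>"
  by algebra

lemma minus_zero_right [simp]: "x \<in> carrier A \<Longrightarrow> x \<ominus> \<zero> = x"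
  by algebra

lemma minus_add_cancel: "\<lbrakk>x \<in> carrier A; y \<in> carrier A\<rbrakk> \<Longrightarrow> (x \<ominus> y) \<oplus> y = x"
  by algebra

lemma minus_eq_zero_iff: "\<lbrakk>x \<in> carrier A; y \<in> carrier A\<rbrakk> \<Longrightarrow> x \<ominus> y = \<zero> \<longleftrightarrow> x = y"
  by (metis M.l_zero minus_add_cancel minus_self)

lemma nrm_zero [simp]: "nrm A \<zero> = 0"
  using nrm_eq_0[of \<zero>] by simp

lemma nrm_a_inv: "x \<in> carrier A \<Longrightarrow> nrm A (\<ominus> x) = nrm A x"
  by (simp add: a_inv_eq_smult nrm_smult)

lemma nrm_minus_commute:
  "\<lbrakk>x \<in> carrier A; y \<in> carrier A\<rbrakk> \<Longrightarrow> nrm A (x \<ominus> y) = nrm A (y \<ominus> x)"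
proof -
  assume "x \<in> carrier A" "y \<in> carrier A"
  moreover from this have "x \<ominus> y = \<ominus> (y \<ominus> x)" by algebra
  ultimately show ?thesis by (simp add: nrm_a_inv)
qed

lemma nrm_minus_triangle:
  "\<lbrakk>x \<in> carrier A; y \<in> carrier A; z \<in> carrier A\<rbrakk>
    \<Longrightarrow> nrm A (x \<ominus> z) \<le> nrm A (x \<ominus> y) + nrm A (y \<ominus> z)"
  using nrm_triangle[of "x \<ominus> y" "y \<ominus> z"] by (simp add: minus_add_minus)

lemma nrm_triangle2:
  "\<lbrakk>x \<in> carrier A; y \<in> carrier A\<rbrakk> \<Longrightarrow> \<bar>nrm A x - nrm A y\<bar> \<le> nrm A (x \<ominus> y)"
  using nrm_triangle[of "x \<ominus> y" y] nrm_triangle[of "y \<ominus> x" x] nrm_minus_commute[of x y]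
  by (simp add: minus_add_cancel)

lemma nrm_minus_eq_0:
  "\<lbrakk>x \<in> carrier A; y \<in> carrier A\<rbrakk> \<Longrightarrow> nrm A (x \<ominus> y) = 0 \<longleftrightarrow> x = y"
  by (simp add: nrm_eq_0 minus_eq_zero_iff)

text \<open>The C*-identity gives ||y||^2 = ||star(y) y|| \<le> ||star(y)|| ||y||. Cancelling ||y||
  and applying this to x and to star(x) yields both inequalities.\<close>

lemma nrm_star [simp]: "x \<in> carrier A \<Longrightarrow> nrm A (star A x) = nrm A x"
proof -
  have le: "nrm A y \<le> nrm A (star A y)" if y: "y \<in> carrier A" for y
  proof (cases "nrm A y = 0")
    case False
    have "nrm A y * nrm A y \<le> nrm A (star A y) * nrm A y"
      using nrm_star_mult[OF y] nrm_mult[of "star A y" y] y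
      by (simp add: star_closed power2_eq_square)
    then show ?thesis
      using False nrm_nonneg[OF y] by (simp add: mult_le_cancel_right)
  qed (simp add: y nrm_nonneg star_closed)
  show "nrm A (star A x) = nrm A x" if "x \<in> carrier A"
    using le[of x] le[of "star A x"] that by (simp add: star_closed star_star)
qed

lemma nrm_add_minus_add_le:
  assumes "x \<in> carrier A" "y \<in> carrier A" "x' \<in> carrier A" "y' \<in> carrier A"
  shows "nrm A ((x \<oplus> y) \<ominus> (x' \<oplus> y')) \<le> nrm A (x \<ominus> x') + nrm A (y \<ominus> y')"
proof -
  have "(x \<oplus> y) \<ominus> (x' \<oplus> y') = (x \<ominus> x') \<oplus> (y \<ominus> y')"
    using assms by algebra
  then show ?thesis
    using nrm_triangle[of "x \<ominus> x'" "y \<ominus> y'"] assms by simp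
qed

text \<open>Split the difference as x (y - y') + (x - x') y'. An application therefore has to bound
  one exact factor, x, and one approximating factor, y'.\<close>

lemma nrm_mult_minus_mult_le:
  assumes "x \<in> carrier A" "y \<in> carrier A" "x' \<in> carrier A" "y' \<in> carrier A"
  shows "nrm A (x \<otimes> y \<ominus> x' \<otimes> y')
    \<le> nrm A x * nrm A (y \<ominus> y') + nrm A (x \<ominus> x') * nrm A y'"
proof -
  have "x \<otimes> y \<ominus> x' \<otimes> y' = x \<otimes> (y \<ominus> y') \<oplus> (x \<ominus> x') \<otimes> y'"
    using assms by algebra
  then have "nrm A (x \<otimes> y \<ominus> x' \<otimes> y')
      \<le> nrm A (x \<otimes> (y \<ominus> y')) + nrm A ((x \<ominus> x') \<otimes> y')"
    using nrm_triangle assms by (simp add: mult_closed)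
  also have "\<dots> \<le> nrm A x * nrm A (y \<ominus> y') + nrm A (x \<ominus> x') * nrm A y'"
    using assms by (intro add_mono nrm_mult) auto
  finally show ?thesis .
qed

lemma smult_minus_smult: "\<lbrakk>x \<in> carrier A; y \<in> carrier A\<rbrakk> \<Longrightarrow> c \<odot> x \<ominus> c \<odot> y = c \<odot> (x \<ominus> y)"
  by algebra

lemma star_minus_star:
  "\<lbrakk>x \<in> carrier A; y \<in> carrier A\<rbrakk> \<Longrightarrow> star A x \<ominus> star A y = star A (x \<ominus> y)"
  by algebra

sublocale met: Metric_space "carrier A" "cstar_dist A"
  by (rule Metric_space_cstar_dist)

lemma Cauchy_convergent:
  assumes "\<And>n. \<sigma> n \<in> carrier A"
    and "\<And>e. 0 < e \<Longrightarrow> \<exists>N. \<forall>m\<ge>N. \<forall>n\<ge>N. nrm A (\<sigma> m \<ominus> \<sigma> n) < e"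
  obtains x where "x \<in> carrier A" "(\<lambda>n. nrm A (\<sigma> n \<ominus> x)) \<longlonglongrightarrow> 0"
proof -
  have "met.MCauchy \<sigma>"
    using assms unfolding met.MCauchy_def cstar_dist_def by fastforce
  then obtain x where x: "limitin met.mtopology \<sigma> x sequentially"
    using complete by (auto simp: met.mcomplete_def)
  then have xc: "x \<in> carrier A"
    by (simp add: met.limitin_metric)
  moreover have "(\<lambda>n. nrm A (\<sigma> n \<ominus> x)) \<longlonglongrightarrow> 0"
    using x assms(1) xc
    by (simp add: met.limitin_metric_dist_null cstar_dist_def)
  ultimately show thesis
    using that by blast
qed

end

section \<open>Limits and unitary multipliers\<close>

context cstar_algebra
begin

text \<open>The carrier is not a topological type, so convergence is transferred to the real-valued
  distance, where the limit calculus of the reals applies.\<close>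

definition converges_to :: "'i filter \<Rightarrow> ('i \<Rightarrow> 'a) \<Rightarrow> 'a \<Rightarrow> bool" where
  "converges_to F f x \<longleftrightarrow> ((\<lambda>i. nrm A (f i \<ominus> x)) \<longlongrightarrow> 0) F"

lemma converges_to_le:
  assumes "\<And>i. f i \<in> carrier A" "x \<in> carrier A" "(g \<longlongrightarrow> 0) F"
    and "eventually (\<lambda>i. nrm A (f i \<ominus> x) \<le> g i) F"
  shows "converges_to F f x"
  unfolding converges_to_def using assms
  by (intro tendsto_sandwich[OF _ assms(4) tendsto_const assms(3)]) (simp add: nrm_nonneg)

lemma converges_to_const: "x \<in> carrier A \<Longrightarrow> converges_to F (\<lambda>i. x) x"
  by (simp add: converges_to_def)

lemma converges_to_nrm:
  assumes "\<And>i. f i \<in> carrier A" "x \<in> carrier A" "converges_to F f x"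
  shows "((\<lambda>i. nrm A (f i)) \<longlongrightarrow> nrm A x) F"
proof -
  have "((\<lambda>i. nrm A (f i) - nrm A x) \<longlongrightarrow> 0) F"
    using assms(3) unfolding converges_to_def
    by (rule Lim_null_comparison[rotated]) (simp add: assms nrm_triangle2)
  then show ?thesis
    by (simp add: LIM_zero_iff)
qed

lemma converges_to_add:
  assumes "\<And>i. f i \<in> carrier A" "x \<in> carrier A" "converges_to F f x"
    and "\<And>i. g i \<in> carrier A" "y \<in> carrier A" "converges_to F g y"
  shows "converges_to F (\<lambda>i. f i \<oplus> g i) (x \<oplus> y)"
  using assms tendsto_add[OF assms(3,6)[unfolded converges_to_def]]
  by (intro converges_to_le[where g = "\<lambda>i. nrm A (f i \<ominus> x) + nrm A (g i \<ominus> y)"])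
    (auto simp: nrm_add_minus_add_le)

lemma converges_to_smult:
  assumes "\<And>i. f i \<in> carrier A" "x \<in> carrier A" "converges_to F f x"
  shows "converges_to F (\<lambda>i. c \<odot> f i) (c \<odot> x)"
  using assms tendsto_mult_right_zero[OF assms(3)[unfolded converges_to_def], of "cmod c"]
  by (simp add: converges_to_def smult_minus_smult nrm_smult)

lemma converges_to_star:
  assumes "\<And>i. f i \<in> carrier A" "x \<in> carrier A" "converges_to F f x"
  shows "converges_to F (\<lambda>i. star A (f i)) (star A x)"
  using assms by (simp add: converges_to_def star_minus_star)

lemma converges_to_mult:
  assumes "\<And>i. f i \<in> carrier A" "x \<in> carrier A" "converges_to F f x"
    and "\<And>i. g i \<in> carrier A" "y \<in> carrier A" "converges_to F g y"
  shows "converges_to F (\<lambda>i. f i \<otimes> g i) (x \<otimes> y)"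
proof -
  have "((\<lambda>i. nrm A (f i) * nrm A (g i \<ominus> y) + nrm A (f i \<ominus> x) * nrm A y)
      \<longlongrightarrow> nrm A x * 0 + 0 * nrm A y) F"
    using assms by (intro tendsto_intros converges_to_nrm) (auto simp: converges_to_def)
  then show ?thesis
    using assms by (intro converges_to_le) (auto simp: mult_closed nrm_mult_minus_mult_le)
qed

lemma converges_to_unique:
  assumes "F \<noteq> bot" "\<And>i. f i \<in> carrier A" "x \<in> carrier A" "y \<in> carrier A"
    and "converges_to F f x" "converges_to F f y"
  shows "x = y"
proof -
  have "((\<lambda>i. nrm A (f i \<ominus> x) + nrm A (f i \<ominus> y)) \<longlongrightarrow> 0 + 0) F"
    using assms by (intro tendsto_intros) (auto simp: converges_to_def)
  then have "nrm A (x \<ominus> y) \<le> 0 + 0"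
  proof (rule tendsto_lowerbound[OF _ _ assms(1)])
    show "eventually (\<lambda>i. nrm A (x \<ominus> y) \<le> nrm A (f i \<ominus> x) + nrm A (f i \<ominus> y)) F"
      using assms nrm_minus_triangle[of x "f _" y] by (simp add: nrm_minus_commute)
  qed
  then show ?thesis
    using assms nrm_nonneg[of "x \<ominus> y"] nrm_minus_eq_0[of x y] by simp
qed

text \<open>The final error bound depends only on \<open>C\<close>, \<open>r\<close> and
  \<open>n\<close>. Hence limits taken separately at each argument of a function are uniform
  approximations, which the completeness of the quotient relies on.\<close>

lemma geometric_convergent:
  assumes "\<And>n. \<sigma> n \<in> carrier A" "0 \<le> r" "r < 1"
    and step: "\<And>n. nrm A (\<sigma> (Suc n) \<ominus> \<sigma> n) \<le> C * r ^ n"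
  obtains x where "x \<in> carrier A" "converges_to sequentially \<sigma> x"
    "\<And>n. nrm A (\<sigma> n \<ominus> x) \<le> C * r ^ n / (1 - r)"
proof -
  have C: "0 \<le> C"
    using order_trans[OF nrm_nonneg step[of 0]] assms(1) by simp
  have *: "nrm A (\<sigma> (n + k) \<ominus> \<sigma> n) \<le> C * r ^ n * (1 - r ^ k) / (1 - r)" for n k
  proof (induction k)
    case (Suc k)
    have "nrm A (\<sigma> (n + Suc k) \<ominus> \<sigma> n)
        \<le> nrm A (\<sigma> (Suc (n + k)) \<ominus> \<sigma> (n + k)) + nrm A (\<sigma> (n + k) \<ominus> \<sigma> n)"
      using nrm_minus_triangle assms(1) by simp
    also have "\<dots> \<le> C * r ^ (n + k) + C * r ^ n * (1 - r ^ k) / (1 - r)"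
      using Suc step by (intro add_mono)
    also have "\<dots> = C * r ^ n * (1 - r ^ Suc k) / (1 - r)"
      using assms(3) by (simp add: field_simps power_add)
    finally show ?case .
  qed (simp add: assms)
  have bound: "nrm A (\<sigma> (n + k) \<ominus> \<sigma> n) \<le> C * r ^ n / (1 - r)" for n k
  proof -
    have "C * r ^ n * (1 - r ^ k) \<le> C * r ^ n * 1"
      using assms C by (intro mult_left_mono) auto
    then show ?thesis
      using *[of n k] assms(3) by (smt (verit) divide_right_mono mult.right_neutral)
  qed
  have bound': "nrm A (\<sigma> m \<ominus> \<sigma> n) \<le> C * r ^ N / (1 - r) + C * r ^ N / (1 - r)"
    if "N \<le> m" "N \<le> n" for m n N
    using nrm_minus_triangle[of "\<sigma> m" "\<sigma> N" "\<sigma> n"] bound[of N "m - N"] bound[of N "n - N"]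
      assms(1) that nrm_minus_commute[of "\<sigma> N" "\<sigma> n"] by simp
  have "(\<lambda>n. C * r ^ n / (1 - r) + C * r ^ n / (1 - r)) \<longlonglongrightarrow> C * 0 / (1 - r) + C * 0 / (1 - r)"
    using assms by (intro tendsto_intros LIMSEQ_realpow_zero) auto
  then have ev: "eventually (\<lambda>n. C * r ^ n / (1 - r) + C * r ^ n / (1 - r) < e) sequentially"
    if "0 < e" for e
    using that by (auto dest: order_tendstoD)
  obtain x where x: "x \<in> carrier A" "converges_to sequentially \<sigma> x"
  proof (rule Cauchy_convergent[of \<sigma>])
    show "\<exists>N. \<forall>m\<ge>N. \<forall>n\<ge>N. nrm A (\<sigma> m \<ominus> \<sigma> n) < e" if "0 < e" for e
      using ev[OF that] bound' unfolding eventually_sequentially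
      by (meson order.refl order_le_less_trans)
  qed (auto simp: assms converges_to_def)
  moreover have "nrm A (\<sigma> n \<ominus> x) \<le> C * r ^ n / (1 - r)" for n
  proof -
    have "(\<lambda>k. C * r ^ n / (1 - r) + nrm A (\<sigma> (k + n) \<ominus> x)) \<longlonglongrightarrow> C * r ^ n / (1 - r) + 0"
      using x LIMSEQ_ignore_initial_segment unfolding converges_to_def
      by (intro tendsto_intros) fast
    then have "nrm A (\<sigma> n \<ominus> x) \<le> C * r ^ n / (1 - r) + 0"
    proof (rule tendsto_lowerbound)
      have "nrm A (\<sigma> n \<ominus> x) \<le> C * r ^ n / (1 - r) + nrm A (\<sigma> (k + n) \<ominus> x)" for k
        using nrm_minus_triangle[of "\<sigma> n" "\<sigma> (k + n)" x] bound[of n k] x assms(1)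
          nrm_minus_commute[of "\<sigma> (k + n)" "\<sigma> n"] by (simp add: add.commute)
      then show "\<forall>\<^sub>F k in sequentially.
          nrm A (\<sigma> n \<ominus> x) \<le> C * r ^ n / (1 - r) + nrm A (\<sigma> (k + n) \<ominus> x)"
        by simp
    qed simp
    then show ?thesis by simp
  qed
  ultimately show thesis
    using that by blast
qed

section \<open>Unitary multipliers whose real part is a given self-adjoint element\<close>

lemma nrm_square_self_adjoint:
  "\<lbrakk>x \<in> carrier A; star A x = x\<rbrakk> \<Longrightarrow> nrm A (x \<otimes> x) = (nrm A x)\<^sup>2"
  using nrm_star_mult[of x] by simp

text \<open>The relation \<open>z \<oplus> z = x\<^sup>2 \<oplus> z\<^sup>2\<close> says that \<open>c = 1 - z\<close> satisfies \<open>x\<^sup>2 + c\<^sup>2 = 1\<close> in the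
  unitization, so that \<open>x + \<i>c\<close> is unitary there.\<close>

definition circle_pair :: "'a \<Rightarrow> 'a \<Rightarrow> bool" where
  "circle_pair x z \<longleftrightarrow> x \<in> carrier A \<and> z \<in> carrier A \<and> star A x = x \<and> star A z = z \<and>
     x \<otimes> z = z \<otimes> x \<and> z \<oplus> z = x \<otimes> x \<oplus> z \<otimes> z"

text \<open>z = 1 - sqrt(1 - x^2) is a fixed point of v |-> (x^2 + v^2)/2, reached by iteration from
  0. With r = ||x||^2 < 1 all iterates stay in the ball of radius r, where the map contracts by the
  factor r. Self-adjointness and commutation with x pass to the limit.\<close>

lemma exists_circle_pair:
  assumes x: "x \<in> carrier A" "star A x = x" and less: "nrm A x < 1"
  obtains z where "circle_pair x z"
proof -
  define r where "r = (nrm A x)\<^sup>2"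
  define z where "z = rec_nat \<zero> (\<lambda>_ v. (1/2) \<odot> (x \<otimes> x \<oplus> v \<otimes> v))"
  have z0: "z 0 = \<zero>" and zS: "z (Suc n) = (1/2) \<odot> (x \<otimes> x \<oplus> z n \<otimes> z n)" for n
    by (simp_all add: z_def)
  have r: "0 \<le> r" "r < 1"
    using less nrm_nonneg[OF x(1)] by (simp_all add: r_def power_less_one_iff)
  have zc [simp]: "z n \<in> carrier A" for n
    by (induction n) (simp_all add: z0 zS mult_closed x)
  have sa: "star A (z n) = z n" for n
    by (induction n) (simp_all add: z0 zS mult_closed x star_smult star_add star_mult)
  have comm: "x \<otimes> z n = z n \<otimes> x" for n
  proof (induction n)
    case (Suc n)
    have "x \<otimes> (z n \<otimes> z n) = (z n \<otimes> z n) \<otimes> x"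
      by (metis Suc mult_assoc x(1) zc)
    then show ?case
      by (simp add: zS mult_closed x smult_mult_left smult_mult_right mult_distrib_left
          mult_distrib_right mult_assoc)
  qed (simp add: z0 x)
  have bound: "nrm A (z n) \<le> r" for n
  proof (induction n)
    case (Suc n)
    have "nrm A (z (Suc n)) \<le> (nrm A (x \<otimes> x) + nrm A (z n \<otimes> z n)) / 2"
      using nrm_triangle[of "x \<otimes> x" "z n \<otimes> z n"] by (simp add: zS nrm_smult mult_closed x)
    also have "\<dots> = (r + (nrm A (z n))\<^sup>2) / 2"
      by (simp add: nrm_square_self_adjoint x sa r_def)
    also have "\<dots> \<le> (r + r * 1) / 2"
      unfolding power2_eq_square
      using Suc r nrm_nonneg[of "z n"] by (intro divide_right_mono add_left_mono mult_mono) auto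
    finally show ?case by simp
  qed (simp add: z0 r)
  have step: "nrm A (z (Suc n) \<ominus> z n) \<le> r * r ^ n" for n
  proof (induction n)
    case (Suc n)
    have "z (Suc (Suc n)) \<ominus> z (Suc n) = (1/2) \<odot> (z (Suc n) \<otimes> z (Suc n) \<ominus> z n \<otimes> z n)"
    proof -
      have "(1/2) \<odot> (x \<otimes> x \<oplus> v \<otimes> v) \<ominus> (1/2) \<odot> (x \<otimes> x \<oplus> w \<otimes> w) = (1/2) \<odot> (v \<otimes> v \<ominus> w \<otimes> w)"
        if "v \<in> carrier A" "w \<in> carrier A" for v w
        using that x(1) by algebra
      then show ?thesis
        by (metis zS zc)
    qed
    then have "nrm A (z (Suc (Suc n)) \<ominus> z (Suc n))
        = nrm A (z (Suc n) \<otimes> z (Suc n) \<ominus> z n \<otimes> z n) / 2"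
      by (simp add: nrm_smult mult_closed)
    also have "\<dots> \<le> (nrm A (z (Suc n)) * nrm A (z (Suc n) \<ominus> z n)
        + nrm A (z (Suc n) \<ominus> z n) * nrm A (z n)) / 2"
      by (intro divide_right_mono nrm_mult_minus_mult_le) auto
    also have "\<dots> \<le> (r * (r * r ^ n) + (r * r ^ n) * r) / 2"
      using Suc bound r by (intro divide_right_mono add_mono mult_mono) (auto simp: nrm_nonneg)
    finally show ?case by (simp add: algebra_simps)
  qed (use bound[of 1] in \<open>simp add: z0\<close>)
  obtain w where w: "w \<in> carrier A" "converges_to sequentially z w"
    by (rule geometric_convergent[of z r r, OF zc r step])
  have "converges_to sequentially (\<lambda>n. z (Suc n)) ((1/2) \<odot> (x \<otimes> x \<oplus> w \<otimes> w))"
    unfolding zS using w x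
    by (intro converges_to_smult converges_to_add converges_to_mult converges_to_const)
      (auto simp: mult_closed)
  moreover have "converges_to sequentially (\<lambda>n. z (Suc n)) w"
    using w(2) unfolding converges_to_def by (rule LIMSEQ_Suc)
  ultimately have "w = (1/2) \<odot> (x \<otimes> x \<oplus> w \<otimes> w)"
    using converges_to_unique[of sequentially "\<lambda>n. z (Suc n)"] w x by (simp add: mult_closed)
  then have "w \<oplus> w = (1/2 + 1/2) \<odot> (x \<otimes> x \<oplus> w \<otimes> w)"
    using smult_add_left[of "x \<otimes> x \<oplus> w \<otimes> w" "1/2" "1/2"] w x by (simp add: mult_closed)
  then have "w \<oplus> w = x \<otimes> x \<oplus> w \<otimes> w"
    using w x by (simp add: mult_closed)
  moreover have "star A w = w"
    using converges_to_unique[of sequentially z "star A w" w] converges_to_star[of z w] w sa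
    by (simp add: star_closed)
  moreover have "x \<otimes> w = w \<otimes> x"
  proof (rule converges_to_unique)
    show "converges_to sequentially (\<lambda>n. x \<otimes> z n) (x \<otimes> w)"
      using w x by (intro converges_to_mult converges_to_const) auto
    show "converges_to sequentially (\<lambda>n. x \<otimes> z n) (w \<otimes> x)"
      unfolding comm using w x by (intro converges_to_mult converges_to_const) auto
  qed (use w x in \<open>auto simp: mult_closed\<close>)
  ultimately show thesis
    using that[of w] w x unfolding circle_pair_def by blast
qed

text \<open>Left multiplication by x + k (1 - z), written without a unit.\<close>

definition circle_op :: "complex \<Rightarrow> 'a \<Rightarrow> 'a \<Rightarrow> 'a \<Rightarrow> 'a" where
  "circle_op k x z w = x \<otimes> w \<oplus> k \<odot> (w \<ominus> z \<otimes> w)"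

lemma circle_op_closed [simp]:
  "\<lbrakk>circle_pair x z; w \<in> carrier A\<rbrakk> \<Longrightarrow> circle_op k x z w \<in> carrier A"
  by (simp add: circle_op_def circle_pair_def mult_closed)

lemma smult_uminus: "x \<in> carrier A \<Longrightarrow> (- c) \<odot> x = \<ominus> (c \<odot> x)"
  by (simp add: a_inv_eq_smult)

text \<open>With c = 1 - z commuting with x, (x - k c) (x + k c) = x^2 - k^2 c^2 = x^2 + c^2 =
  1.\<close>

lemma circle_op_inverse:
  assumes p: "circle_pair x z" and w: "w \<in> carrier A" and k: "k * k = -1"
  shows "circle_op (- k) x z (circle_op k x z w) = w"
proof -
  have x: "x \<in> carrier A" and z: "z \<in> carrier A" and comm: "x \<otimes> z = z \<otimes> x"
    and e: "z \<oplus> z = x \<otimes> x \<oplus> z \<otimes> z"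
    using p by (auto simp: circle_pair_def)
  \<comment> \<open>The circle relation in the form x^2 = 2z - z^2, applied to w.\<close>
  have e': "x \<otimes> (x \<otimes> w) = (z \<otimes> w \<oplus> z \<otimes> w) \<ominus> z \<otimes> (z \<otimes> w)"
  proof -
    have "z \<otimes> w \<oplus> z \<otimes> w = (x \<otimes> x \<oplus> z \<otimes> z) \<otimes> w"
      using e x z w by (metis mult_distrib_right)
    then show ?thesis
      using x z w by algebra
  qed
  have c': "x \<otimes> (z \<otimes> w) = z \<otimes> (x \<otimes> w)"
    using comm x z w by (metis mult_assoc)
  have "circle_op (- k) x z (circle_op k x z w)
      = (x \<otimes> (x \<otimes> w) \<oplus> k \<odot> (x \<otimes> w) \<ominus> k \<odot> (x \<otimes> (z \<otimes> w))) \<ominus> k \<odot> (x \<otimes> w)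
        \<ominus> (k * k) \<odot> w \<oplus> (k * k) \<odot> (z \<otimes> w) \<oplus> k \<odot> (z \<otimes> (x \<otimes> w))
        \<oplus> (k * k) \<odot> (z \<otimes> w) \<ominus> (k * k) \<odot> (z \<otimes> (z \<otimes> w))"
    \<comment> \<open>The rules of \<open>algebra\<close> do not relate the scalar - k to k, so the
      outer - k is turned into a negative of the algebra beforehand.\<close>
    unfolding circle_op_def smult_uminus[OF M.minus_closed[OF
          M.a_closed[OF mult_closed[OF x w] smult_in_carrier[OF M.minus_closed[OF w mult_closed[OF z w]]]]
          mult_closed[OF z M.a_closed[OF mult_closed[OF x w] smult_in_carrier[OF M.minus_closed[OF w mult_closed[OF z w]]]]]]]
    using x z w by algebra
  also have "\<dots> = (x \<otimes> (x \<otimes> w) \<oplus> k \<odot> (x \<otimes> w) \<ominus> k \<odot> (x \<otimes> (z \<otimes> w))) \<ominus> k \<odot> (x \<otimes> w)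
        \<oplus> w \<ominus> z \<otimes> w \<oplus> k \<odot> (z \<otimes> (x \<otimes> w)) \<ominus> z \<otimes> w \<oplus> z \<otimes> (z \<otimes> w)"
  proof -
    have *: "(- 1) \<odot> v = \<ominus> v" if "v \<in> carrier A" for v
      using that by (simp add: a_inv_eq_smult)
    show ?thesis
      unfolding k *[OF w] *[OF mult_closed[OF z w]] *[OF mult_closed[OF z mult_closed[OF z w]]]
      using x z w by algebra
  qed
  also have "\<dots> = w"
    unfolding c' e' using x z w by algebra
  finally show ?thesis .
qed

text \<open>Regard star(w) v as an A-valued inner product. As x and z are self-adjoint and z enters
  with the coefficient k, the adjoint of the multiplier is obtained by conjugating k.\<close>

lemma star_circle_op_mult:
  assumes p: "circle_pair x z" and w: "w \<in> carrier A" "v \<in> carrier A"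
  shows "star A (circle_op k x z w) \<otimes> v = star A w \<otimes> circle_op (cnj k) x z v"
proof -
  have x: "x \<in> carrier A" and z: "z \<in> carrier A" and "star A x = x" "star A z = z"
    using p by (auto simp: circle_pair_def)
  then show ?thesis
    unfolding circle_op_def using w by algebra
qed

text \<open>For k = i or k = -i the conjugate of k is - k, so the adjoint is the inverse, and the
  C*-identity turns star(U w) U w = star(w) w into equality of norms.\<close>

lemma nrm_circle_op:
  assumes p: "circle_pair x z" and w: "w \<in> carrier A" and k: "k = \<i> \<or> k = - \<i>"
  shows "nrm A (circle_op k x z w) = nrm A w"
proof -
  have "star A (circle_op k x z w) \<otimes> circle_op k x z w
      = star A w \<otimes> circle_op (- k) x z (circle_op k x z w)"
    using star_circle_op_mult[OF p w circle_op_closed[OF p w]] k by auto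
  also have "\<dots> = star A w \<otimes> w"
    using k by (subst circle_op_inverse[OF p w]) auto
  finally have "(nrm A (circle_op k x z w))\<^sup>2 = (nrm A w)\<^sup>2"
    using nrm_star_mult p w by (metis circle_op_closed)
  then show ?thesis
    using nrm_nonneg p w by (simp add: power2_eq_iff_nonneg)
qed

lemma circle_op_add:
  assumes p: "circle_pair x z" and w: "w \<in> carrier A"
  shows "circle_op \<i> x z w \<oplus> circle_op (- \<i>) x z w = 2 \<odot> (x \<otimes> w)"
proof -
  have x: "x \<in> carrier A" and z: "z \<in> carrier A"
    using p by (auto simp: circle_pair_def)
  have "circle_op \<i> x z w \<oplus> circle_op (- \<i>) x z w = x \<otimes> w \<oplus> x \<otimes> w"
    unfolding circle_op_def smult_uminus[OF M.minus_closed[OF w mult_closed[OF z w]]]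
    using x z w by algebra
  also have "\<dots> = 2 \<odot> (x \<otimes> w)"
    using smult_add_left[of "x \<otimes> w" 1 1] x w by (simp add: mult_closed)
  finally show ?thesis .
qed

text \<open>2 x w is the sum of two elements of norm ||w||; taking w = x gives ||x||^2 \<le> ||x||.
  As \<open>circle_pair\<close> consists of equations only, it survives *-homomorphisms, and
  together with \<open>exists_circle_pair\<close> it expresses the size of x algebraically.\<close>

lemma circle_pair_nrm_le_1:
  assumes p: "circle_pair x z"
  shows "nrm A x \<le> 1"
proof -
  have x: "x \<in> carrier A" "star A x = x"
    using p by (auto simp: circle_pair_def)
  have "2 * nrm A (x \<otimes> x) = nrm A (circle_op \<i> x z x \<oplus> circle_op (- \<i>) x z x)"
    using circle_op_add[OF p x(1)] x by (simp add: nrm_smult mult_closed)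
  also have "\<dots> \<le> nrm A x + nrm A x"
    using nrm_triangle[of "circle_op \<i> x z x" "circle_op (- \<i>) x z x"] nrm_circle_op p x by simp
  finally have "nrm A x * nrm A x \<le> 1 * nrm A x"
    by (simp add: nrm_square_self_adjoint x power2_eq_square)
  then show ?thesis
    using nrm_nonneg[OF x(1)] by (metis less_eq_real_def linorder_not_le mult_le_cancel_right zero_less_one)
qed

end

section \<open>Polynomials in operators\<close>

text \<open>The coefficient is the k-th derivative at 0 divided by k!, and Cauchy's inequality on
  the unit circle bounds that derivative by k! M.\<close>

lemma norm_coeff_le:
  fixes p :: "complex poly"
  assumes "\<And>z. cmod z = 1 \<Longrightarrow> cmod (poly p z) \<le> M"
  shows "cmod (coeff p k) \<le> M"
proof -
  have "(deriv ^^ k) (poly p) = poly ((pderiv ^^ k) p)"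
  proof (induction k)
    case (Suc k)
    have "deriv (poly q) = poly (pderiv q)" for q :: "complex poly"
      by (intro ext DERIV_imp_deriv poly_DERIV)
    then show ?case
      by (simp add: Suc)
  qed simp
  moreover have "coeff ((pderiv ^^ k) p) 0 = fact k * coeff p k"
  proof (induction k arbitrary: p)
    case (Suc k)
    have "coeff ((pderiv ^^ Suc k) p) 0 = coeff ((pderiv ^^ k) (pderiv p)) 0"
      by (simp add: funpow_swap1)
    then show ?case
      by (simp only: Suc) (simp add: coeff_pderiv)
  qed simp
  moreover have "norm ((deriv ^^ k) (poly p) 0) \<le> fact k * M / 1 ^ k"
    by (rule Cauchy_inequality) (auto intro: holomorphic_intros continuous_intros assms)
  ultimately show ?thesis
    by (simp add: poly_0_coeff_0 norm_mult)
qed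

context cstar_algebra
begin

definition linear_op :: "('a \<Rightarrow> 'a) \<Rightarrow> bool" where
  "linear_op T \<longleftrightarrow> (\<forall>x\<in>carrier A. T x \<in> carrier A) \<and>
     (\<forall>x\<in>carrier A. \<forall>y\<in>carrier A. T (x \<oplus> y) = T x \<oplus> T y) \<and>
     (\<forall>c. \<forall>x\<in>carrier A. T (c \<odot> x) = c \<odot> T x)"

text \<open>Horner's scheme for p(T) w. Applying p(T) to a vector gives the constant term a meaning
  in an algebra without unit.\<close>

definition poly_op :: "('a \<Rightarrow> 'a) \<Rightarrow> complex poly \<Rightarrow> 'a \<Rightarrow> 'a" where
  "poly_op T p w = fold_coeffs (\<lambda>c v. c \<odot> w \<oplus> T v) p \<zero>"

lemma linear_op_closed [simp]: "\<lbrakk>linear_op T; x \<in> carrier A\<rbrakk> \<Longrightarrow> T x \<in> carrier A"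
  and linear_op_add: "\<lbrakk>linear_op T; x \<in> carrier A; y \<in> carrier A\<rbrakk> \<Longrightarrow> T (x \<oplus> y) = T x \<oplus> T y"
  and linear_op_smult: "\<lbrakk>linear_op T; x \<in> carrier A\<rbrakk> \<Longrightarrow> T (c \<odot> x) = c \<odot> T x"
  by (auto simp: linear_op_def)

lemma linear_op_zero [simp]: "linear_op T \<Longrightarrow> T \<zero> = \<zero>"
  using linear_op_smult[of T \<zero> 0] by simp

lemma linear_op_mult_left: "x \<in> carrier A \<Longrightarrow> linear_op ((\<otimes>) x)"
  by (simp add: linear_op_def mult_closed mult_distrib_left smult_mult_right)

lemma linear_op_smult_op: "linear_op T \<Longrightarrow> linear_op (\<lambda>v. c \<odot> T v)"
  by (simp add: linear_op_def smult_add_right mult.commute)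

lemma linear_op_circle_op: "circle_pair x z \<Longrightarrow> linear_op (circle_op k x z)"
proof -
  assume p: "circle_pair x z"
  then have xz: "x \<in> carrier A" "z \<in> carrier A"
    by (auto simp: circle_pair_def)
  have "circle_op k x z (v \<oplus> w) = circle_op k x z v \<oplus> circle_op k x z w"
    if "v \<in> carrier A" "w \<in> carrier A" for v w
    using xz that unfolding circle_op_def by algebra
  moreover have "circle_op k x z (c \<odot> v) = c \<odot> circle_op k x z v" if "v \<in> carrier A" for c v
  proof -
    have "circle_op k x z (c \<odot> v) = c \<odot> (x \<otimes> v) \<oplus> (k * c) \<odot> v \<ominus> (k * c) \<odot> (z \<otimes> v)"
      using xz that unfolding circle_op_def by algebra
    moreover have "c \<odot> circle_op k x z v = c \<odot> (x \<otimes> v) \<oplus> (c * k) \<odot> v \<ominus> (c * k) \<odot> (z \<otimes> v)"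
      using xz that unfolding circle_op_def by algebra
    ultimately show ?thesis
      by (simp add: mult.commute)
  qed
  ultimately show ?thesis
    using p by (simp add: linear_op_def)
qed

lemma poly_op_0 [simp]: "poly_op T 0 w = \<zero>"
  by (simp add: poly_op_def)

lemma poly_op_pCons [simp]:
  "\<lbrakk>linear_op T; w \<in> carrier A\<rbrakk> \<Longrightarrow> poly_op T (pCons c p) w = c \<odot> w \<oplus> T (poly_op T p w)"
  \<comment> \<open>\<open>fold_coeffs\<close> does not unfold on \<open>pCons 0 0\<close>; in that
    case both sides are zero because T maps zero to zero.\<close>
  by (cases "p = 0 \<and> c = 0") (auto simp: poly_op_def)

lemma poly_op_closed [simp]:
  "\<lbrakk>linear_op T; w \<in> carrier A\<rbrakk> \<Longrightarrow> poly_op T p w \<in> carrier A"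
  by (induction p) auto

lemma poly_op_add:
  assumes T: "linear_op T" and w: "w \<in> carrier A"
  shows "poly_op T (p + q) w = poly_op T p w \<oplus> poly_op T q w"
proof (induction p q rule: poly_induct2)
  case (pCons a p b q)
  have "(a \<odot> w \<oplus> b \<odot> w) \<oplus> (T (poly_op T p w) \<oplus> T (poly_op T q w))
      = (a \<odot> w \<oplus> T (poly_op T p w)) \<oplus> (b \<odot> w \<oplus> T (poly_op T q w))"
    using T w by (simp add: M.a_ac)
  then show ?case
    using T w pCons by (simp add: linear_op_add smult_add_left)
qed simp

lemma poly_op_smult:
  "\<lbrakk>linear_op T; w \<in> carrier A\<rbrakk> \<Longrightarrow> poly_op T (Polynomial.smult c p) w = c \<odot> poly_op T p w"
  by (induction p) (simp_all add: smult_add_right linear_op_smult)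

lemma poly_op_diff:
  assumes "linear_op T" "w \<in> carrier A"
  shows "poly_op T (p - q) w = poly_op T p w \<ominus> poly_op T q w"
  using poly_op_add[OF assms, of p "Polynomial.smult (-1) q"] poly_op_smult[OF assms, of "-1" q] assms
  by (simp add: minus_eq_smult)

lemma poly_op_mult:
  assumes T: "linear_op T" and w: "w \<in> carrier A"
  shows "poly_op T (p * q) w = poly_op T p (poly_op T q w)"
  using T w by (induction p) (simp_all add: poly_op_add poly_op_smult)

lemma linear_op_poly_op:
  assumes T: "linear_op T"
  shows "linear_op (poly_op T p)"
proof -
  have "poly_op T p (x \<oplus> y) = poly_op T p x \<oplus> poly_op T p y"
    if "x \<in> carrier A" "y \<in> carrier A" for x y
  proof (induction p)
    case (pCons a p)
    have "(a \<odot> x \<oplus> a \<odot> y) \<oplus> (T (poly_op T p x) \<oplus> T (poly_op T p y))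
      = (a \<odot> x \<oplus> T (poly_op T p x)) \<oplus> (a \<odot> y \<oplus> T (poly_op T p y))"
      using T that by (simp add: M.a_ac)
    then show ?case
      using T that pCons by (simp add: linear_op_add smult_add_right)
  qed simp
  moreover have "poly_op T p (c \<odot> x) = c \<odot> poly_op T p x" if "x \<in> carrier A" for c x
    using T that by (induction p) (simp_all add: linear_op_smult smult_add_right mult.commute)
  ultimately show ?thesis
    using T by (simp add: linear_op_def)
qed

lemma poly_op_commute:
  assumes "linear_op T" "w \<in> carrier A"
  shows "T (poly_op T p w) = poly_op T p (T w)"
  using assms by (induction p) (simp_all add: linear_op_add linear_op_smult)

lemma poly_op_power:
  assumes T: "linear_op T" and w: "w \<in> carrier A"
  shows "poly_op T (p ^ n) w = (poly_op T p ^^ n) w"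
proof (induction n)
  case 0
  have "poly_op T [:1:] w = w"
    using assms by simp
  then show ?case by (simp add: one_pCons)
qed (use assms in \<open>simp_all add: poly_op_mult\<close>)

lemma poly_op_pcompose_scale:
  assumes T: "linear_op T" and w: "w \<in> carrier A"
  shows "poly_op (\<lambda>v. c \<odot> T v) p w = poly_op T (pcompose p [:0, c:]) w"
proof (induction p)
  case (pCons a p)
  have "pcompose (pCons a p) [:0, c:] = pCons a (Polynomial.smult c (pcompose p [:0, c:]))"
    by (simp add: pcompose_pCons)
  then show ?case
    using assms pCons linear_op_smult_op[OF T]
    by (simp add: poly_op_smult linear_op_smult)
qed simp

text \<open>p(T) w is a sum of at most n + 1 terms c T^k w, and each has norm at most M ||w|| since
  T is a contraction.\<close>

lemma nrm_poly_op_le_sum: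
  assumes T: "linear_op T" and contr: "\<And>v. v \<in> carrier A \<Longrightarrow> nrm A (T v) \<le> nrm A v"
    and w: "w \<in> carrier A" and M: "\<And>k. cmod (coeff p k) \<le> M" and deg: "degree p \<le> n"
  shows "nrm A (poly_op T p w) \<le> real (Suc n) * M * nrm A w"
  using M deg
proof (induction n arbitrary: p)
  case 0
  then obtain c where "p = [:c:]"
    by (metis degree_eq_zeroE le_zero_eq)
  then show ?case
    using 0(1)[of 0] T w nrm_nonneg[OF w] by (simp add: nrm_smult mult_right_mono)
next
  case (Suc n)
  obtain c q where p: "p = pCons c q"
    by (cases p)
  have q: "cmod (coeff q k) \<le> M" for k
    using Suc(2)[of "Suc k"] p by simp
  have "degree q \<le> n"
    using Suc(3) p by (auto simp: degree_pCons_eq_if split: if_splits)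
  then have "nrm A (poly_op T q w) \<le> real (Suc n) * M * nrm A w"
    using Suc(1) q by blast
  moreover have "cmod c * nrm A w \<le> M * nrm A w"
    using Suc(2)[of 0] p nrm_nonneg[OF w] by (simp add: mult_right_mono)
  moreover have "nrm A (poly_op T p w) \<le> cmod c * nrm A w + nrm A (T (poly_op T q w))"
    using nrm_triangle[of "c \<odot> w" "T (poly_op T q w)"] T w by (simp add: p nrm_smult)
  ultimately show ?case
    using contr[of "poly_op T q w"] T w by (simp add: algebra_simps)
qed

text \<open>The Joukowski substitution \<open>t = (z + 1/z)/2\<close>: multiplied by \<open>z\<^sup>m\<close>, it turns a polynomial of
  degree at most \<open>m\<close> in \<open>t\<close> into one of degree at most \<open>2m\<close> in \<open>z\<close>.\<close>

lemma poly_op_joukowski: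
  assumes U: "linear_op U" and V: "linear_op V" and T: "linear_op T"
    and inv: "\<And>w. w \<in> carrier A \<Longrightarrow> U (V w) = w" "\<And>w. w \<in> carrier A \<Longrightarrow> V (U w) = w"
    and UV: "\<And>w. w \<in> carrier A \<Longrightarrow> U w \<oplus> V w = 2 \<odot> T w"
    and deg: "degree p \<le> m"
  obtains P where "degree P \<le> 2 * m"
    "\<And>z. cmod z = 1 \<Longrightarrow> poly P z = z ^ m * poly p (of_real (Re z))"
    "\<And>w. w \<in> carrier A \<Longrightarrow> poly_op U P w = (U ^^ m) (poly_op T p w)"
proof -
  \<comment> \<open>U applied to U + V = 2T. The resulting relation U^2 + 1 = 2UT no longer mentions
    the inverse V, so polynomials in U suffice.\<close>
  have UU: "U (U w) \<oplus> w = 2 \<odot> U (T w)" if "w \<in> carrier A" for w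
  proof -
    have "U (U w \<oplus> V w) = U (2 \<odot> T w)"
      using UV that by simp
    then show ?thesis
      using that U V T inv by (simp add: linear_op_add linear_op_smult)
  qed
  have TU: "T (U w) = U (T w)" if "w \<in> carrier A" for w
  proof -
    have "2 \<odot> T (U w) = 2 \<odot> U (T w)"
      using UV[of "U w"] UU[OF that] that U inv by simp
    then have "(1/2) \<odot> (2 \<odot> T (U w)) = (1/2) \<odot> (2 \<odot> U (T w))"
      by simp
    then show ?thesis
      using that U T by simp
  qed
  have Um [simp]: "(U ^^ m) w \<in> carrier A" if "w \<in> carrier A" for w m
    using that U by (induction m) auto
  have TUm: "T ((U ^^ m) w) = (U ^^ m) (T w)" if "w \<in> carrier A" for w m
    using that T by (induction m) (simp_all add: TU)
  have Um_add: "(U ^^ m) (v \<oplus> w) = (U ^^ m) v \<oplus> (U ^^ m) w"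
    if "v \<in> carrier A" "w \<in> carrier A" for v w m
    using that U by (induction m) (simp_all add: linear_op_add)
  have Um_smult: "(U ^^ m) (c \<odot> w) = c \<odot> (U ^^ m) w" if "w \<in> carrier A" for w m c
    using that U by (induction m) (simp_all add: linear_op_smult)
  have monom_op: "poly_op U (monom c m) w = c \<odot> (U ^^ m) w" if "w \<in> carrier A" for c m w
    using that U by (induction m) (simp_all add: monom_0 monom_Suc linear_op_smult)
  have "\<exists>P. degree P \<le> 2 * m \<and>
      (\<forall>z. cmod z = 1 \<longrightarrow> poly P z = z ^ m * poly p (of_real (Re z))) \<and>
      (\<forall>w\<in>carrier A. poly_op U P w = (U ^^ m) (poly_op T p w))"
    using deg
  proof (induction m arbitrary: p)
    case 0
    then obtain c where p: "p = [:c:]"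
      by (metis degree_eq_zeroE le_zero_eq)
    show ?case
      by (rule exI[of _ p]) (use T U in \<open>simp add: p\<close>)
  next
    case (Suc m)
    obtain c q where p: "p = pCons c q"
      by (cases p)
    have "degree q \<le> m"
      using Suc(2) p by (auto simp: degree_pCons_eq_if split: if_splits)
    then obtain P where P: "degree P \<le> 2 * m"
      and Pz: "\<And>z. cmod z = 1 \<Longrightarrow> poly P z = z ^ m * poly q (of_real (Re z))"
      and Pw: "\<And>w. w \<in> carrier A \<Longrightarrow> poly_op U P w = (U ^^ m) (poly_op T q w)"
      using Suc(1) by blast
    \<comment> \<open>For p(t) = c + t q(t), z^(m+1) p(t) = c z^(m+1) + (z t) (z^m q(t)), and z t =
      (1 + z^2)/2 accounts for the quadratic factor.\<close>
    define Q where "Q = monom c (Suc m) + [:1/2, 0, 1/2:] * P"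
    have "degree ([:1/2, 0, 1/2:] * P) \<le> 2 * Suc m"
      using degree_mult_le[of "[:1/2, 0, 1/2 :: complex:]" P] P by simp
    moreover have "degree (monom c (Suc m)) \<le> 2 * Suc m"
      using degree_monom_le[of c "Suc m"] by simp
    ultimately have "degree Q \<le> 2 * Suc m"
      unfolding Q_def by (rule degree_add_le[rotated])
    moreover have "poly Q z = z ^ Suc m * poly p (of_real (Re z))" if z: "cmod z = 1" for z
    proof -
      \<comment> \<open>On the unit circle 1/z is the conjugate of z, so z Re z = (1 +
        z^2)/2.\<close>
      have "z * cnj z = 1"
        using z complex_norm_square[of z] by simp
      then have "1 + z * z = z * (z + cnj z)"
        by (simp add: distrib_left)
      then have e: "1 + z * z = 2 * z * of_real (Re z)"
        by (simp add: complex_add_cnj)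
      have "poly Q z = c * z ^ Suc m + (1 + z * z) / 2 * poly P z"
        by (simp add: Q_def poly_monom algebra_simps add_divide_distrib)
      then show ?thesis
        unfolding e
        using Pz[OF z] by (simp add: p algebra_simps)
    qed
    moreover have "poly_op U Q w = (U ^^ Suc m) (poly_op T p w)" if w: "w \<in> carrier A" for w
    proof -
      define v where "v = (U ^^ m) (poly_op T q w)"
      have v: "v \<in> carrier A"
        using w T by (simp add: v_def)
      have "poly_op U [:1/2, 0, 1/2:] v = (1/2) \<odot> (U (U v) \<oplus> v)"
        using U v by (simp add: linear_op_smult smult_add_right M.a_ac)
      also have "\<dots> = U (T v)"
        using UU[OF v] U T v by simp
      finally have "poly_op U Q w = c \<odot> (U ^^ Suc m) w \<oplus> U (T v)"
        by (simp only: Q_def poly_op_add[OF U w] poly_op_mult[OF U w] Pw[OF w] monom_op[OF w] v_def)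
      also have "\<dots> = (U ^^ Suc m) (poly_op T p w)"
        using w T U by (simp add: p v_def TUm Um_add Um_smult linear_op_add linear_op_smult)
      finally show ?thesis .
    qed
    ultimately show ?case by blast
  qed
  then show thesis
    using that by blast
qed

text \<open>With m the degree of p, p(x) w has the same norm as U^m p(x) w = P(U) w, because U
  preserves norms. On the unit circle |P(z)| = |p(Re z)| \<le> M, so each of the at most 2m + 1
  coefficients of P is bounded by M.\<close>

lemma nrm_poly_op_weak:
  assumes x: "x \<in> carrier A" "star A x = x" "nrm A x < 1" and w: "w \<in> carrier A"
    and M: "\<And>t. \<bar>t\<bar> \<le> 1 \<Longrightarrow> cmod (poly p (of_real t)) \<le> M"
  shows "nrm A (poly_op ((\<otimes>) x) p w) \<le> real (2 * degree p + 1) * M * nrm A w"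
proof -
  obtain z where p: "circle_pair x z"
    using exists_circle_pair x by blast
  let ?U = "circle_op \<i> x z" and ?V = "circle_op (- \<i>) x z" and ?T = "(\<otimes>) x"
  have U: "linear_op ?U" and V: "linear_op ?V" and T: "linear_op ?T"
    using p x by (simp_all add: linear_op_circle_op linear_op_mult_left)
  have UV: "?U (?V v) = v" if "v \<in> carrier A" for v
    using circle_op_inverse[OF p that, of "- \<i>"] by simp
  have VU: "?V (?U v) = v" if "v \<in> carrier A" for v
    using circle_op_inverse[OF p that, of "\<i>"] by simp
  obtain P where P: "degree P \<le> 2 * degree p"
    "\<And>z. cmod z = 1 \<Longrightarrow> poly P z = z ^ degree p * poly p (of_real (Re z))"
    "\<And>w. w \<in> carrier A \<Longrightarrow> poly_op ?U P w = (?U ^^ degree p) (poly_op ?T p w)"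
    by (rule poly_op_joukowski[OF U V T UV VU circle_op_add[OF p] order.refl]) blast+
  have "nrm A ((?U ^^ n) v) = nrm A v \<and> (?U ^^ n) v \<in> carrier A" if "v \<in> carrier A" for n v
    using that p by (induction n) (simp_all add: nrm_circle_op)
  then have "nrm A (poly_op ?T p w) = nrm A (poly_op ?U P w)"
    using P(3)[OF w] T w by simp
  also have "\<dots> \<le> real (Suc (2 * degree p)) * M * nrm A w"
  proof (rule nrm_poly_op_le_sum[OF U _ w _ P(1)])
    show "cmod (coeff P k) \<le> M" for k
    proof (rule norm_coeff_le)
      fix z assume z: "cmod z = 1"
      then show "cmod (poly P z) \<le> M"
        using M[of "Re z"] abs_Re_le_cmod[of z] P(2)[OF z] by (simp add: norm_mult norm_power)
    qed
  qed (simp add: nrm_circle_op p)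
  finally show ?thesis by simp
qed

end

section \<open>Injective *-homomorphisms are isometric\<close>

text \<open>If b < a, then (D n + 1) (b/a)^n tends to 0: the linear factor cannot compensate for
  exponential decay.\<close>

lemma le_of_power2_growth:
  fixes a b D :: real
  assumes "0 \<le> a" "0 \<le> b" and le: "\<And>k. a ^ (2 ^ k) \<le> (D * 2 ^ k + 1) * b ^ (2 ^ k)"
  shows "a \<le> b"
proof (rule ccontr)
  assume "\<not> a \<le> b"
  then have a: "b < a" "0 < a"
    using assms by auto
  define c where "c = b / a"
  have c: "0 \<le> c" "c < 1"
    using a assms by (auto simp: c_def)
  have "(\<lambda>n. D * (real n * c ^ n) + c ^ n) \<longlonglongrightarrow> D * 0 + 0"
    using c by (intro tendsto_add tendsto_mult[OF tendsto_const] powser_times_n_limit_0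
        LIMSEQ_realpow_zero) auto
  then have "eventually (\<lambda>n. D * (real n * c ^ n) + c ^ n < 1) sequentially"
    by (rule order_tendstoD(2)) simp
  then obtain N where N: "\<And>n. N \<le> n \<Longrightarrow> D * (real n * c ^ n) + c ^ n < 1"
    by (auto simp: eventually_sequentially)
  \<comment> \<open>The hypothesis covers only exponents that are powers of 2, and 2^N is at least
    N.\<close>
  define n :: nat where "n = 2 ^ N"
  have "N \<le> n"
    unfolding n_def using less_exp[of N] by simp
  have "a ^ n \<le> (D * real n + 1) * b ^ n"
    using le[of N] by (simp add: n_def)
  also have "b ^ n = c ^ n * a ^ n"
    using a by (simp add: c_def power_divide)
  finally have "1 * a ^ n \<le> (D * (real n * c ^ n) + c ^ n) * a ^ n"
    by (simp add: algebra_simps)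
  then have "1 \<le> D * (real n * c ^ n) + c ^ n"
    using a by (simp add: mult_le_cancel_right)
  then show False
    using N[OF \<open>N \<le> n\<close>] by simp
qed

text \<open>Weierstrass approximation. Real coefficients are recorded because p(x) is then
  self-adjoint for self-adjoint x, which the sharp norm bound requires of p.\<close>

lemma real_poly_approximation:
  fixes f :: "real \<Rightarrow> real"
  assumes "continuous_on {-R..R} f" "0 < e"
  obtains p :: "complex poly" where "\<And>k. cnj (coeff p k) = coeff p k"
    "\<And>t. \<bar>t\<bar> \<le> R \<Longrightarrow> cmod (poly p (of_real t) - of_real (f t)) \<le> e"
proof -
  obtain g where g: "real_polynomial_function g" "\<And>t. t \<in> {-R..R} \<Longrightarrow> \<bar>f t - g t\<bar> < e"
    using Stone_Weierstrass_real_polynomial_function[OF compact_Icc assms] by blast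
  then obtain a n where a: "g = (\<lambda>x. \<Sum>i\<le>n. a i * x ^ i)"
    by (auto simp: real_polynomial_function_iff_sum)
  define p :: "complex poly" where "p = (\<Sum>i\<le>n. monom (of_real (a i)) i)"
  have "poly p (of_real t) = of_real (g t)" for t
    by (simp add: p_def a poly_sum poly_monom)
  then have "cmod (poly p (of_real t) - of_real (f t)) = \<bar>g t - f t\<bar>" for t
    by (metis norm_of_real of_real_diff)
  then have "cmod (poly p (of_real t) - of_real (f t)) \<le> e" if "\<bar>t\<bar> \<le> R" for t
    using g(2)[of t] that by (simp add: abs_le_iff abs_less_iff)
  moreover have "cnj (coeff p k) = coeff p k" for k
    by (simp add: p_def coeff_sum if_distrib cong: if_cong)
  ultimately show thesis
    using that[of p] by blast
qed

section \<open>The sharp norm bound for real polynomials in a self-adjoint element\<close>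

context cstar_algebra
begin

text \<open>Self-adjointness of p(x) for the pairing star(w) v. In the induction the factor x moves
  from the left argument to v, hence v is arbitrary, and commutes with p(x) there.\<close>

lemma star_poly_op_mult:
  assumes x: "x \<in> carrier A" "star A x = x" and w: "w \<in> carrier A" "v \<in> carrier A"
    and real: "\<And>k. cnj (coeff p k) = coeff p k"
  shows "star A (poly_op ((\<otimes>) x) p w) \<otimes> v = star A w \<otimes> poly_op ((\<otimes>) x) p v"
  using real w(2)
proof (induction p arbitrary: v)
  case (pCons c p)
  define y where "y = poly_op ((\<otimes>) x) p w"
  have T: "linear_op ((\<otimes>) x)"
    using x linear_op_mult_left by blast
  have y: "y \<in> carrier A"
    using T w by (simp add: y_def)
  have c: "cnj c = c"
    using pCons(3)[of 0] by simp
  have IH: "star A y \<otimes> (x \<otimes> v) = star A w \<otimes> poly_op ((\<otimes>) x) p (x \<otimes> v)"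
    unfolding y_def
  proof (rule pCons(2))
    show "cnj (coeff p k) = coeff p k" for k
      using pCons(3)[of "Suc k"] by simp
  qed (simp add: x pCons mult_closed)
  have "star A (poly_op ((\<otimes>) x) (pCons c p) w) \<otimes> v
      = c \<odot> (star A w \<otimes> v) \<oplus> star A y \<otimes> (x \<otimes> v)"
    using T w x y pCons(4) c
    by (simp add: star_add star_smult star_mult star_closed mult_closed mult_distrib_right
        smult_mult_left mult_assoc flip: y_def)
  then show ?case
    using T w x pCons(4)
    by (simp add: IH poly_op_commute[OF T] star_closed mult_distrib_left smult_mult_right mult_closed)
qed (use w in \<open>simp add: star_closed\<close>)

lemma poly_op_cong:
  assumes "linear_op T" "linear_op T'" "\<And>v. v \<in> carrier A \<Longrightarrow> T v = T' v" "w \<in> carrier A"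
  shows "poly_op T p w = poly_op T' p w"
  using assms by (induction p) auto

text \<open>The C*-identity applied to the powers \<open>p\<^sup>n\<close> with \<open>n = 2\<^sup>k\<close> removes the factor linear in the
  degree from the bound \<open>nrm_poly_op_weak\<close>.\<close>

lemma nrm_poly_op_le_unit:
  assumes x: "x \<in> carrier A" "star A x = x" "nrm A x < 1" and w: "w \<in> carrier A"
    and real: "\<And>k. cnj (coeff p k) = coeff p k"
    and M: "\<And>t. \<bar>t\<bar> \<le> 1 \<Longrightarrow> cmod (poly p (of_real t)) \<le> M"
  shows "nrm A (poly_op ((\<otimes>) x) p w) \<le> M * nrm A w"
proof -
  define T where "T = poly_op ((\<otimes>) x) p"
  define W where "W = nrm A w"
  have L: "linear_op ((\<otimes>) x)"
    using x linear_op_mult_left by blast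
  have W: "0 \<le> W"
    using w by (simp add: W_def nrm_nonneg)
  have M0: "0 \<le> M"
    using order_trans[OF norm_ge_zero M[of 0]] by simp
  have Tc: "(T ^^ n) v \<in> carrier A" if "v \<in> carrier A" for n v
    using that L by (induction n) (simp_all add: T_def)
  have adj: "star A ((T ^^ n) u) \<otimes> v = star A u \<otimes> (T ^^ n) v"
    if "u \<in> carrier A" "v \<in> carrier A" for u v n
    using that
  proof (induction n arbitrary: v)
    case (Suc n)
    have "star A ((T ^^ Suc n) u) \<otimes> v = star A ((T ^^ n) u) \<otimes> T v"
      using star_poly_op_mult[OF x(1,2) Tc[OF Suc(2)] Suc(3) real] by (simp add: T_def)
    then show ?case
      using Suc Tc[of v 1] by (simp add: funpow_swap1)
  qed simp
  \<comment> \<open>With n = 2^k this is (||T w|| / W)^n \<le> ||T^n w|| / W, cleared of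
    denominators. The doubling step is ||T^n w||^2 = ||star(w) T^(2n) w|| \<le> W ||T^(2n)
    w||.\<close>
  have "nrm A (T w) ^ (2 ^ k) * W \<le> W ^ (2 ^ k) * nrm A ((T ^^ (2 ^ k)) w)" for k
  proof (induction k)
    case 0
    show ?case by (simp add: mult.commute)
  next
    case (Suc k)
    define n :: nat where "n = 2 ^ k"
    have "(nrm A ((T ^^ n) w))\<^sup>2 = nrm A (star A w \<otimes> (T ^^ n) ((T ^^ n) w))"
      using nrm_star_mult[OF Tc[OF w]] adj[OF w Tc[OF w]] by metis
    also have "\<dots> \<le> W * nrm A ((T ^^ n) ((T ^^ n) w))"
      using nrm_mult[of "star A w" "(T ^^ n) ((T ^^ n) w)"] Tc w by (simp add: W_def star_closed)
    also have "(T ^^ n) ((T ^^ n) w) = (T ^^ (2 * n)) w"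
      by (simp add: funpow_add mult_2)
    finally have sq: "(nrm A ((T ^^ n) w))\<^sup>2 \<le> W * nrm A ((T ^^ (2 * n)) w)" .
    have "(nrm A (T w) ^ n * W)\<^sup>2 \<le> (W ^ n * nrm A ((T ^^ n) w))\<^sup>2"
      using Suc W nrm_nonneg[OF Tc[OF w, of 1]] by (intro power_mono) (auto simp: n_def)
    also have "\<dots> \<le> (W ^ n)\<^sup>2 * (W * nrm A ((T ^^ (2 * n)) w))"
      unfolding power_mult_distrib using sq by (intro mult_left_mono) auto
    finally have **: "(nrm A (T w) ^ n * W)\<^sup>2 \<le> (W ^ n)\<^sup>2 * (W * nrm A ((T ^^ (2 * n)) w))" .
    have square: "c ^ (2 * n) = c ^ n * c ^ n" for c :: real
      by (simp add: mult_2 power_add)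
    from ** have *: "(nrm A (T w) ^ (2 * n) * W) * W \<le> (W ^ (2 * n) * nrm A ((T ^^ (2 * n)) w)) * W"
      unfolding square by (simp only: power_mult_distrib power2_eq_square mult_ac)
    show ?case
    proof (cases "W = 0")
      case False
      then show ?thesis
        using * W by (simp add: n_def mult_le_cancel_right)
    qed (simp add: power_0_left)
  qed
  then have key: "nrm A (T w) ^ (2 ^ k) * W \<le> W ^ (2 ^ k) * nrm A ((T ^^ (2 ^ k)) w)" for k .
  show ?thesis
  proof (cases "W = 0")
    case True
    then have "w = \<zero>"
      using nrm_eq_0[OF w] by (simp add: W_def)
    then show ?thesis
      using linear_op_poly_op[OF L] by simp
  next
    case False
    \<comment> \<open>p^n is bounded by M^n and has degree at most n times that of p, so the weak
      bound loses only a factor linear in n, which disappears on taking n-th roots.\<close>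
    have "nrm A (T w) ^ (2 ^ k) \<le> (2 * real (degree p) * 2 ^ k + 1) * (M * W) ^ (2 ^ k)" for k
    proof -
      define n :: nat where "n = 2 ^ k"
      have "nrm A (poly_op ((\<otimes>) x) (p ^ n) w) \<le> real (2 * degree (p ^ n) + 1) * M ^ n * W"
        unfolding W_def
        by (rule nrm_poly_op_weak[OF x w]) (simp add: norm_power power_mono M)
      also have "\<dots> \<le> real (2 * (degree p * n) + 1) * M ^ n * W"
      proof -
        have "real (2 * degree (p ^ n) + 1) \<le> real (2 * (degree p * n) + 1)"
          using degree_power_le[of p n] by (simp only: of_nat_le_iff)
        then show ?thesis
          using M0 W by (intro mult_right_mono) auto
      qed
      finally have "nrm A ((T ^^ n) w) \<le> ((2 * degree p) * real n + 1) * M ^ n * W"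
        by (simp add: T_def poly_op_power[OF L w] algebra_simps)
      then have "W ^ n * nrm A ((T ^^ n) w) \<le> W ^ n * (((2 * degree p) * real n + 1) * M ^ n * W)"
        using W by (intro mult_left_mono) auto
      then have "nrm A (T w) ^ n * W \<le> (((2 * degree p) * real n + 1) * (M * W) ^ n) * W"
        using key[of k] by (simp add: n_def power_mult_distrib mult_ac)
      then have "nrm A (T w) ^ n \<le> ((2 * degree p) * real n + 1) * (M * W) ^ n"
        using False W by (simp add: mult_le_cancel_right)
      then show ?thesis
        by (simp add: n_def)
    qed
    then show ?thesis
      using le_of_power2_growth[of "nrm A (T w)" "M * W" "2 * degree p"] M0 W nrm_nonneg[OF Tc[OF w, of 1]]
      by (simp add: T_def W_def)
  qed
qed

text \<open>Rescaling y = x/R and q(t) = p(R t) reduces to the unit ball. A free radius matters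
  later, where x and its image are tested on intervals of different length.\<close>

lemma nrm_poly_op_le:
  assumes x: "x \<in> carrier A" "star A x = x" "nrm A x < R" and w: "w \<in> carrier A"
    and real: "\<And>k. cnj (coeff p k) = coeff p k"
    and M: "\<And>t. \<bar>t\<bar> \<le> R \<Longrightarrow> cmod (poly p (of_real t)) \<le> M"
  shows "nrm A (poly_op ((\<otimes>) x) p w) \<le> M * nrm A w"
proof -
  have R: "0 < R"
    using x(3) nrm_nonneg[OF x(1)] by simp
  define y where "y = of_real (1/R) \<odot> x"
  define q where "q = pcompose p [:0, of_real R:]"
  have y: "y \<in> carrier A" "star A y = y" "nrm A y < 1"
    using x R by (simp_all add: y_def star_smult nrm_smult norm_divide)
  have "poly_op ((\<otimes>) x) p w = poly_op (\<lambda>v. of_real R \<odot> (y \<otimes> v)) p w"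
    using x y w R
    by (intro poly_op_cong linear_op_smult_op linear_op_mult_left)
      (auto simp: y_def smult_mult_left mult_closed)
  also have "\<dots> = poly_op ((\<otimes>) y) q w"
    unfolding q_def using y w by (intro poly_op_pcompose_scale linear_op_mult_left) auto
  finally have "nrm A (poly_op ((\<otimes>) x) p w) = nrm A (poly_op ((\<otimes>) y) q w)"
    by simp
  also have "\<dots> \<le> M * nrm A w"
  proof (rule nrm_poly_op_le_unit[OF y w])
    show "cnj (coeff q k) = coeff q k" for k
      by (simp add: q_def coeff_pcompose_linear real)
    show "cmod (poly q (of_real t)) \<le> M" if "\<bar>t\<bar> \<le> 1" for t
    proof -
      have "\<bar>R * t\<bar> \<le> R"
        using that R by (simp add: abs_mult mult_left_le)
      then show ?thesis
        using M[of "R * t"] by (simp add: q_def poly_pcompose mult.commute)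
    qed
  qed
  finally show ?thesis .
qed

end

section \<open>*-homomorphisms: contractivity, and isometry in the injective case\<close>

locale cstar_hom = A: cstar_algebra A + B: cstar_algebra B
  for A :: "('a, 'm) cstar_scheme" and B :: "('b, 'n) cstar_scheme" +
  fixes h :: "'a \<Rightarrow> 'b"
  assumes hom: "h \<in> star_hom A B"
begin

lemma hom_closed [simp]: "x \<in> carrier A \<Longrightarrow> h x \<in> carrier B"
  and hom_add: "\<lbrakk>x \<in> carrier A; y \<in> carrier A\<rbrakk> \<Longrightarrow> h (x \<oplus>\<^bsub>A\<^esub> y) = h x \<oplus>\<^bsub>B\<^esub> h y"
  and hom_smult: "x \<in> carrier A \<Longrightarrow> h (c \<odot>\<^bsub>A\<^esub> x) = c \<odot>\<^bsub>B\<^esub> h x"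
  and hom_mult: "\<lbrakk>x \<in> carrier A; y \<in> carrier A\<rbrakk> \<Longrightarrow> h (x \<otimes>\<^bsub>A\<^esub> y) = h x \<otimes>\<^bsub>B\<^esub> h y"
  and hom_star: "x \<in> carrier A \<Longrightarrow> h (star A x) = star B (h x)"
  using hom by (auto simp: star_hom_def)

lemma hom_zero [simp]: "h \<zero>\<^bsub>A\<^esub> = \<zero>\<^bsub>B\<^esub>"
  using hom_smult[of "\<zero>\<^bsub>A\<^esub>" 0] by simp

lemma hom_minus: "\<lbrakk>x \<in> carrier A; y \<in> carrier A\<rbrakk> \<Longrightarrow> h (x \<ominus>\<^bsub>A\<^esub> y) = h x \<ominus>\<^bsub>B\<^esub> h y"
  by (simp add: A.minus_eq_smult B.minus_eq_smult hom_add hom_smult)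

lemma circle_pair_hom: "A.circle_pair x z \<Longrightarrow> B.circle_pair (h x) (h z)"
  unfolding A.circle_pair_def B.circle_pair_def
  by (metis A.mult_closed hom_add hom_closed hom_mult hom_star)

text \<open>For self-adjoint y and any c > ||y||, a circle pair for y/c is carried by h to one for
  h(y)/c, so ||h(y)|| \<le> c. The C*-identity extends this from star(x) x to x.\<close>

lemma contractive:
  assumes x: "x \<in> carrier A"
  shows "nrm B (h x) \<le> nrm A x"
proof -
  have self_adjoint: "nrm B (h y) \<le> nrm A y" if y: "y \<in> carrier A" "star A y = y" for y
  proof (rule dense_ge)
    fix c assume c: "nrm A y < c"
    then have c0: "0 < c"
      using A.nrm_nonneg[OF y(1)] by simp
    define v where "v = of_real (1/c) \<odot>\<^bsub>A\<^esub> y"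
    have v: "v \<in> carrier A" "star A v = v" "nrm A v < 1"
      using y c c0 by (simp_all add: v_def A.star_smult A.nrm_smult norm_divide)
    then obtain z where "A.circle_pair v z"
      using A.exists_circle_pair by blast
    then have "nrm B (h v) \<le> 1"
      using B.circle_pair_nrm_le_1 circle_pair_hom by blast
    then show "nrm B (h y) \<le> c"
      using c0 y by (simp add: v_def hom_smult B.nrm_smult norm_divide)
  qed
  have "(nrm B (h x))\<^sup>2 = nrm B (h (star A x \<otimes>\<^bsub>A\<^esub> x))"
    using x by (simp add: hom_mult hom_star A.star_closed B.nrm_star_mult)
  also have "\<dots> \<le> nrm A (star A x \<otimes>\<^bsub>A\<^esub> x)"
    using x by (intro self_adjoint)
      (simp_all add: A.mult_closed A.star_closed A.star_mult A.star_star)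
  also have "\<dots> = (nrm A x)\<^sup>2"
    using x by (simp add: A.nrm_star_mult)
  finally show ?thesis
    using A.nrm_nonneg[OF x] by (simp add: power2_le_iff_abs_le B.nrm_nonneg x)
qed

lemma poly_op_hom:
  assumes "x \<in> carrier A" "w \<in> carrier A"
  shows "h (A.poly_op ((\<otimes>\<^bsub>A\<^esub>) x) p w) = B.poly_op ((\<otimes>\<^bsub>B\<^esub>) (h x)) p (h w)"
  using assms
  by (induction p)
    (simp_all add: A.linear_op_mult_left B.linear_op_mult_left hom_add hom_smult hom_mult A.mult_closed)

text \<open>If \<open>nrm B (h x) < s < nrm A x\<close> for a self-adjoint \<open>x\<close>, functional calculus with a function
  that vanishes exactly on \<open>[-s, s]\<close> gives a nonzero element of the kernel of \<open>h\<close>.\<close>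

lemma isometric_self_adjoint:
  assumes inj: "inj_on h (carrier A)" and x: "x \<in> carrier A" "star A x = x"
  shows "nrm A x \<le> nrm B (h x)"
proof (rule dense_ge)
  fix s assume s: "nrm B (h x) < s"
  then have s0: "0 < s"
    using B.nrm_nonneg[of "h x"] x by simp
  \<comment> \<open>Any number above both ||x|| and s would do: one approximation of f has to serve
    for x in A and, on [-s, s], for h x in B.\<close>
  define R where "R = nrm A x + s + 1"
  have R: "nrm A x < R" "s < R"
    using A.nrm_nonneg[OF x(1)] s0 by (simp_all add: R_def)
  \<comment> \<open>t minus its projection to [-s, s]. That f vanishes on [-s, s] will annihilate
    the image under h; that t - f(t) is bounded by s will bound x.\<close>
  define f where "f t = t - max (-s) (min s t)" for t :: real
  have [simp]: "continuous_on {-R..R} f"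
    unfolding f_def by (intro continuous_intros)
  have "\<exists>p :: complex poly. (\<forall>k. cnj (coeff p k) = coeff p k) \<and>
      (\<forall>t. \<bar>t\<bar> \<le> R \<longrightarrow> cmod (poly p (of_real t) - of_real (f t)) \<le> (1/2) ^ n)" for n
    by (rule real_poly_approximation[of R f "(1/2) ^ n"]) auto
  then obtain p :: "nat \<Rightarrow> complex poly"
    where real: "\<And>n k. cnj (coeff (p n) k) = coeff (p n) k"
      and approx: "\<And>n t. \<bar>t\<bar> \<le> R \<Longrightarrow> cmod (poly (p n) (of_real t) - of_real (f t)) \<le> (1/2) ^ n"
    by metis
  let ?L = "(\<otimes>\<^bsub>A\<^esub>) x"
  have L: "A.linear_op ?L"
    using x A.linear_op_mult_left by blast
  \<comment> \<open>Approximations of f(x) x. The extra factor x keeps them in A although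
    \<open>p n\<close> may have a constant term.\<close>
  define b where "b n = A.poly_op ?L (p n) x" for n
  have b: "b n \<in> carrier A" for n
    using L x by (simp add: b_def)
  have step: "nrm A (b (Suc n) \<ominus>\<^bsub>A\<^esub> b n) \<le> (2 * nrm A x) * (1/2) ^ n" for n
  proof -
    have "nrm A (A.poly_op ?L (p (Suc n) - p n) x) \<le> (2 * (1/2) ^ n) * nrm A x"
    proof (rule A.nrm_poly_op_le[OF x R(1) x(1)])
      show "cmod (poly (p (Suc n) - p n) (of_real t)) \<le> 2 * (1/2) ^ n" if "\<bar>t\<bar> \<le> R" for t
      proof -
        have "cmod (poly (p (Suc n) - p n) (of_real t)) \<le> (1/2) ^ Suc n + (1/2) ^ n"
          using norm_triangle_ineq4[of "poly (p (Suc n)) (of_real t) - of_real (f t)"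
              "poly (p n) (of_real t) - of_real (f t)"]
            approx[OF that, of n] approx[OF that, of "Suc n"] by simp
        also have "\<dots> \<le> 2 * (1/2) ^ n"
          by simp
        finally show ?thesis .
      qed
    qed (simp add: real)
    then show ?thesis
      using L x by (simp add: b_def A.poly_op_diff mult_ac)
  qed
  have half: "0 \<le> (1/2 :: real)" "(1/2 :: real) < 1"
    by simp_all
  obtain a where a: "a \<in> carrier A" "A.converges_to sequentially b a"
    by (rule A.geometric_convergent[OF b half step])
  \<comment> \<open>As ||h x|| < s, only arguments with |t| \<le> s matter in B; there f is zero and
    \<open>p n\<close> has size at most (1/2)^n.\<close>
  have hb: "nrm B (h (b n)) \<le> (1/2) ^ n * nrm B (h x)" for n
    unfolding b_def poly_op_hom[OF x(1) x(1)]
  proof (rule B.nrm_poly_op_le[OF _ _ s])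
    show "cmod (poly (p n) (of_real t)) \<le> (1/2) ^ n" if "\<bar>t\<bar> \<le> s" for t
      using approx[of t n] that R by (simp add: f_def)
  qed (simp_all add: x real flip: hom_star)
  have "(\<lambda>n. (1/2) ^ n * nrm B (h x) + nrm A (b n \<ominus>\<^bsub>A\<^esub> a)) \<longlonglongrightarrow> 0 * nrm B (h x) + 0"
    using a(2) unfolding A.converges_to_def by (intro tendsto_intros LIMSEQ_realpow_zero) auto
  then have "nrm B (h a) \<le> 0 * nrm B (h x) + 0"
  proof (rule tendsto_lowerbound)
    have "nrm B (h a) \<le> (1/2) ^ n * nrm B (h x) + nrm A (b n \<ominus>\<^bsub>A\<^esub> a)" for n
      using B.nrm_triangle2[of "h (b n)" "h a"] hb[of n] contractive[of "b n \<ominus>\<^bsub>A\<^esub> a"] a b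
      by (simp add: hom_minus)
    then show "\<forall>\<^sub>F n in sequentially. nrm B (h a) \<le> (1/2) ^ n * nrm B (h x) + nrm A (b n \<ominus>\<^bsub>A\<^esub> a)"
      by simp
  qed simp
  then have "h a = \<zero>\<^bsub>B\<^esub>"
    using B.nrm_nonneg[of "h a"] B.nrm_eq_0[of "h a"] a by simp
  then have "a = \<zero>\<^bsub>A\<^esub>"
    using inj a by (metis A.M.zero_closed hom_zero inj_onD)
  then have b0: "(\<lambda>n. nrm A (b n)) \<longlonglongrightarrow> 0"
    using a b by (simp add: A.converges_to_def)
  \<comment> \<open>x^2 - b n is (t - p n(t)) evaluated at x and applied to x, and |t - f(t)| \<le>
    s. As b n tends to 0, this leaves ||x||^2 \<le> s ||x||.\<close>
  have "(nrm A x)\<^sup>2 \<le> (s + (1/2) ^ n) * nrm A x + nrm A (b n)" for n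
  proof -
    have "nrm A (A.poly_op ?L ([:0, 1:] - p n) x) \<le> (s + (1/2) ^ n) * nrm A x"
    proof (rule A.nrm_poly_op_le[OF x R(1) x(1)])
      show "cmod (poly ([:0, 1:] - p n) (of_real t)) \<le> s + (1/2) ^ n" if "\<bar>t\<bar> \<le> R" for t
      proof -
        have "\<bar>t - f t\<bar> \<le> s"
          using s0 by (simp add: f_def)
        then have "cmod (of_real (t - f t)) \<le> s"
          by (simp only: norm_of_real)
        then show ?thesis
          using norm_triangle_ineq4[of "of_real (t - f t)" "poly (p n) (of_real t) - of_real (f t)"]
            approx[OF that, of n] by simp
      qed
      show "cnj (coeff ([:0, 1:] - p n) k) = coeff ([:0, 1:] - p n) k" for k
        using real by (simp add: coeff_pCons split: nat.split)
    qed
    moreover have "A.poly_op ?L ([:0, 1:] - p n) x = x \<otimes>\<^bsub>A\<^esub> x \<ominus>\<^bsub>A\<^esub> b n"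
      using L x by (simp add: A.poly_op_diff b_def A.mult_closed)
    ultimately show ?thesis
      using A.nrm_triangle2[of "x \<otimes>\<^bsub>A\<^esub> x" "b n"] b x
      by (simp add: A.nrm_square_self_adjoint A.mult_closed)
  qed
  moreover have "(\<lambda>n. (s + (1/2) ^ n) * nrm A x + nrm A (b n)) \<longlonglongrightarrow> (s + 0) * nrm A x + 0"
    using b0 by (intro tendsto_intros LIMSEQ_realpow_zero) auto
  ultimately have "(nrm A x)\<^sup>2 \<le> (s + 0) * nrm A x + 0"
    by (intro tendsto_lowerbound[where F = sequentially]) auto
  then show "nrm A x \<le> s"
    using A.nrm_nonneg[OF x(1)] s0 by (cases "nrm A x = 0") (auto simp: power2_eq_square)
qed

lemma isometric:
  assumes inj: "inj_on h (carrier A)" and x: "x \<in> carrier A"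
  shows "nrm B (h x) = nrm A x"
proof -
  have "(nrm A x)\<^sup>2 = nrm A (star A x \<otimes>\<^bsub>A\<^esub> x)"
    using x by (simp add: A.nrm_star_mult)
  also have "\<dots> \<le> nrm B (h (star A x \<otimes>\<^bsub>A\<^esub> x))"
    using x inj by (intro isometric_self_adjoint)
      (simp_all add: A.mult_closed A.star_closed A.star_mult A.star_star)
  also have "\<dots> = (nrm B (h x))\<^sup>2"
    using x by (simp add: hom_mult hom_star A.star_closed B.nrm_star_mult)
  finally have "nrm A x \<le> nrm B (h x)"
    using A.nrm_nonneg[OF x] B.nrm_nonneg[of "h x"] x by (simp add: power2_le_iff_abs_le)
  then show ?thesis
    using contractive[OF x] by simp
qed

end

section \<open>Quotients of function algebras along a filter\<close>

text \<open>Convergence of the norms along \<open>F\<close> makes the quotient norm a genuine limit,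
  through which the C*-identity passes. The closure condition \<open>approx_C\<close> makes the
  quotient complete.\<close>

locale cstar_limit = cstar_algebra A for A :: "('a, 'm) cstar_scheme" (structure) +
  fixes F :: "'i filter" and C :: "('i \<Rightarrow> 'a) set"
  assumes F_nontrivial: "F \<noteq> bot"
    and C_closed [simp]: "f \<in> C \<Longrightarrow> f i \<in> carrier A"
    and zero_C [simp]: "(\<lambda>i. \<zero>) \<in> C"
    and add_C [simp]: "\<lbrakk>f \<in> C; g \<in> C\<rbrakk> \<Longrightarrow> (\<lambda>i. f i \<oplus> g i) \<in> C"
    and mult_C [simp]: "\<lbrakk>f \<in> C; g \<in> C\<rbrakk> \<Longrightarrow> (\<lambda>i. f i \<otimes> g i) \<in> C"
    and smult_C [simp]: "f \<in> C \<Longrightarrow> (\<lambda>i. c \<odot> f i) \<in> C"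
    and star_C [simp]: "f \<in> C \<Longrightarrow> (\<lambda>i. star A (f i)) \<in> C"
    and nrm_converges: "f \<in> C \<Longrightarrow> \<exists>l. ((\<lambda>i. nrm A (f i)) \<longlongrightarrow> l) F"
    and approx_C: "\<lbrakk>\<And>i. f i \<in> carrier A;
      \<And>e. 0 < e \<Longrightarrow> \<exists>g\<in>C. eventually (\<lambda>i. nrm A (f i \<ominus> g i) \<le> e) F\<rbrakk> \<Longrightarrow> f \<in> C"
begin

definition lim_nrm :: "('i \<Rightarrow> 'a) \<Rightarrow> real" where
  "lim_nrm f = Lim F (\<lambda>i. nrm A (f i))"

definition lim_eq :: "('i \<Rightarrow> 'a) \<Rightarrow> ('i \<Rightarrow> 'a) \<Rightarrow> bool" where
  "lim_eq f g \<longleftrightarrow> ((\<lambda>i. nrm A (f i \<ominus> g i)) \<longlongrightarrow> 0) F"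

definition lim_class :: "('i \<Rightarrow> 'a) \<Rightarrow> ('i \<Rightarrow> 'a) set" where
  "lim_class f = {g \<in> C. lim_eq f g}"

definition lim_rep :: "('i \<Rightarrow> 'a) set \<Rightarrow> 'i \<Rightarrow> 'a" where
  "lim_rep X = (SOME f. f \<in> X)"

text \<open>Operations use chosen representatives; the congruence properties of
  \<open>lim_eq\<close> show that the choice is immaterial. The field \<open>one\<close> is left
  undefined because no unit is claimed.\<close>

definition limit_algebra :: "('i \<Rightarrow> 'a) set cstar" where
  "limit_algebra =
    \<lparr>carrier = lim_class ` C,
     monoid.mult = (\<lambda>X Y. lim_class (\<lambda>i. lim_rep X i \<otimes> lim_rep Y i)),
     one = undefined,
     zero = lim_class (\<lambda>i. \<zero>),
     add = (\<lambda>X Y. lim_class (\<lambda>i. lim_rep X i \<oplus> lim_rep Y i)),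
     module.smult = (\<lambda>c X. lim_class (\<lambda>i. c \<odot> lim_rep X i)),
     star = (\<lambda>X. lim_class (\<lambda>i. star A (lim_rep X i))),
     nrm = (\<lambda>X. lim_nrm (lim_rep X))\<rparr>"

lemma lim_nrm_tendsto: "f \<in> C \<Longrightarrow> ((\<lambda>i. nrm A (f i)) \<longlongrightarrow> lim_nrm f) F"
  unfolding lim_nrm_def using nrm_converges tendsto_Lim[OF F_nontrivial] by blast

lemma lim_nrmI: "((\<lambda>i. nrm A (f i)) \<longlongrightarrow> l) F \<Longrightarrow> lim_nrm f = l"
  unfolding lim_nrm_def by (rule tendsto_Lim[OF F_nontrivial])

lemma lim_nrm_le:
  "\<lbrakk>f \<in> C; (g \<longlongrightarrow> l) F; eventually (\<lambda>i. nrm A (f i) \<le> g i) F\<rbrakk> \<Longrightarrow> lim_nrm f \<le> l"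
  using tendsto_le[OF F_nontrivial _ lim_nrm_tendsto] by blast

lemma lim_nrm_nonneg: "f \<in> C \<Longrightarrow> 0 \<le> lim_nrm f"
  using tendsto_lowerbound[OF lim_nrm_tendsto _ F_nontrivial] by (simp add: nrm_nonneg)

lemma diff_C [simp]: "\<lbrakk>f \<in> C; g \<in> C\<rbrakk> \<Longrightarrow> (\<lambda>i. f i \<ominus> g i) \<in> C"
  by (simp add: minus_eq_smult)

lemma lim_eqI:
  assumes "\<And>i. f i \<in> carrier A" "\<And>i. g i \<in> carrier A" "(b \<longlongrightarrow> 0) F"
    and "eventually (\<lambda>i. nrm A (f i \<ominus> g i) \<le> b i) F"
  shows "lim_eq f g"
  unfolding lim_eq_def using assms
  by (intro tendsto_sandwich[OF _ assms(4) tendsto_const assms(3)]) (simp add: nrm_nonneg)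

lemma lim_eq_iff: "\<lbrakk>f \<in> C; g \<in> C\<rbrakk> \<Longrightarrow> lim_eq f g \<longleftrightarrow> lim_nrm (\<lambda>i. f i \<ominus> g i) = 0"
  unfolding lim_eq_def
  by (rule iffI, erule lim_nrmI, erule subst, rule lim_nrm_tendsto, rule diff_C)

lemma lim_eq_refl: "f \<in> C \<Longrightarrow> lim_eq f f"
  by (simp add: lim_eq_def)

lemma lim_eq_sym: "\<lbrakk>f \<in> C; g \<in> C; lim_eq f g\<rbrakk> \<Longrightarrow> lim_eq g f"
  unfolding lim_eq_def using nrm_minus_commute[of "f _" "g _"] by simp

lemma lim_eq_trans:
  assumes "f \<in> C" "g \<in> C" "h \<in> C" "lim_eq f g" "lim_eq g h"
  shows "lim_eq f h"
proof (rule lim_eqI)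
  show "((\<lambda>i. nrm A (f i \<ominus> g i) + nrm A (g i \<ominus> h i)) \<longlongrightarrow> 0) F"
    using assms(4,5) unfolding lim_eq_def by (rule tendsto_add_zero)
qed (use assms in \<open>simp_all add: nrm_minus_triangle\<close>)

lemma lim_class_eq_iff:
  assumes "f \<in> C" "g \<in> C"
  shows "lim_class f = lim_class g \<longleftrightarrow> lim_eq f g"
  unfolding lim_class_def using assms lim_eq_refl lim_eq_sym lim_eq_trans by blast

lemma lim_rep_class:
  assumes f: "f \<in> C"
  shows lim_rep_in_C [simp]: "lim_rep (lim_class f) \<in> C"
    and lim_eq_rep: "lim_eq (lim_rep (lim_class f)) f"
proof -
  have "f \<in> lim_class f"
    using f lim_eq_refl by (simp add: lim_class_def)
  then have "lim_rep (lim_class f) \<in> lim_class f"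
    unfolding lim_rep_def by (rule someI[of "\<lambda>g. g \<in> lim_class f"])
  then show "lim_rep (lim_class f) \<in> C" "lim_eq (lim_rep (lim_class f)) f"
    using f lim_eq_sym by (auto simp: lim_class_def)
qed

lemma carrier_limit_algebra: "carrier limit_algebra = lim_class ` C"
  by (simp add: limit_algebra_def)

lemma lim_class_closed [simp]: "f \<in> C \<Longrightarrow> lim_class f \<in> carrier limit_algebra"
  by (simp add: carrier_limit_algebra)

lemma zero_limit_algebra: "\<zero>\<^bsub>limit_algebra\<^esub> = lim_class (\<lambda>i. \<zero>)"
  by (simp add: limit_algebra_def)

lemma lim_eq_add:
  assumes "f \<in> C" "g \<in> C" "f' \<in> C" "g' \<in> C" "lim_eq f f'" "lim_eq g g'"
  shows "lim_eq (\<lambda>i. f i \<oplus> g i) (\<lambda>i. f' i \<oplus> g' i)"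
proof (rule lim_eqI)
  show "((\<lambda>i. nrm A (f i \<ominus> f' i) + nrm A (g i \<ominus> g' i)) \<longlongrightarrow> 0) F"
    using assms(5,6) unfolding lim_eq_def by (rule tendsto_add_zero)
qed (use assms in \<open>simp_all add: nrm_add_minus_add_le\<close>)

lemma lim_eq_mult:
  assumes "f \<in> C" "g \<in> C" "f' \<in> C" "g' \<in> C" "lim_eq f f'" "lim_eq g g'"
  shows "lim_eq (\<lambda>i. f i \<otimes> g i) (\<lambda>i. f' i \<otimes> g' i)"
proof (rule lim_eqI)
  have "((\<lambda>i. nrm A (f i) * nrm A (g i \<ominus> g' i) + nrm A (f i \<ominus> f' i) * nrm A (g' i))
      \<longlongrightarrow> lim_nrm f * 0 + 0 * lim_nrm g') F"
    using assms unfolding lim_eq_def by (intro tendsto_add tendsto_mult lim_nrm_tendsto)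
  then show "((\<lambda>i. nrm A (f i) * nrm A (g i \<ominus> g' i) + nrm A (f i \<ominus> f' i) * nrm A (g' i))
      \<longlongrightarrow> 0) F"
    by simp
qed (use assms in \<open>simp_all add: mult_closed nrm_mult_minus_mult_le\<close>)

lemma lim_eq_smult:
  assumes "f \<in> C" "f' \<in> C" "lim_eq f f'"
  shows "lim_eq (\<lambda>i. c \<odot> f i) (\<lambda>i. c \<odot> f' i)"
  using assms(3) tendsto_mult_right_zero[of "\<lambda>i. nrm A (f i \<ominus> f' i)" F "cmod c"]
  unfolding lim_eq_def by (simp add: assms smult_minus_smult nrm_smult)

lemma lim_eq_star:
  assumes "f \<in> C" "f' \<in> C" "lim_eq f f'"
  shows "lim_eq (\<lambda>i. star A (f i)) (\<lambda>i. star A (f' i))"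
  using assms unfolding lim_eq_def by (simp add: star_minus_star)

lemma lim_class_add:
  "\<lbrakk>f \<in> C; g \<in> C\<rbrakk> \<Longrightarrow> lim_class f \<oplus>\<^bsub>limit_algebra\<^esub> lim_class g = lim_class (\<lambda>i. f i \<oplus> g i)"
  by (simp add: limit_algebra_def lim_class_eq_iff lim_eq_add lim_eq_rep)

lemma lim_class_mult:
  "\<lbrakk>f \<in> C; g \<in> C\<rbrakk> \<Longrightarrow> lim_class f \<otimes>\<^bsub>limit_algebra\<^esub> lim_class g = lim_class (\<lambda>i. f i \<otimes> g i)"
  by (simp add: limit_algebra_def lim_class_eq_iff lim_eq_mult lim_eq_rep)

lemma lim_class_smult:
  "f \<in> C \<Longrightarrow> c \<odot>\<^bsub>limit_algebra\<^esub> lim_class f = lim_class (\<lambda>i. c \<odot> f i)"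
  by (simp add: limit_algebra_def lim_class_eq_iff lim_eq_smult lim_eq_rep)

lemma lim_class_star: "f \<in> C \<Longrightarrow> star limit_algebra (lim_class f) = lim_class (\<lambda>i. star A (f i))"
  by (simp add: limit_algebra_def lim_class_eq_iff lim_eq_star lim_eq_rep)

lemma lim_nrm_cong:
  assumes "f \<in> C" "g \<in> C" "lim_eq f g"
  shows "lim_nrm f = lim_nrm g"
proof (rule lim_nrmI)
  have "((\<lambda>i. nrm A (f i) - nrm A (g i)) \<longlongrightarrow> 0) F"
    using assms(3) unfolding lim_eq_def
    by (rule Lim_null_comparison[rotated]) (simp add: assms nrm_triangle2)
  from tendsto_add[OF this lim_nrm_tendsto[OF assms(2)]]
  show "((\<lambda>i. nrm A (f i)) \<longlongrightarrow> lim_nrm g) F"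
    by simp
qed

lemma nrm_lim_class: "f \<in> C \<Longrightarrow> nrm limit_algebra (lim_class f) = lim_nrm f"
  using lim_nrm_cong[OF _ _ lim_eq_rep] by (simp add: limit_algebra_def)

lemmas lim_class_simps = carrier_limit_algebra zero_limit_algebra lim_class_add lim_class_mult
  lim_class_smult lim_class_star nrm_lim_class

lemma abelian_group_limit_algebra: "abelian_group limit_algebra"
proof (rule abelian_groupI)
  fix X assume "X \<in> carrier limit_algebra"
  then obtain f where f: "f \<in> C" "X = lim_class f"
    by (auto simp: carrier_limit_algebra)
  have neg: "(-1) \<odot> f i \<oplus> f i = \<zero>" for i
    using M.l_neg[of "f i"] f by (simp add: a_inv_eq_smult)
  have "lim_class (\<lambda>i. (-1) \<odot> f i) \<oplus>\<^bsub>limit_algebra\<^esub> X = \<zero>\<^bsub>limit_algebra\<^esub>"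
    using f by (simp add: lim_class_simps neg)
  then show "\<exists>Y\<in>carrier limit_algebra. Y \<oplus>\<^bsub>limit_algebra\<^esub> X = \<zero>\<^bsub>limit_algebra\<^esub>"
    using f by (intro bexI[of _ "lim_class (\<lambda>i. (-1) \<odot> f i)"]) auto
qed (auto simp: lim_class_simps M.a_ac)

lemma module_limit_algebra: "Module.module complex_ring limit_algebra"
  by (rule moduleI[OF R.is_cring abelian_group_limit_algebra])
    (auto simp: lim_class_simps complex_ring_def smult_add_left smult_add_right)

lemma lim_class_minus:
  assumes "f \<in> C" "g \<in> C"
  shows "lim_class f \<ominus>\<^bsub>limit_algebra\<^esub> lim_class g = lim_class (\<lambda>i. f i \<ominus> g i)"
proof -
  interpret L: abelian_group limit_algebra
    by (rule abelian_group_limit_algebra)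
  have neg: "(-1) \<odot> g i \<oplus> g i = \<zero>" for i
    using M.l_neg[of "g i"] assms by (simp add: a_inv_eq_smult)
  have "\<ominus>\<^bsub>limit_algebra\<^esub> lim_class g = lim_class (\<lambda>i. (-1) \<odot> g i)"
    using assms by (intro L.minus_equality)
      (simp_all add: lim_class_add zero_limit_algebra neg)
  then show ?thesis
    using assms by (simp add: L.minus_eq lim_class_add minus_eq_smult)
qed

lemma dist_lim_class:
  "\<lbrakk>f \<in> C; g \<in> C\<rbrakk>
    \<Longrightarrow> cstar_dist limit_algebra (lim_class f) (lim_class g) = lim_nrm (\<lambda>i. f i \<ominus> g i)"
  by (simp add: cstar_dist_def lim_class_minus nrm_lim_class)

text \<open>Shown directly: the general lemma on \<open>cstar_dist\<close> presupposes
  \<open>cstar_algebra\<close>, whose completeness axiom is still to be proved for this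
  quotient.\<close>

lemma Metric_space_limit_algebra:
  "Metric_space (carrier limit_algebra) (cstar_dist limit_algebra)"
proof
  fix X Y
  show "0 \<le> cstar_dist limit_algebra X Y"
    by (auto simp: cstar_dist_def carrier_limit_algebra lim_class_minus nrm_lim_class lim_nrm_nonneg)
  have "lim_nrm (\<lambda>i. f i \<ominus> g i) = lim_nrm (\<lambda>i. g i \<ominus> f i)" if "f \<in> C" "g \<in> C" for f g
    using that nrm_minus_commute[of "f _" "g _"] by (simp add: lim_nrm_def)
  then show "cstar_dist limit_algebra X Y = cstar_dist limit_algebra Y X"
    by (auto simp: cstar_dist_def carrier_limit_algebra lim_class_minus nrm_lim_class)
next
  fix X Y assume "X \<in> carrier limit_algebra" "Y \<in> carrier limit_algebra"
  then obtain f g where "f \<in> C" "X = lim_class f" "g \<in> C" "Y = lim_class g"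
    by (auto simp: carrier_limit_algebra)
  then show "cstar_dist limit_algebra X Y = 0 \<longleftrightarrow> X = Y"
    by (simp add: dist_lim_class lim_class_eq_iff lim_eq_iff)
next
  fix X Y Z
  assume "X \<in> carrier limit_algebra" "Y \<in> carrier limit_algebra" "Z \<in> carrier limit_algebra"
  then obtain f g h where fgh: "f \<in> C" "X = lim_class f" "g \<in> C" "Y = lim_class g"
    "h \<in> C" "Z = lim_class h"
    by (auto simp: carrier_limit_algebra)
  have "lim_nrm (\<lambda>i. f i \<ominus> h i) \<le> lim_nrm (\<lambda>i. f i \<ominus> g i) + lim_nrm (\<lambda>i. g i \<ominus> h i)"
    using fgh by (intro lim_nrm_le[OF _ tendsto_add[OF lim_nrm_tendsto lim_nrm_tendsto]])
      (simp_all add: nrm_minus_triangle)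
  then show "cstar_dist limit_algebra X Z
      \<le> cstar_dist limit_algebra X Y + cstar_dist limit_algebra Y Z"
    using fgh by (simp add: dist_lim_class)
qed

text \<open>Representatives of a Cauchy sequence are close only eventually, on sets depending on the
  indices, so they may diverge at every point. They are modified off sets of the filter so that they
  converge uniformly; the pointwise limit lies in C by \<open>approx_C\<close>, and a convergent
  subsequence suffices.\<close>

lemma mcomplete_limit_algebra:
  "Metric_space.mcomplete (carrier limit_algebra) (cstar_dist limit_algebra)"
proof -
  interpret L: Metric_space "carrier limit_algebra" "cstar_dist limit_algebra"
    by (rule Metric_space_limit_algebra)
  show ?thesis
    unfolding L.mcomplete_def
  proof (intro allI impI)
    fix \<sigma> assume cauchy: "L.MCauchy \<sigma>"
    then have "\<sigma> n \<in> lim_class ` C" for n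
      by (auto simp: L.MCauchy_def simp flip: carrier_limit_algebra)
    then have "\<forall>n. \<exists>f. f \<in> C \<and> \<sigma> n = lim_class f"
      by blast
    then obtain f where f: "\<And>n. f n \<in> C" and \<sigma>: "\<And>n. \<sigma> n = lim_class (f n)"
      by metis
    have "\<exists>N. \<forall>m\<ge>N. \<forall>m'\<ge>N. lim_nrm (\<lambda>i. f m i \<ominus> f m' i) < (1/2) ^ n" for n :: nat
    proof -
      have "(0 :: real) < (1/2) ^ n"
        by simp
      then obtain N where "\<And>m m'. \<lbrakk>N \<le> m; N \<le> m'\<rbrakk>
          \<Longrightarrow> cstar_dist limit_algebra (\<sigma> m) (\<sigma> m') < (1/2) ^ n"
        using cauchy unfolding L.MCauchy_def by meson
      then show ?thesis
        using f by (auto simp: \<sigma> dist_lim_class)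
    qed
    then obtain K where K: "\<And>n m m'. \<lbrakk>K n \<le> m; K n \<le> m'\<rbrakk>
        \<Longrightarrow> lim_nrm (\<lambda>i. f m i \<ominus> f m' i) < (1/2) ^ n"
      by metis
    \<comment> \<open>The partial sum makes k n at least K n, and the added n makes k strictly
      increasing.\<close>
    define k where "k n = (\<Sum>i\<le>n. K i) + n" for n
    have k_mono: "strict_mono k"
      by (rule strict_mono_Suc_iff[THEN iffD2]) (simp add: k_def)
    have K_le: "K n \<le> k n" for n
      using member_le_sum[of n "{..n}" K] by (simp add: k_def)
    then have K_le': "K n \<le> k (Suc n)" for n
      using strict_monoD[OF k_mono, of n "Suc n"] by (meson lessI less_imp_le order_trans)
    \<comment> \<open>At each index the value moves on to the next representative only if the jump
      is at most (1/2)^n. So h converges at every index, while h n still agrees with f (k n)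
      eventually.\<close>
    define h where "h = rec_nat (f (k 0)) (\<lambda>n h i.
        if nrm A (f (k (Suc n)) i \<ominus> h i) \<le> (1/2) ^ n then f (k (Suc n)) i else h i)"
    have h0: "h 0 = f (k 0)" and hS: "h (Suc n) i =
        (if nrm A (f (k (Suc n)) i \<ominus> h n i) \<le> (1/2) ^ n then f (k (Suc n)) i else h n i)" for n i
      by (simp_all add: h_def)
    have hc: "h n i \<in> carrier A" for n i
      by (induction n) (simp_all add: h0 hS f)
    have h_step: "nrm A (h (Suc n) i \<ominus> h n i) \<le> 1 * (1/2) ^ n" for n i
      using hc by (simp add: hS)
    have h_ev: "eventually (\<lambda>i. h n i = f (k n) i) F" for n
    proof (induction n)
      case (Suc n)
      have "eventually (\<lambda>i. nrm A (f (k (Suc n)) i \<ominus> f (k n) i) < (1/2) ^ n) F"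
        using order_tendstoD(2)[OF lim_nrm_tendsto K[OF K_le' K_le]] f by simp
      with Suc show ?case
        by eventually_elim (simp add: hS)
    qed (simp add: h0)
    have half: "0 \<le> (1/2 :: real)" "(1/2 :: real) < 1"
      by simp_all
    have "\<exists>x. x \<in> carrier A \<and> (\<forall>n. nrm A (h n i \<ominus> x) \<le> 1 * (1/2) ^ n / (1 - 1/2))" for i
      by (rule geometric_convergent[of "\<lambda>n. h n i", OF hc half h_step]) (rule exI conjI allI | assumption)+
    then have "\<exists>g. \<forall>i. g i \<in> carrier A \<and> (\<forall>n. nrm A (h n i \<ominus> g i) \<le> 1 * (1/2) ^ n / (1 - 1/2))"
      by (intro choice) (rule allI)
    then obtain g where g':
        "\<forall>i. g i \<in> carrier A \<and> (\<forall>n. nrm A (h n i \<ominus> g i) \<le> 1 * (1/2) ^ n / (1 - 1/2))"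
      by (rule exE)
    then have gc: "g i \<in> carrier A" for i
      by simp
    have g: "nrm A (h n i \<ominus> g i) \<le> 2 * (1/2) ^ n" for i n
      using g'[THEN spec, of i, THEN conjunct2, THEN spec, of n] by simp
    have close: "eventually (\<lambda>i. nrm A (f (k n) i \<ominus> g i) \<le> 2 * (1/2) ^ n) F" for n
      using h_ev[of n]
    proof eventually_elim
      case (elim i)
      then show ?case
        using g[of n i] by simp
    qed
    have lim0: "(\<lambda>n. 2 * (1/2) ^ n :: real) \<longlonglongrightarrow> 0"
      by (intro tendsto_mult_right_zero LIMSEQ_realpow_zero) auto
    have "g \<in> C"
    proof (rule approx_C[OF gc])
      fix e :: real assume "0 < e"
      then have "eventually (\<lambda>n. 2 * (1/2) ^ n < e) sequentially"
        using lim0 by (rule order_tendstoD(2)[rotated])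
      then obtain n where n: "2 * (1/2) ^ n < e"
        using eventually_happens by force
      have "eventually (\<lambda>i. nrm A (g i \<ominus> f (k n) i) \<le> e) F"
        using close[of n]
      proof eventually_elim
        case (elim i)
        then show ?case
          using n nrm_minus_commute[OF gc C_closed[OF f], of i "k n" i] by simp
      qed
      then show "\<exists>f\<in>C. eventually (\<lambda>i. nrm A (g i \<ominus> f i) \<le> e) F"
        using f by blast
    qed
    have le: "lim_nrm (\<lambda>i. f (k n) i \<ominus> g i) \<le> 2 * (1/2) ^ n" for n
      using f \<open>g \<in> C\<close> close by (intro lim_nrm_le[OF _ tendsto_const]) auto
    have "(\<lambda>n. cstar_dist limit_algebra ((\<sigma> \<circ> k) n) (lim_class g)) \<longlonglongrightarrow> 0"
      by (rule tendsto_sandwich[OF _ _ tendsto_const lim0])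
        (simp_all add: \<sigma> dist_lim_class f \<open>g \<in> C\<close> le lim_nrm_nonneg)
    then have "limitin L.mtopology (\<sigma> \<circ> k) (lim_class g) sequentially"
      using f \<open>g \<in> C\<close> by (simp add: L.limitin_metric_dist_null \<sigma>)
    then show "\<exists>x. limitin L.mtopology \<sigma> x sequentially"
      using L.MCauchy_convergent_subsequence[OF cauchy k_mono] by blast
  qed
qed

lemma cstar_algebra_limit_algebra: "cstar_algebra limit_algebra"
proof (rule cstar_algebra.intro[OF module_limit_algebra], unfold_locales)

  fix X assume "X \<in> carrier limit_algebra"
  then obtain f where f: "f \<in> C" "X = lim_class f"
    by (auto simp: carrier_limit_algebra)
  show "0 \<le> nrm limit_algebra X"
    using f by (simp add: nrm_lim_class lim_nrm_nonneg)
  show "nrm limit_algebra X = 0 \<longleftrightarrow> X = \<zero>\<^bsub>limit_algebra\<^esub>"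
    using f by (simp add: lim_class_simps lim_class_eq_iff lim_eq_iff)
  show "nrm limit_algebra (c \<odot>\<^bsub>limit_algebra\<^esub> X) = cmod c * nrm limit_algebra X" for c
    using f tendsto_mult_left[OF lim_nrm_tendsto[OF f(1)], of "cmod c"]
    by (simp add: lim_class_smult nrm_lim_class nrm_smult lim_nrmI)
  show "star limit_algebra X \<in> carrier limit_algebra"
    using f by (simp add: lim_class_star)
  show "star limit_algebra (star limit_algebra X) = X"
    using f by (simp add: lim_class_star star_star)
  show "star limit_algebra (c \<odot>\<^bsub>limit_algebra\<^esub> X)
      = cnj c \<odot>\<^bsub>limit_algebra\<^esub> star limit_algebra X" for c
    using f by (simp add: lim_class_star lim_class_smult star_smult)
  show "nrm limit_algebra (star limit_algebra X \<otimes>\<^bsub>limit_algebra\<^esub> X) = (nrm limit_algebra X)\<^sup>2"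
    using f tendsto_power[OF lim_nrm_tendsto[OF f(1)], of 2]
    by (simp add: lim_class_simps nrm_star_mult lim_nrmI)
next
  fix X Y assume "X \<in> carrier limit_algebra" "Y \<in> carrier limit_algebra"
  then obtain f g where fg: "f \<in> C" "X = lim_class f" "g \<in> C" "Y = lim_class g"
    by (auto simp: carrier_limit_algebra)
  show "nrm limit_algebra (X \<oplus>\<^bsub>limit_algebra\<^esub> Y) \<le> nrm limit_algebra X + nrm limit_algebra Y"
    using fg lim_nrm_le[OF _ tendsto_add[OF lim_nrm_tendsto lim_nrm_tendsto], of "\<lambda>i. f i \<oplus> g i" f g]
    by (simp add: lim_class_add nrm_lim_class nrm_triangle)
  show "nrm limit_algebra (X \<otimes>\<^bsub>limit_algebra\<^esub> Y) \<le> nrm limit_algebra X * nrm limit_algebra Y"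
    using fg lim_nrm_le[OF _ tendsto_mult[OF lim_nrm_tendsto lim_nrm_tendsto], of "\<lambda>i. f i \<otimes> g i" f g]
    by (simp add: lim_class_mult nrm_lim_class nrm_mult)
  show "X \<otimes>\<^bsub>limit_algebra\<^esub> Y \<in> carrier limit_algebra"
    using fg by (simp add: lim_class_mult)
  show "(c \<odot>\<^bsub>limit_algebra\<^esub> X) \<otimes>\<^bsub>limit_algebra\<^esub> Y
      = c \<odot>\<^bsub>limit_algebra\<^esub> (X \<otimes>\<^bsub>limit_algebra\<^esub> Y)" for c
    using fg by (simp add: lim_class_mult lim_class_smult smult_mult_left)
  show "X \<otimes>\<^bsub>limit_algebra\<^esub> (c \<odot>\<^bsub>limit_algebra\<^esub> Y)
      = c \<odot>\<^bsub>limit_algebra\<^esub> (X \<otimes>\<^bsub>limit_algebra\<^esub> Y)" for c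
    using fg by (simp add: lim_class_mult lim_class_smult smult_mult_right)
  show "star limit_algebra (X \<oplus>\<^bsub>limit_algebra\<^esub> Y)
      = star limit_algebra X \<oplus>\<^bsub>limit_algebra\<^esub> star limit_algebra Y"
    using fg by (simp add: lim_class_star lim_class_add star_add)
  show "star limit_algebra (X \<otimes>\<^bsub>limit_algebra\<^esub> Y)
      = star limit_algebra Y \<otimes>\<^bsub>limit_algebra\<^esub> star limit_algebra X"
    using fg by (simp add: lim_class_star lim_class_mult star_mult)
next
  show "Metric_space.mcomplete (carrier limit_algebra) (cstar_dist limit_algebra)"
    by (rule mcomplete_limit_algebra)
next
  fix X Y Z
  assume "X \<in> carrier limit_algebra" "Y \<in> carrier limit_algebra" "Z \<in> carrier limit_algebra"
  then obtain f g h where fgh: "f \<in> C" "X = lim_class f" "g \<in> C" "Y = lim_class g"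
    "h \<in> C" "Z = lim_class h"
    by (auto simp: carrier_limit_algebra)
  show "X \<otimes>\<^bsub>limit_algebra\<^esub> Y \<otimes>\<^bsub>limit_algebra\<^esub> Z
      = X \<otimes>\<^bsub>limit_algebra\<^esub> (Y \<otimes>\<^bsub>limit_algebra\<^esub> Z)"
    using fgh by (simp add: lim_class_mult mult_assoc)
  show "(X \<oplus>\<^bsub>limit_algebra\<^esub> Y) \<otimes>\<^bsub>limit_algebra\<^esub> Z
      = X \<otimes>\<^bsub>limit_algebra\<^esub> Z \<oplus>\<^bsub>limit_algebra\<^esub> Y \<otimes>\<^bsub>limit_algebra\<^esub> Z"
    using fgh by (simp add: lim_class_mult lim_class_add mult_distrib_right)
  show "Z \<otimes>\<^bsub>limit_algebra\<^esub> (X \<oplus>\<^bsub>limit_algebra\<^esub> Y)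
      = Z \<otimes>\<^bsub>limit_algebra\<^esub> X \<oplus>\<^bsub>limit_algebra\<^esub> Z \<otimes>\<^bsub>limit_algebra\<^esub> Y"
    using fgh by (simp add: lim_class_mult lim_class_add mult_distrib_left)
qed

end

section \<open>Coherent functions on an Ore semigroup\<close>

text \<open>The Cauchy criterion along a filter. Two eventual estimates hold together somewhere
  because the filter is nontrivial, so the constants chosen for e = (1/2)^n form a Cauchy
  sequence.\<close>

lemma filter_convergent_real:
  fixes \<phi> :: "'i \<Rightarrow> real"
  assumes "F \<noteq> bot" and ev: "\<And>e. 0 < e \<Longrightarrow> \<exists>l. eventually (\<lambda>i. \<bar>\<phi> i - l\<bar> \<le> e) F"
  shows "\<exists>l. (\<phi> \<longlongrightarrow> l) F"
proof -
  have "\<exists>l. eventually (\<lambda>i. \<bar>\<phi> i - l\<bar> \<le> (1/2) ^ n) F" for n :: nat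
    by (rule ev) simp
  then obtain l where l: "\<And>n. eventually (\<lambda>i. \<bar>\<phi> i - l n\<bar> \<le> (1/2) ^ n) F"
    by metis
  have lim0: "(\<lambda>n. (1/2) ^ n + (1/2) ^ n :: real) \<longlonglongrightarrow> 0"
    by (intro tendsto_add_zero LIMSEQ_realpow_zero) auto
  have small: "\<exists>N. \<forall>n\<ge>N. (1/2) ^ n + (1/2) ^ n < e" if "0 < e" for e :: real
    using order_tendstoD(2)[OF lim0 that] by (simp add: eventually_sequentially)
  have dist: "\<bar>l m - l n\<bar> \<le> (1/2) ^ m + (1/2) ^ n" for m n
  proof -
    have "eventually (\<lambda>i. \<bar>l m - l n\<bar> \<le> (1/2) ^ m + (1/2) ^ n) F"
      using l[of m] l[of n] by eventually_elim linarith
    then show ?thesis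
      using assms(1) by (simp add: eventually_const_iff)
  qed
  have "Cauchy l"
  proof (rule metric_CauchyI)
    fix e :: real assume "0 < e"
    then obtain N where N: "\<And>n. N \<le> n \<Longrightarrow> (1/2) ^ n + (1/2) ^ n < e"
      using small by blast
    have "\<bar>l m - l n\<bar> < e" if "N \<le> m" "N \<le> n" for m n
    proof -
      have "(1/2 :: real) ^ m \<le> (1/2) ^ N" "(1/2 :: real) ^ n \<le> (1/2) ^ N"
        using that by (simp_all add: power_decreasing)
      then show ?thesis
        using dist[of m n] N[of N] by linarith
    qed
    then show "\<exists>M. \<forall>m\<ge>M. \<forall>n\<ge>M. dist (l m) (l n) < e"
      by (auto simp: dist_real_def)
  qed
  then obtain c where c: "l \<longlonglongrightarrow> c"
    using Cauchy_convergent_iff convergent_def by blast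
  have "(\<phi> \<longlongrightarrow> c) F"
  proof (rule tendstoI)
    fix e :: real assume e: "0 < e"
    obtain N where N: "\<And>n. N \<le> n \<Longrightarrow> (1/2) ^ n + (1/2) ^ n < e/2"
      using small[of "e/2"] e by auto
    obtain N' where N': "\<And>n. N' \<le> n \<Longrightarrow> \<bar>l n - c\<bar> < e/2"
      using LIMSEQ_D[OF c, of "e/2"] e by auto
    define n where "n = max N N'"
    have 1: "(1/2) ^ n + (1/2) ^ n < e/2" "\<bar>l n - c\<bar> < e/2"
      using N[of n] N'[of n] by (simp_all add: n_def)
    have 2: "0 \<le> (1/2 :: real) ^ n"
      by simp
    show "eventually (\<lambda>i. dist (\<phi> i) c < e) F"
      using l[of n]
    proof eventually_elim
      case (elim i)
      then show ?case
        using 1 2 unfolding dist_real_def by linarith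
    qed
  qed
  then show ?thesis ..
qed

section \<open>The directed family of left ideals and functions that are coherent along it\<close>

locale ore_action = S: ore_semigroup S + G: Group.group G + A: cstar_algebra A
  for S :: "('s, 'k) monoid_scheme" and G :: "('g, 'l) monoid_scheme"
    and A :: "('a, 'm) cstar_scheme" +
  fixes j :: "'s \<Rightarrow> 'g" and \<alpha> :: "'s \<Rightarrow> 'a \<Rightarrow> 'a"
  assumes env: "enveloping_group S G j"
    and act: "endomorphism_action S A \<alpha>"
    and inj_act: "s \<in> carrier S \<Longrightarrow> inj_on (\<alpha> s) (carrier A)"
begin

lemma j_closed [simp]: "s \<in> carrier S \<Longrightarrow> j s \<in> carrier G"
  and j_mult: "\<lbrakk>s \<in> carrier S; t \<in> carrier S\<rbrakk> \<Longrightarrow> j (s \<otimes>\<^bsub>S\<^esub> t) = j s \<otimes>\<^bsub>G\<^esub> j t"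
  and j_inj: "\<lbrakk>j s = j t; s \<in> carrier S; t \<in> carrier S\<rbrakk> \<Longrightarrow> s = t"
  using env by (auto simp: enveloping_group_def hom_def inj_on_def)

lemma fraction:
  assumes "g \<in> carrier G"
  obtains s t where "s \<in> carrier S" "t \<in> carrier S" "g = inv\<^bsub>G\<^esub> (j s) \<otimes>\<^bsub>G\<^esub> j t"
  using assms env unfolding enveloping_group_def by blast

lemma S_nonempty: "carrier S \<noteq> {}"
  using fraction[OF G.one_closed] by blast

lemma common_multiple:
  assumes "s \<in> carrier S" "t \<in> carrier S"
  obtains p q where "p \<in> carrier S" "q \<in> carrier S" "p \<otimes>\<^bsub>S\<^esub> s = q \<otimes>\<^bsub>S\<^esub> t"
  using S.ore[OF assms] by blast

text \<open>Write g s^-1 as a fraction b^-1 a. All later uses of G = S^-1 S to move an index s by g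
  go through this equation.\<close>

lemma translate_multiple:
  assumes g: "g \<in> carrier G" and s: "s \<in> carrier S"
  obtains b a where "b \<in> carrier S" "a \<in> carrier S" "j b \<otimes>\<^bsub>G\<^esub> g = j a \<otimes>\<^bsub>G\<^esub> j s"
proof -
  have "g \<otimes>\<^bsub>G\<^esub> inv\<^bsub>G\<^esub> (j s) \<in> carrier G"
    using assms by simp
  then obtain b a where ba: "b \<in> carrier S" "a \<in> carrier S"
    and e: "g \<otimes>\<^bsub>G\<^esub> inv\<^bsub>G\<^esub> (j s) = inv\<^bsub>G\<^esub> (j b) \<otimes>\<^bsub>G\<^esub> j a"
    by (rule fraction)
  have "g = inv\<^bsub>G\<^esub> (j b) \<otimes>\<^bsub>G\<^esub> (j a \<otimes>\<^bsub>G\<^esub> j s)"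
    using e g s ba by (metis G.inv_closed G.inv_solve_right G.m_assoc G.m_closed j_closed G.inv_inv)
  then have "j b \<otimes>\<^bsub>G\<^esub> g = j a \<otimes>\<^bsub>G\<^esub> j s"
    using g s ba G.inv_solve_left[of "g" "j b" "j a \<otimes>\<^bsub>G\<^esub> j s"] by simp
  with ba show thesis
    by (rule that)
qed

lemma act_hom: "s \<in> carrier S \<Longrightarrow> cstar_hom A A (\<alpha> s)"
  using act A.cstar_algebra_axioms
  by (simp add: endomorphism_action_def cstar_hom_def cstar_hom_axioms_def)

lemma act_closed [simp]: "\<lbrakk>s \<in> carrier S; a \<in> carrier A\<rbrakk> \<Longrightarrow> \<alpha> s a \<in> carrier A"
  using cstar_hom.hom_closed[OF act_hom] .

lemma act_act:
  "\<lbrakk>s \<in> carrier S; t \<in> carrier S; a \<in> carrier A\<rbrakk> \<Longrightarrow> \<alpha> s (\<alpha> t a) = \<alpha> (s \<otimes>\<^bsub>S\<^esub> t) a"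
  using act by (simp add: endomorphism_action_def)

lemma act_isometric [simp]:
  "\<lbrakk>s \<in> carrier S; a \<in> carrier A\<rbrakk> \<Longrightarrow> nrm A (\<alpha> s a) = nrm A a"
  using cstar_hom.isometric[OF act_hom inj_act] by blast

lemmas act_add = cstar_hom.hom_add[OF act_hom]
  and act_smult = cstar_hom.hom_smult[OF act_hom]
  and act_mult = cstar_hom.hom_mult[OF act_hom]
  and act_star = cstar_hom.hom_star[OF act_hom]
  and act_zero = cstar_hom.hom_zero[OF act_hom]

text \<open>The filter of sets containing a left ideal \<open>Ss\<close>; the Ore condition makes it directed.\<close>

definition ideal_filter :: "'s filter" where
  "ideal_filter = (INF s\<in>carrier S. principal ((\<lambda>r. r \<otimes>\<^bsub>S\<^esub> s) ` carrier S))"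

lemma eventually_ideal_filter:
  "eventually P ideal_filter \<longleftrightarrow> (\<exists>s\<in>carrier S. \<forall>r\<in>carrier S. P (r \<otimes>\<^bsub>S\<^esub> s))"
proof -
  have "\<exists>w\<in>carrier S. principal ((\<lambda>r. r \<otimes>\<^bsub>S\<^esub> w) ` carrier S)
      \<le> inf (principal ((\<lambda>r. r \<otimes>\<^bsub>S\<^esub> s) ` carrier S)) (principal ((\<lambda>r. r \<otimes>\<^bsub>S\<^esub> t) ` carrier S))"
    if st: "s \<in> carrier S" "t \<in> carrier S" for s t
  proof -
    obtain p q where pq: "p \<in> carrier S" "q \<in> carrier S" "p \<otimes>\<^bsub>S\<^esub> s = q \<otimes>\<^bsub>S\<^esub> t"
      using common_multiple[OF st] .
    have "r \<otimes>\<^bsub>S\<^esub> (p \<otimes>\<^bsub>S\<^esub> s) \<in> (\<lambda>r. r \<otimes>\<^bsub>S\<^esub> s) ` carrier S \<inter> (\<lambda>r. r \<otimes>\<^bsub>S\<^esub> t) ` carrier S"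
      if r: "r \<in> carrier S" for r
    proof -
      have "r \<otimes>\<^bsub>S\<^esub> (p \<otimes>\<^bsub>S\<^esub> s) = (r \<otimes>\<^bsub>S\<^esub> p) \<otimes>\<^bsub>S\<^esub> s" "r \<otimes>\<^bsub>S\<^esub> (p \<otimes>\<^bsub>S\<^esub> s) = (r \<otimes>\<^bsub>S\<^esub> q) \<otimes>\<^bsub>S\<^esub> t"
        using st pq r by (simp_all add: S.m_assoc)
      then show ?thesis
        using pq r S.m_closed by blast
    qed
    then show ?thesis
      using st pq S.m_closed by (intro bexI[of _ "p \<otimes>\<^bsub>S\<^esub> s"]) auto
  qed
  then show ?thesis
    unfolding ideal_filter_def
    by (subst eventually_INF_base[OF S_nonempty]) (auto simp: eventually_principal)
qed

lemma ideal_filter_nontrivial: "ideal_filter \<noteq> bot"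
  using S_nonempty by (auto simp: trivial_limit_def eventually_ideal_filter)

lemma eventually_in_S: "eventually (\<lambda>x. x \<in> carrier S) ideal_filter"
  using S_nonempty S.m_closed by (force simp: eventually_ideal_filter)

text \<open>If b g = a s, then (r b) g = (r a) s: right translation by g carries the ideal S b into
  S s.\<close>

lemma eventually_translate:
  assumes g: "g \<in> carrier G" and "eventually P ideal_filter"
  shows "eventually (\<lambda>x. \<exists>y. x \<in> carrier S \<and> y \<in> carrier S \<and> j y = j x \<otimes>\<^bsub>G\<^esub> g \<and> P y) ideal_filter"
proof -
  obtain s where s: "s \<in> carrier S" and P: "\<And>r. r \<in> carrier S \<Longrightarrow> P (r \<otimes>\<^bsub>S\<^esub> s)"
    using assms by (auto simp: eventually_ideal_filter)
  obtain b a where ba: "b \<in> carrier S" "a \<in> carrier S" "j b \<otimes>\<^bsub>G\<^esub> g = j a \<otimes>\<^bsub>G\<^esub> j s"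
    using translate_multiple[OF g s] .
  have "j ((r \<otimes>\<^bsub>S\<^esub> a) \<otimes>\<^bsub>S\<^esub> s) = j (r \<otimes>\<^bsub>S\<^esub> b) \<otimes>\<^bsub>G\<^esub> g" if "r \<in> carrier S" for r
    using that ba s g by (simp add: j_mult S.m_closed G.m_assoc)
  then show ?thesis
    unfolding eventually_ideal_filter using ba s P S.m_closed
    by (intro bexI[of _ b] ballI) (auto intro!: exI[of _ "(_ \<otimes>\<^bsub>S\<^esub> a) \<otimes>\<^bsub>S\<^esub> s"])
qed

text \<open>\<open>germ s a\<close> represents the element \<open>\<beta>\<^sub>s\<^sup>-\<^sup>1(i(a))\<close> of the dilation: a function \<open>f\<close> stands for \<open>b\<close>
  when \<open>i(f(x))\<close> and \<open>\<beta>\<^sub>x(b)\<close> are asymptotically equal along the filter.\<close>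

definition germ :: "'s \<Rightarrow> 'a \<Rightarrow> 's \<Rightarrow> 'a" where
  "germ s a x = (if x \<in> (\<lambda>r. r \<otimes>\<^bsub>S\<^esub> s) ` carrier S
     then \<alpha> (inv_into (carrier S) (\<lambda>r. r \<otimes>\<^bsub>S\<^esub> s) x) a else \<zero>\<^bsub>A\<^esub>)"

lemma germ_mult:
  assumes "s \<in> carrier S" "r \<in> carrier S"
  shows "germ s a (r \<otimes>\<^bsub>S\<^esub> s) = \<alpha> r a"
proof -
  have "inj_on (\<lambda>r. r \<otimes>\<^bsub>S\<^esub> s) (carrier S)"
    using S.r_cancel assms by (auto intro: inj_onI)
  from inv_into_f_f[OF this assms(2)] show ?thesis
    using assms by (simp add: germ_def)
qed

lemma germ_closed [simp]: "a \<in> carrier A \<Longrightarrow> germ s a x \<in> carrier A"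
  by (auto simp: germ_def inv_into_into)

text \<open>The identification of the inductive limit: a at index s is the same element as
  \<open>\<alpha> p a\<close> at index p s. The two functions are compared only on the smaller ideal
  S (p s).\<close>

lemma germ_multiple:
  assumes "s \<in> carrier S" "p \<in> carrier S" "a \<in> carrier A"
  shows "eventually (\<lambda>x. germ s a x = germ (p \<otimes>\<^bsub>S\<^esub> s) (\<alpha> p a) x) ideal_filter"
proof -
  have "germ s a (r \<otimes>\<^bsub>S\<^esub> (p \<otimes>\<^bsub>S\<^esub> s)) = germ (p \<otimes>\<^bsub>S\<^esub> s) (\<alpha> p a) (r \<otimes>\<^bsub>S\<^esub> (p \<otimes>\<^bsub>S\<^esub> s))"
    if "r \<in> carrier S" for r
    using that assms germ_mult[of s "r \<otimes>\<^bsub>S\<^esub> p" a]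
    by (simp add: germ_mult S.m_closed S.m_assoc act_act)
  then show ?thesis
    using assms S.m_closed by (auto simp: eventually_ideal_filter)
qed

lemma germ_common:
  assumes "s \<in> carrier S" "a \<in> carrier A" "t \<in> carrier S" "b \<in> carrier A"
  obtains w a' b' where "w \<in> carrier S" "a' \<in> carrier A" "b' \<in> carrier A"
    "eventually (\<lambda>x. germ s a x = germ w a' x \<and> germ t b x = germ w b' x) ideal_filter"
proof -
  obtain p q where pq: "p \<in> carrier S" "q \<in> carrier S" "p \<otimes>\<^bsub>S\<^esub> s = q \<otimes>\<^bsub>S\<^esub> t"
    using common_multiple assms by blast
  show thesis
  proof (rule that)
    show "eventually (\<lambda>x. germ s a x = germ (p \<otimes>\<^bsub>S\<^esub> s) (\<alpha> p a) x \<and>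
        germ t b x = germ (p \<otimes>\<^bsub>S\<^esub> s) (\<alpha> q b) x) ideal_filter"
      using germ_multiple[of s p a] germ_multiple[of t q b] pq assms
      by (simp add: eventually_conj_iff)
  qed (use pq assms S.m_closed in auto)
qed

lemma eventually_germI:
  assumes "w \<in> carrier S" "\<And>r. r \<in> carrier S \<Longrightarrow> P (r \<otimes>\<^bsub>S\<^esub> w)"
  shows "eventually P ideal_filter"
  using assms by (auto simp: eventually_ideal_filter)

text \<open>The closure of the germs under uniform approximation along the filter. Closing up at the
  level of functions supplies \<open>approx_C\<close>.\<close>

definition coherent :: "('s \<Rightarrow> 'a) set" where
  "coherent = {f. (\<forall>x. f x \<in> carrier A) \<and> (\<forall>e>0. \<exists>s\<in>carrier S. \<exists>a\<in>carrier A.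
     eventually (\<lambda>x. nrm A (f x \<ominus>\<^bsub>A\<^esub> germ s a x) \<le> e) ideal_filter)}"

lemma coherent_closed: "f \<in> coherent \<Longrightarrow> f x \<in> carrier A"
  by (simp add: coherent_def)

lemma coherent_approx:
  assumes "f \<in> coherent" "0 < e"
  obtains s a where "s \<in> carrier S" "a \<in> carrier A"
    "eventually (\<lambda>x. nrm A (f x \<ominus>\<^bsub>A\<^esub> germ s a x) \<le> e) ideal_filter"
  using assms by (auto simp: coherent_def)

lemma coherent_approx2:
  assumes "f \<in> coherent" "g \<in> coherent" "0 < e"
  obtains w a b where "w \<in> carrier S" "a \<in> carrier A" "b \<in> carrier A"
    "eventually (\<lambda>x. nrm A (f x \<ominus>\<^bsub>A\<^esub> germ w a x) \<le> e \<and> nrm A (g x \<ominus>\<^bsub>A\<^esub> germ w b x) \<le> e)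
      ideal_filter"
proof -
  obtain s a where sa: "s \<in> carrier S" "a \<in> carrier A"
    and f: "eventually (\<lambda>x. nrm A (f x \<ominus>\<^bsub>A\<^esub> germ s a x) \<le> e) ideal_filter"
    using coherent_approx assms by blast
  obtain t b where tb: "t \<in> carrier S" "b \<in> carrier A"
    and g: "eventually (\<lambda>x. nrm A (g x \<ominus>\<^bsub>A\<^esub> germ t b x) \<le> e) ideal_filter"
    using coherent_approx assms by blast
  obtain w a' b' where w: "w \<in> carrier S" "a' \<in> carrier A" "b' \<in> carrier A"
    and e: "eventually (\<lambda>x. germ s a x = germ w a' x \<and> germ t b x = germ w b' x) ideal_filter"
    using germ_common sa tb by blast
  have "eventually (\<lambda>x. nrm A (f x \<ominus>\<^bsub>A\<^esub> germ w a' x) \<le> e \<and> nrm A (g x \<ominus>\<^bsub>A\<^esub> germ w b' x) \<le> e)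
      ideal_filter"
    using f g e by eventually_elim simp
  with w show thesis
    by (rule that)
qed

text \<open>The intermediate h separates two tasks: the norm estimate, done with a sum or product of
  germs, and the identification of that expression with a single germ.\<close>

lemma coherentI:
  assumes "\<And>x. f x \<in> carrier A"
    and "\<And>e. 0 < e \<Longrightarrow> \<exists>s\<in>carrier S. \<exists>a\<in>carrier A. \<exists>h. (\<forall>x. h x \<in> carrier A) \<and>
      eventually (\<lambda>x. nrm A (f x \<ominus>\<^bsub>A\<^esub> h x) \<le> e) ideal_filter \<and>
      eventually (\<lambda>x. h x = germ s a x) ideal_filter"
  shows "f \<in> coherent"
  unfolding coherent_def mem_Collect_eq
proof (intro conjI allI impI)
  fix e :: real assume "0 < e"
  then obtain s a h where "s \<in> carrier S" "a \<in> carrier A"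
    and h: "eventually (\<lambda>x. nrm A (f x \<ominus>\<^bsub>A\<^esub> h x) \<le> e) ideal_filter"
      "eventually (\<lambda>x. h x = germ s a x) ideal_filter"
    using assms(2)[of e] by blast
  moreover from h have "eventually (\<lambda>x. nrm A (f x \<ominus>\<^bsub>A\<^esub> germ s a x) \<le> e) ideal_filter"
    by eventually_elim simp
  ultimately show "\<exists>s\<in>carrier S. \<exists>a\<in>carrier A.
      eventually (\<lambda>x. nrm A (f x \<ominus>\<^bsub>A\<^esub> germ s a x) \<le> e) ideal_filter"
    by blast
qed (rule assms(1))

lemma germ_coherent:
  assumes "s \<in> carrier S" "a \<in> carrier A"
  shows "germ s a \<in> coherent"
  using assms by (intro coherentI) (auto intro!: bexI exI[of _ "germ s a"])

lemma coherent_add: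
  assumes "f \<in> coherent" "g \<in> coherent"
  shows "(\<lambda>x. f x \<oplus>\<^bsub>A\<^esub> g x) \<in> coherent"
proof (rule coherentI)
  fix e :: real assume "0 < e"
  then obtain w a b where w: "w \<in> carrier S" "a \<in> carrier A" "b \<in> carrier A"
    and ev: "eventually (\<lambda>x. nrm A (f x \<ominus>\<^bsub>A\<^esub> germ w a x) \<le> e/2 \<and>
      nrm A (g x \<ominus>\<^bsub>A\<^esub> germ w b x) \<le> e/2) ideal_filter"
    using coherent_approx2[OF assms, of "e/2"] by auto
  show "\<exists>s\<in>carrier S. \<exists>a\<in>carrier A. \<exists>h. (\<forall>x. h x \<in> carrier A) \<and>
      eventually (\<lambda>x. nrm A ((f x \<oplus>\<^bsub>A\<^esub> g x) \<ominus>\<^bsub>A\<^esub> h x) \<le> e) ideal_filter \<and>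
      eventually (\<lambda>x. h x = germ s a x) ideal_filter"
  proof (intro bexI exI conjI)
    show "eventually (\<lambda>x. nrm A ((f x \<oplus>\<^bsub>A\<^esub> g x) \<ominus>\<^bsub>A\<^esub> (germ w a x \<oplus>\<^bsub>A\<^esub> germ w b x)) \<le> e) ideal_filter"
      using ev
    proof eventually_elim
      case (elim x)
      then show ?case
        using A.nrm_add_minus_add_le[of "f x" "g x" "germ w a x" "germ w b x"] assms w
        by (simp add: coherent_closed)
    qed
    show "eventually (\<lambda>x. germ w a x \<oplus>\<^bsub>A\<^esub> germ w b x = germ w (a \<oplus>\<^bsub>A\<^esub> b) x) ideal_filter"
      using w by (intro eventually_germI[of w]) (simp_all add: germ_mult act_add)
  qed (use w in auto)
qed (use assms coherent_closed in auto)

text \<open>The norm of \<open>germ s a\<close> is eventually ||a||, since each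
  \<open>\<alpha> r\<close> is isometric. Products need this bound because coherent functions may be
  unbounded off an ideal.\<close>

lemma coherent_bounded:
  assumes "f \<in> coherent"
  obtains K where "0 \<le> K" "eventually (\<lambda>x. nrm A (f x) \<le> K) ideal_filter"
proof -
  obtain s a where sa: "s \<in> carrier S" "a \<in> carrier A"
    and ev: "eventually (\<lambda>x. nrm A (f x \<ominus>\<^bsub>A\<^esub> germ s a x) \<le> 1) ideal_filter"
    using coherent_approx[OF assms, of 1] by auto
  have "eventually (\<lambda>x. nrm A (germ s a x) = nrm A a) ideal_filter"
    using sa by (intro eventually_germI[of s]) (simp_all add: germ_mult)
  with ev have "eventually (\<lambda>x. nrm A (f x) \<le> nrm A a + 1) ideal_filter"
  proof eventually_elim
    case (elim x)
    then show ?case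
      using A.nrm_triangle2[of "f x" "germ s a x"] assms sa by (simp add: coherent_closed)
  qed
  then show thesis
    using that[of "nrm A a + 1"] A.nrm_nonneg[OF sa(2)] by simp
qed

lemma coherent_mult:
  assumes "f \<in> coherent" "g \<in> coherent"
  shows "(\<lambda>x. f x \<otimes>\<^bsub>A\<^esub> g x) \<in> coherent"
proof (rule coherentI)
  fix e :: real assume e: "0 < e"
  obtain K where K: "0 \<le> K" "eventually (\<lambda>x. nrm A (f x) \<le> K) ideal_filter"
    using coherent_bounded[OF assms(1)] .
  obtain L where L: "0 \<le> L" "eventually (\<lambda>x. nrm A (g x) \<le> L) ideal_filter"
    using coherent_bounded[OF assms(2)] .
  \<comment> \<open>d \<le> 1 keeps the second germ below L + 1 in norm, and the other bound makes
    the total error K d + d (L + 1) at most e.\<close>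
  define d where "d = min 1 (e / (K + L + 1))"
  have "0 < e / (K + L + 1)"
    using e K L by simp
  then have d: "0 < d" "d \<le> 1" "d \<le> e / (K + L + 1)"
    by (simp_all add: d_def)
  then have de: "d * (K + L + 1) \<le> e"
    using K L pos_le_divide_eq[of "K + L + 1" d e] by simp
  obtain w a b where w: "w \<in> carrier S" "a \<in> carrier A" "b \<in> carrier A"
    and ev: "eventually (\<lambda>x. nrm A (f x \<ominus>\<^bsub>A\<^esub> germ w a x) \<le> d \<and>
      nrm A (g x \<ominus>\<^bsub>A\<^esub> germ w b x) \<le> d) ideal_filter"
    using coherent_approx2[OF assms d(1)] .
  show "\<exists>s\<in>carrier S. \<exists>a\<in>carrier A. \<exists>h. (\<forall>x. h x \<in> carrier A) \<and>
      eventually (\<lambda>x. nrm A ((f x \<otimes>\<^bsub>A\<^esub> g x) \<ominus>\<^bsub>A\<^esub> h x) \<le> e) ideal_filter \<and>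
      eventually (\<lambda>x. h x = germ s a x) ideal_filter"
  proof (intro bexI exI conjI)
    show "eventually (\<lambda>x. nrm A ((f x \<otimes>\<^bsub>A\<^esub> g x) \<ominus>\<^bsub>A\<^esub> (germ w a x \<otimes>\<^bsub>A\<^esub> germ w b x)) \<le> e) ideal_filter"
      using ev K(2) L(2)
    proof eventually_elim
      case (elim x)
      have c: "f x \<in> carrier A" "g x \<in> carrier A" "germ w a x \<in> carrier A" "germ w b x \<in> carrier A"
        using assms w by (simp_all add: coherent_closed)
      have "nrm A (germ w b x) \<le> L + 1"
        using A.nrm_triangle2[OF c(2,4)] conjunct2[OF elim(1)] elim(3) d(2) by linarith
      then have "nrm A (f x) * nrm A (g x \<ominus>\<^bsub>A\<^esub> germ w b x)
          + nrm A (f x \<ominus>\<^bsub>A\<^esub> germ w a x) * nrm A (germ w b x) \<le> K * d + d * (L + 1)"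
        using elim K L d c by (intro add_mono mult_mono) (auto simp: A.nrm_nonneg)
      also have "\<dots> \<le> e"
        using de by (simp add: algebra_simps)
      finally show ?case
        using A.nrm_mult_minus_mult_le[of "f x" "g x" "germ w a x" "germ w b x"] c by simp
    qed
    show "eventually (\<lambda>x. germ w a x \<otimes>\<^bsub>A\<^esub> germ w b x = germ w (a \<otimes>\<^bsub>A\<^esub> b) x) ideal_filter"
      using w by (intro eventually_germI[of w]) (simp_all add: germ_mult act_mult)
  qed (use w A.mult_closed in auto)
qed (use assms coherent_closed A.mult_closed in auto)

lemma coherent_smult:
  assumes "f \<in> coherent"
  shows "(\<lambda>x. c \<odot>\<^bsub>A\<^esub> f x) \<in> coherent"
proof (rule coherentI)
  fix e :: real assume e: "0 < e"
  \<comment> \<open>The added 1 covers c = 0.\<close>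
  define d where "d = e / (cmod c + 1)"
  have d: "0 < d"
    unfolding d_def by (intro divide_pos_pos e add_nonneg_pos) auto
  obtain w a where w: "w \<in> carrier S" "a \<in> carrier A"
    and ev: "eventually (\<lambda>x. nrm A (f x \<ominus>\<^bsub>A\<^esub> germ w a x) \<le> d) ideal_filter"
    using coherent_approx[OF assms d] .
  have de: "cmod c * d \<le> e"
    using e by (simp add: d_def divide_simps add_nonneg_pos)
  show "\<exists>s\<in>carrier S. \<exists>a\<in>carrier A. \<exists>h. (\<forall>x. h x \<in> carrier A) \<and>
      eventually (\<lambda>x. nrm A (c \<odot>\<^bsub>A\<^esub> f x \<ominus>\<^bsub>A\<^esub> h x) \<le> e) ideal_filter \<and>
      eventually (\<lambda>x. h x = germ s a x) ideal_filter"
  proof (intro bexI exI conjI)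
    show "eventually (\<lambda>x. nrm A (c \<odot>\<^bsub>A\<^esub> f x \<ominus>\<^bsub>A\<^esub> c \<odot>\<^bsub>A\<^esub> germ w a x) \<le> e) ideal_filter"
      using ev
    proof eventually_elim
      case (elim x)
      then have "cmod c * nrm A (f x \<ominus>\<^bsub>A\<^esub> germ w a x) \<le> cmod c * d"
        by (intro mult_left_mono) auto
      then show ?case
        using de assms w by (simp add: A.smult_minus_smult A.nrm_smult coherent_closed)
    qed
    show "eventually (\<lambda>x. c \<odot>\<^bsub>A\<^esub> germ w a x = germ w (c \<odot>\<^bsub>A\<^esub> a) x) ideal_filter"
      using w by (intro eventually_germI[of w]) (simp_all add: germ_mult act_smult)
  qed (use w in auto)
qed (use assms coherent_closed in auto)

lemma coherent_star:
  assumes "f \<in> coherent"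
  shows "(\<lambda>x. star A (f x)) \<in> coherent"
proof (rule coherentI)
  fix e :: real assume e: "0 < e"
  obtain w a where w: "w \<in> carrier S" "a \<in> carrier A"
    and ev: "eventually (\<lambda>x. nrm A (f x \<ominus>\<^bsub>A\<^esub> germ w a x) \<le> e) ideal_filter"
    using coherent_approx[OF assms e] .
  show "\<exists>s\<in>carrier S. \<exists>a\<in>carrier A. \<exists>h. (\<forall>x. h x \<in> carrier A) \<and>
      eventually (\<lambda>x. nrm A (star A (f x) \<ominus>\<^bsub>A\<^esub> h x) \<le> e) ideal_filter \<and>
      eventually (\<lambda>x. h x = germ s a x) ideal_filter"
  proof (intro bexI exI conjI)
    show "eventually (\<lambda>x. nrm A (star A (f x) \<ominus>\<^bsub>A\<^esub> star A (germ w a x)) \<le> e) ideal_filter"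
      using ev assms w by (simp add: A.star_minus_star coherent_closed)
    show "eventually (\<lambda>x. star A (germ w a x) = germ w (star A a) x) ideal_filter"
      using w by (intro eventually_germI[of w]) (simp_all add: germ_mult act_star)
  qed (use w A.star_closed in auto)
qed (use assms coherent_closed A.star_closed in auto)

text \<open>By isometry a germ has eventually constant norm, so approximation by a germ confines the
  norms of f to within e of a constant.\<close>

lemma coherent_nrm_converges:
  assumes "f \<in> coherent"
  shows "\<exists>l. ((\<lambda>x. nrm A (f x)) \<longlongrightarrow> l) ideal_filter"
proof (rule filter_convergent_real[OF ideal_filter_nontrivial])
  fix e :: real assume "0 < e"
  then obtain s a where sa: "s \<in> carrier S" "a \<in> carrier A"
    and ev: "eventually (\<lambda>x. nrm A (f x \<ominus>\<^bsub>A\<^esub> germ s a x) \<le> e) ideal_filter"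
    using coherent_approx[OF assms] by blast
  have "eventually (\<lambda>x. nrm A (germ s a x) = nrm A a) ideal_filter"
    using sa by (intro eventually_germI[of s]) (simp_all add: germ_mult)
  with ev have "eventually (\<lambda>x. \<bar>nrm A (f x) - nrm A a\<bar> \<le> e) ideal_filter"
  proof eventually_elim
    case (elim x)
    then show ?case
      using A.nrm_triangle2[of "f x" "germ s a x"] assms sa by (simp add: coherent_closed)
  qed
  then show "\<exists>l. eventually (\<lambda>x. \<bar>nrm A (f x) - l\<bar> \<le> e) ideal_filter" ..
qed

lemma coherent_approx_closed:
  assumes f: "\<And>x. f x \<in> carrier A"
    and approx: "\<And>e. 0 < e \<Longrightarrow>
      \<exists>g\<in>coherent. eventually (\<lambda>x. nrm A (f x \<ominus>\<^bsub>A\<^esub> g x) \<le> e) ideal_filter"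
  shows "f \<in> coherent"
proof (rule coherentI[OF f])
  fix e :: real assume "0 < e"
  then have e: "0 < e/2"
    by simp
  obtain g where g: "g \<in> coherent"
    and fg: "eventually (\<lambda>x. nrm A (f x \<ominus>\<^bsub>A\<^esub> g x) \<le> e/2) ideal_filter"
    using approx[OF e] by blast
  obtain s a where sa: "s \<in> carrier S" "a \<in> carrier A"
    and ev: "eventually (\<lambda>x. nrm A (g x \<ominus>\<^bsub>A\<^esub> germ s a x) \<le> e/2) ideal_filter"
    using coherent_approx[OF g e] .
  have "eventually (\<lambda>x. nrm A (f x \<ominus>\<^bsub>A\<^esub> germ s a x) \<le> e) ideal_filter"
    using fg ev
  proof eventually_elim
    case (elim x)
    then show ?case
      using A.nrm_minus_triangle[of "f x" "g x" "germ s a x"] f g sa by (simp add: coherent_closed)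
  qed
  then show "\<exists>s\<in>carrier S. \<exists>a\<in>carrier A. \<exists>h. (\<forall>x. h x \<in> carrier A) \<and>
      eventually (\<lambda>x. nrm A (f x \<ominus>\<^bsub>A\<^esub> h x) \<le> e) ideal_filter \<and>
      eventually (\<lambda>x. h x = germ s a x) ideal_filter"
    using sa by (intro bexI exI[of _ "germ s a"]) auto
qed

lemma coherent_zero: "(\<lambda>x. \<zero>\<^bsub>A\<^esub>) \<in> coherent"
proof -
  obtain s where s: "s \<in> carrier S"
    using S_nonempty by blast
  then have "eventually (\<lambda>x. \<zero>\<^bsub>A\<^esub> = germ s \<zero>\<^bsub>A\<^esub> x) ideal_filter"
    by (intro eventually_germI[of s]) (simp_all add: germ_mult act_zero)
  then show ?thesis
    using s by (intro coherentI) (auto intro!: bexI exI[of _ "\<lambda>x. \<zero>\<^bsub>A\<^esub>"])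
qed

sublocale L: cstar_limit A ideal_filter coherent
  by unfold_locales
    (simp_all add: ideal_filter_nontrivial coherent_closed coherent_zero coherent_add coherent_mult
      coherent_smult coherent_star coherent_nrm_converges coherent_approx_closed)

end

section \<open>Existence of the minimal dilation\<close>

context ore_action
begin

text \<open>The value at x is f(x g), with x g formed in G. If f(x) stands for \<beta>_x(b), then
  f(x g) stands for \<beta>_x(\<beta>_g(b)). The default zero is harmless, as x g lies in S for all
  x in some left ideal.\<close>

definition translate :: "'g \<Rightarrow> ('s \<Rightarrow> 'a) \<Rightarrow> 's \<Rightarrow> 'a" where
  "translate g f x = (if x \<in> carrier S \<and> j x \<otimes>\<^bsub>G\<^esub> g \<in> j ` carrier S
     then f (inv_into (carrier S) j (j x \<otimes>\<^bsub>G\<^esub> g)) else \<zero>\<^bsub>A\<^esub>)"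

lemma translate_eq:
  assumes "x \<in> carrier S" "y \<in> carrier S" "j y = j x \<otimes>\<^bsub>G\<^esub> g"
  shows "translate g f x = f y"
proof -
  have "inj_on j (carrier S)"
    using env by (simp add: enveloping_group_def)
  from inv_into_f_f[OF this assms(2)] show ?thesis
    using assms(1,2) by (simp add: translate_def assms(3)[symmetric])
qed

lemma translate_eventually:
  assumes "g \<in> carrier G" "eventually P ideal_filter"
  shows "eventually (\<lambda>x. \<exists>y\<in>carrier S. j y = j x \<otimes>\<^bsub>G\<^esub> g \<and> (\<forall>f. translate g f x = f y) \<and> P y)
    ideal_filter"
  using eventually_translate[OF assms]
  by eventually_elim (auto intro!: bexI simp: translate_eq)

text \<open>With b g = c s, the value at r b is that of \<open>germ s a\<close> at (r c) s, which is
  \<alpha>_r(\<alpha>_c(a)). This is \<beta>_g \<beta>_s^-1 i(a) = \<beta>_b^-1 i(\<alpha>_c(a)) in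
  terms of functions.\<close>

lemma translate_germ:
  assumes g: "g \<in> carrier G" and s: "s \<in> carrier S" "a \<in> carrier A"
  obtains b c where "b \<in> carrier S" "c \<in> carrier S" "j b \<otimes>\<^bsub>G\<^esub> g = j c \<otimes>\<^bsub>G\<^esub> j s"
    "eventually (\<lambda>x. translate g (germ s a) x = germ b (\<alpha> c a) x) ideal_filter"
proof -
  obtain b c where bc: "b \<in> carrier S" "c \<in> carrier S" and e: "j b \<otimes>\<^bsub>G\<^esub> g = j c \<otimes>\<^bsub>G\<^esub> j s"
    using translate_multiple[OF g s(1)] .
  have "translate g (germ s a) (r \<otimes>\<^bsub>S\<^esub> b) = germ b (\<alpha> c a) (r \<otimes>\<^bsub>S\<^esub> b)" if r: "r \<in> carrier S" for r
  proof -
    have "j ((r \<otimes>\<^bsub>S\<^esub> c) \<otimes>\<^bsub>S\<^esub> s) = j (r \<otimes>\<^bsub>S\<^esub> b) \<otimes>\<^bsub>G\<^esub> g"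
      using r bc s e g by (simp add: j_mult S.m_closed G.m_assoc)
    then have "translate g (germ s a) (r \<otimes>\<^bsub>S\<^esub> b) = germ s a ((r \<otimes>\<^bsub>S\<^esub> c) \<otimes>\<^bsub>S\<^esub> s)"
      using r bc s by (intro translate_eq) (simp_all add: S.m_closed)
    then show ?thesis
      using r bc s by (simp add: germ_mult S.m_closed act_act)
  qed
  then have "eventually (\<lambda>x. translate g (germ s a) x = germ b (\<alpha> c a) x) ideal_filter"
    using bc by (intro eventually_germI[of b])
  with bc e show thesis
    by (intro that)
qed

lemma translate_closed: "(\<And>x. f x \<in> carrier A) \<Longrightarrow> translate g f x \<in> carrier A"
  by (simp add: translate_def)

lemma translate_coherent:
  assumes g: "g \<in> carrier G" and f: "f \<in> coherent"
  shows "translate g f \<in> coherent"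
proof (rule coherentI)
  fix e :: real assume "0 < e"
  then obtain s a where sa: "s \<in> carrier S" "a \<in> carrier A"
    and ev: "eventually (\<lambda>x. nrm A (f x \<ominus>\<^bsub>A\<^esub> germ s a x) \<le> e) ideal_filter"
    using coherent_approx[OF f] by blast
  obtain b c where bc: "b \<in> carrier S" "c \<in> carrier S"
    "eventually (\<lambda>x. translate g (germ s a) x = germ b (\<alpha> c a) x) ideal_filter"
    using translate_germ[OF g sa] by blast
  have "eventually (\<lambda>x. nrm A (translate g f x \<ominus>\<^bsub>A\<^esub> translate g (germ s a) x) \<le> e) ideal_filter"
    using translate_eventually[OF g ev] by eventually_elim auto
  then show "\<exists>s\<in>carrier S. \<exists>a\<in>carrier A. \<exists>h. (\<forall>x. h x \<in> carrier A) \<and>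
      eventually (\<lambda>x. nrm A (translate g f x \<ominus>\<^bsub>A\<^esub> h x) \<le> e) ideal_filter \<and>
      eventually (\<lambda>x. h x = germ s a x) ideal_filter"
    using bc sa by (intro bexI[of _ b] bexI[of _ "\<alpha> c a"] exI[of _ "translate g (germ s a)"])
      (simp_all add: translate_closed)
qed (simp add: translate_closed coherent_closed[OF f])

lemma translate_lim_eq:
  assumes g: "g \<in> carrier G" and eq: "L.lim_eq f f'"
  shows "L.lim_eq (translate g f) (translate g f')"
  unfolding L.lim_eq_def
proof (rule tendstoI)
  fix e :: real assume "0 < e"
  then have "eventually (\<lambda>x. dist (nrm A (f x \<ominus>\<^bsub>A\<^esub> f' x)) 0 < e) ideal_filter"
    using eq unfolding L.lim_eq_def by (rule tendstoD[rotated])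
  from translate_eventually[OF g this]
  show "eventually (\<lambda>x. dist (nrm A (translate g f x \<ominus>\<^bsub>A\<^esub> translate g f' x)) 0 < e) ideal_filter"
    by eventually_elim auto
qed

lemma lim_eq_eventually:
  assumes "\<And>x. f x \<in> carrier A" "eventually (\<lambda>x. f x = f' x) ideal_filter"
  shows "L.lim_eq f f'"
  unfolding L.lim_eq_def
proof (rule tendsto_eventually)
  show "eventually (\<lambda>x. nrm A (f x \<ominus>\<^bsub>A\<^esub> f' x) = 0) ideal_filter"
    using assms(2)
  proof eventually_elim
    case (elim x)
    then show ?case
      using assms(1)[of x] by simp
  qed
qed

abbreviation "dil_alg \<equiv> L.limit_algebra"

text \<open>Restricted to the carrier because a \<open>group_action\<close> takes values in
  \<open>Bij\<close>, whose members are extensional.\<close>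

definition dil_act :: "'g \<Rightarrow> ('s \<Rightarrow> 'a) set \<Rightarrow> ('s \<Rightarrow> 'a) set" where
  "dil_act g = (\<lambda>X\<in>carrier dil_alg. L.lim_class (translate g (L.lim_rep X)))"

text \<open>Represents i(a), since \<beta>_x(i(a)) = i(\<alpha>_x(a)). It plays the role of a germ
  at an identity element, which S need not have.\<close>

definition orbit_fun :: "'a \<Rightarrow> 's \<Rightarrow> 'a" where
  "orbit_fun a x = (if x \<in> carrier S then \<alpha> x a else \<zero>\<^bsub>A\<^esub>)"

definition dil_emb :: "'a \<Rightarrow> ('s \<Rightarrow> 'a) set" where
  "dil_emb a = L.lim_class (orbit_fun a)"

lemma dil_act_class:
  assumes "g \<in> carrier G" "f \<in> coherent"
  shows "dil_act g (L.lim_class f) = L.lim_class (translate g f)"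
  using assms by (simp add: dil_act_def L.lim_class_eq_iff translate_coherent translate_lim_eq L.lim_eq_rep)

lemma orbit_fun_closed [simp]: "a \<in> carrier A \<Longrightarrow> orbit_fun a x \<in> carrier A"
  by (simp add: orbit_fun_def)

lemma orbit_fun_germ:
  assumes "s \<in> carrier S" "a \<in> carrier A"
  shows "eventually (\<lambda>x. orbit_fun a x = germ s (\<alpha> s a) x) ideal_filter"
  using assms
  by (intro eventually_germI[of s]) (simp_all add: germ_mult orbit_fun_def S.m_closed act_act)

lemma orbit_fun_coherent [simp]:
  assumes a: "a \<in> carrier A"
  shows "orbit_fun a \<in> coherent"
proof (rule coherentI)
  fix e :: real assume "0 < e"
  obtain s where "s \<in> carrier S"
    using S_nonempty by blast
  then show "\<exists>s\<in>carrier S. \<exists>b\<in>carrier A. \<exists>h. (\<forall>x. h x \<in> carrier A) \<and>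
      eventually (\<lambda>x. nrm A (orbit_fun a x \<ominus>\<^bsub>A\<^esub> h x) \<le> e) ideal_filter \<and>
      eventually (\<lambda>x. h x = germ s b x) ideal_filter"
    using a orbit_fun_germ \<open>0 < e\<close>
    by (intro bexI[of _ s] bexI[of _ "\<alpha> s a"] exI[of _ "orbit_fun a"]) simp_all
qed (simp add: a)

lemma dil_emb_hom: "dil_emb \<in> star_hom A dil_alg"
proof -
  have "orbit_fun (a \<oplus>\<^bsub>A\<^esub> b) = (\<lambda>x. orbit_fun a x \<oplus>\<^bsub>A\<^esub> orbit_fun b x)"
    if "a \<in> carrier A" "b \<in> carrier A" for a b
    using that by (auto simp: orbit_fun_def act_add)
  moreover have "orbit_fun (c \<odot>\<^bsub>A\<^esub> a) = (\<lambda>x. c \<odot>\<^bsub>A\<^esub> orbit_fun a x)" if "a \<in> carrier A" for a c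
    using that by (auto simp: orbit_fun_def act_smult)
  moreover have "orbit_fun (a \<otimes>\<^bsub>A\<^esub> b) = (\<lambda>x. orbit_fun a x \<otimes>\<^bsub>A\<^esub> orbit_fun b x)"
    if "a \<in> carrier A" "b \<in> carrier A" for a b
    using that by (auto simp: orbit_fun_def act_mult)
  moreover have "orbit_fun (star A a) = (\<lambda>x. star A (orbit_fun a x))" if "a \<in> carrier A" for a
    using that by (auto simp: orbit_fun_def act_star)
  ultimately show ?thesis
    by (simp add: star_hom_def dil_emb_def L.lim_class_add L.lim_class_mult L.lim_class_smult
        L.lim_class_star)
qed

text \<open>On S the difference of the two orbits has constant norm ||a - b|| by isometry, and this
  constant must be the limit 0.\<close>

lemma dil_emb_inj: "inj_on dil_emb (carrier A)"
proof (rule inj_onI)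
  fix a b assume ab: "a \<in> carrier A" "b \<in> carrier A" "dil_emb a = dil_emb b"
  then have "L.lim_eq (orbit_fun a) (orbit_fun b)"
    by (simp add: dil_emb_def L.lim_class_eq_iff)
  then have 0: "((\<lambda>x. nrm A (orbit_fun a x \<ominus>\<^bsub>A\<^esub> orbit_fun b x)) \<longlongrightarrow> 0) ideal_filter"
    by (simp add: L.lim_eq_def)
  have "eventually (\<lambda>x. nrm A (orbit_fun a x \<ominus>\<^bsub>A\<^esub> orbit_fun b x) = nrm A (a \<ominus>\<^bsub>A\<^esub> b)) ideal_filter"
    using eventually_in_S
  proof eventually_elim
    case (elim x)
    then have "orbit_fun a x \<ominus>\<^bsub>A\<^esub> orbit_fun b x = \<alpha> x (a \<ominus>\<^bsub>A\<^esub> b)"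
      using ab cstar_hom.hom_minus[OF act_hom] by (simp add: orbit_fun_def)
    then show ?case
      using elim ab by simp
  qed
  from tendsto_unique[OF ideal_filter_nontrivial tendsto_eventually[OF this] 0]
  show "a = b"
    using ab by (simp add: A.nrm_minus_eq_0)
qed

text \<open>Translation changes only the argument, so it commutes with pointwise operations; its
  default value zero is preserved by all of them.\<close>

lemma dil_act_hom:
  assumes g: "g \<in> carrier G"
  shows "dil_act g \<in> star_hom dil_alg dil_alg"
proof -
  have "translate g (\<lambda>x. f x \<oplus>\<^bsub>A\<^esub> f' x) = (\<lambda>x. translate g f x \<oplus>\<^bsub>A\<^esub> translate g f' x)"
    if "f \<in> coherent" "f' \<in> coherent" for f f'
    by (auto simp: translate_def)
  moreover have "translate g (\<lambda>x. c \<odot>\<^bsub>A\<^esub> f x) = (\<lambda>x. c \<odot>\<^bsub>A\<^esub> translate g f x)" for c f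
    by (auto simp: translate_def)
  moreover have "translate g (\<lambda>x. f x \<otimes>\<^bsub>A\<^esub> f' x) = (\<lambda>x. translate g f x \<otimes>\<^bsub>A\<^esub> translate g f' x)"
    if "f \<in> coherent" "f' \<in> coherent" for f f'
    by (auto simp: translate_def)
  moreover have "translate g (\<lambda>x. star A (f x)) = (\<lambda>x. star A (translate g f x))" for f
    by (auto simp: translate_def)
  ultimately show ?thesis
    using g
    by (auto simp: star_hom_def L.carrier_limit_algebra L.lim_class_add L.lim_class_mult
        L.lim_class_smult L.lim_class_star dil_act_class translate_coherent
        coherent_add coherent_mult coherent_smult coherent_star)
qed

lemma dil_act_one:
  assumes "X \<in> carrier dil_alg"
  shows "dil_act \<one>\<^bsub>G\<^esub> X = X"
proof -
  obtain f where f: "f \<in> coherent" "X = L.lim_class f"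
    using assms by (auto simp: L.carrier_limit_algebra)
  have "eventually (\<lambda>x. translate \<one>\<^bsub>G\<^esub> f x = f x) ideal_filter"
    using eventually_in_S by eventually_elim (simp add: translate_eq)
  then have "L.lim_eq (translate \<one>\<^bsub>G\<^esub> f) f"
    using f by (intro lim_eq_eventually) (simp_all add: translate_closed)
  then show ?thesis
    using f by (simp add: dil_act_class L.lim_class_eq_iff translate_coherent)
qed

text \<open>f(x (g h)) = f((x g) h), so right translations compose in the order of a left action.
  Equality holds only eventually, because the composite also needs x g to lie in S.\<close>

lemma dil_act_mult:
  assumes g: "g \<in> carrier G" and h: "h \<in> carrier G" and X: "X \<in> carrier dil_alg"
  shows "dil_act (g \<otimes>\<^bsub>G\<^esub> h) X = dil_act g (dil_act h X)"
proof -
  obtain f where f: "f \<in> coherent" "X = L.lim_class f"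
    using X by (auto simp: L.carrier_limit_algebra)
  have "eventually (\<lambda>x. translate (g \<otimes>\<^bsub>G\<^esub> h) f x = translate g (translate h f) x) ideal_filter"
    using eventually_in_S
      translate_eventually[OF g translate_eventually[OF h eventually_True]]
  proof eventually_elim
    case (elim x)
    then obtain y z where yz: "y \<in> carrier S" "z \<in> carrier S" "j y = j x \<otimes>\<^bsub>G\<^esub> g"
      "j z = j y \<otimes>\<^bsub>G\<^esub> h" "translate g (translate h f) x = translate h f y"
      "translate h f y = f z"
      by blast
    then have "j z = j x \<otimes>\<^bsub>G\<^esub> (g \<otimes>\<^bsub>G\<^esub> h)"
      using g h elim by (simp add: G.m_assoc)
    then show ?case
      using yz elim translate_eq by simp
  qed
  then have "L.lim_eq (translate (g \<otimes>\<^bsub>G\<^esub> h) f) (translate g (translate h f))"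
    using f by (intro lim_eq_eventually) (simp_all add: translate_closed)
  then show ?thesis
    using f g h by (simp add: dil_act_class L.lim_class_eq_iff translate_coherent)
qed

lemma dil_act_closed: "\<lbrakk>g \<in> carrier G; X \<in> carrier dil_alg\<rbrakk> \<Longrightarrow> dil_act g X \<in> carrier dil_alg"
  using dil_act_hom[of g] by (auto simp: star_hom_def)

lemma dil_group_action: "group_action G (carrier dil_alg) dil_act"
proof -
  have bij: "dil_act g \<in> Bij (carrier dil_alg)" if g: "g \<in> carrier G" for g
  proof -
    have "bij_betw (dil_act g) (carrier dil_alg) (carrier dil_alg)"
    proof (rule bij_betwI[where g = "dil_act (inv\<^bsub>G\<^esub> g)"])
      fix X assume X: "X \<in> carrier dil_alg"
      show "dil_act (inv\<^bsub>G\<^esub> g) (dil_act g X) = X" "dil_act g (dil_act (inv\<^bsub>G\<^esub> g) X) = X"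
        using g X by (simp_all add: dil_act_one flip: dil_act_mult)
    qed (use g dil_act_closed in auto)
    then show ?thesis
      by (simp add: Bij_def dil_act_def)
  qed
  have "dil_act (g \<otimes>\<^bsub>G\<^esub> h) = compose (carrier dil_alg) (dil_act g) (dil_act h)"
    if "g \<in> carrier G" "h \<in> carrier G" for g h
  proof (rule extensionalityI)
    show "dil_act (g \<otimes>\<^bsub>G\<^esub> h) \<in> extensional (carrier dil_alg)"
      by (simp add: dil_act_def)
  qed (use that in \<open>simp_all add: compose_def dil_act_mult\<close>)
  then have "dil_act \<in> hom G (BijGroup (carrier dil_alg))"
    using bij by (simp add: hom_def BijGroup_def)
  then show ?thesis
    unfolding group_action_def
    by (intro group_hom.intro group_hom_axioms.intro group_BijGroup G.group_axioms)
qed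

lemma dil_act_emb:
  assumes s: "s \<in> carrier S" and a: "a \<in> carrier A"
  shows "dil_act (j s) (dil_emb a) = dil_emb (\<alpha> s a)"
proof -
  have "eventually (\<lambda>x. translate (j s) (orbit_fun a) x = orbit_fun (\<alpha> s a) x) ideal_filter"
    using eventually_in_S
  proof eventually_elim
    case (elim x)
    then have "translate (j s) (orbit_fun a) x = orbit_fun a (x \<otimes>\<^bsub>S\<^esub> s)"
      using s by (intro translate_eq) (simp_all add: S.m_closed j_mult)
    then show ?case
      using elim s a by (simp add: orbit_fun_def S.m_closed act_act)
  qed
  then have "L.lim_eq (translate (j s) (orbit_fun a)) (orbit_fun (\<alpha> s a))"
    using a by (intro lim_eq_eventually) (simp_all add: translate_closed)
  then show ?thesis
    using s a by (simp add: dil_emb_def dil_act_class L.lim_class_eq_iff translate_coherent)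
qed

text \<open>Identifies the class of \<open>germ s a\<close> with \<beta>_s^-1(i(a)). The density
  required for minimality then amounts to the approximation by germs that defines
  \<open>coherent\<close>.\<close>

lemma dil_act_germ:
  assumes s: "s \<in> carrier S" and a: "a \<in> carrier A"
  shows "dil_act (j s) (L.lim_class (germ s a)) = dil_emb a"
proof -
  have "eventually (\<lambda>x. translate (j s) (germ s a) x = orbit_fun a x) ideal_filter"
    using eventually_in_S
  proof eventually_elim
    case (elim x)
    then have "translate (j s) (germ s a) x = germ s a (x \<otimes>\<^bsub>S\<^esub> s)"
      using s by (intro translate_eq) (simp_all add: S.m_closed j_mult)
    then show ?case
      using elim s by (simp add: orbit_fun_def germ_mult)
  qed
  then have "L.lim_eq (translate (j s) (germ s a)) (orbit_fun a)"
    using a by (intro lim_eq_eventually) (simp_all add: translate_closed)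
  then show ?thesis
    using s a by (simp add: dil_emb_def dil_act_class L.lim_class_eq_iff translate_coherent germ_coherent)
qed

lemma dil_minimal: "minimal_system S j A dil_alg dil_act dil_emb"
proof -
  interpret dil_alg: cstar_algebra dil_alg
    by (rule L.cstar_algebra_limit_algebra)
  let ?U = "\<Union>s\<in>carrier S. {b \<in> carrier dil_alg. dil_act (j s) b \<in> dil_emb ` carrier A}"
  have "\<exists>Y\<in>?U. Y \<in> dil_alg.met.mball X r" if X: "X \<in> carrier dil_alg" and r: "0 < r" for X r
  proof -
    obtain f where f: "f \<in> coherent" "X = L.lim_class f"
      using X by (auto simp: L.carrier_limit_algebra)
    \<comment> \<open>The limit norm inherits only a non-strict bound while the ball is open, hence
      r/2.\<close>
    obtain s a where sa: "s \<in> carrier S" "a \<in> carrier A"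
      and ev: "eventually (\<lambda>x. nrm A (f x \<ominus>\<^bsub>A\<^esub> germ s a x) \<le> r/2) ideal_filter"
      using coherent_approx[OF f(1), of "r/2"] r by auto
    have c: "germ s a \<in> coherent"
      using sa by (rule germ_coherent)
    have "L.lim_nrm (\<lambda>x. f x \<ominus>\<^bsub>A\<^esub> germ s a x) \<le> r/2"
      using f c ev by (intro L.lim_nrm_le[OF _ tendsto_const]) simp_all
    then have "L.lim_class (germ s a) \<in> dil_alg.met.mball X r"
      using f c r by (simp add: L.dist_lim_class)
    moreover have "L.lim_class (germ s a) \<in> ?U"
      using sa c dil_act_germ[OF sa] by (auto intro!: bexI[of _ s])
    ultimately show ?thesis by blast
  qed
  then show ?thesis
    unfolding minimal_system_def dil_alg.met.metric_closure_of by blast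
qed

theorem dilation_exists: "minimal_dilation S G j A \<alpha> dil_alg dil_act dil_emb"
  unfolding minimal_dilation_def cstar_dynamical_system_def dilates_def
  using L.cstar_algebra_limit_algebra dil_group_action dil_act_hom dil_emb_hom dil_emb_inj
    dil_act_emb dil_minimal by blast

end

section \<open>Uniqueness of the minimal dilation\<close>

locale minimal_dil = ore_action S G A j \<alpha>
  for S :: "('s, 'k) monoid_scheme" and G :: "('g, 'l) monoid_scheme"
    and A :: "('a, 'm) cstar_scheme" and j \<alpha> +
  fixes B :: "('b, 'n) cstar_scheme" and \<beta> :: "'g \<Rightarrow> 'b \<Rightarrow> 'b" and i :: "'a \<Rightarrow> 'b"
  assumes minimal: "minimal_dilation S G j A \<alpha> B \<beta> i"
begin

sublocale B: cstar_algebra B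
  using minimal by (simp add: minimal_dilation_def cstar_dynamical_system_def)

lemma action: "group_action G (carrier B) \<beta>"
  using minimal by (simp add: minimal_dilation_def cstar_dynamical_system_def)

lemma \<beta>_hom: "g \<in> carrier G \<Longrightarrow> cstar_hom B B (\<beta> g)"
  using minimal B.cstar_algebra_axioms
  by (simp add: minimal_dilation_def cstar_dynamical_system_def cstar_hom_def cstar_hom_axioms_def)

lemma i_hom: "cstar_hom A B i"
  using minimal A.cstar_algebra_axioms B.cstar_algebra_axioms
  by (simp add: minimal_dilation_def cstar_hom_def cstar_hom_axioms_def)

lemma \<beta>_closed [simp]: "\<lbrakk>g \<in> carrier G; b \<in> carrier B\<rbrakk> \<Longrightarrow> \<beta> g b \<in> carrier B"
  using cstar_hom.hom_closed[OF \<beta>_hom] .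

lemma \<beta>_\<beta>:
  "\<lbrakk>g \<in> carrier G; h \<in> carrier G; b \<in> carrier B\<rbrakk> \<Longrightarrow> \<beta> g (\<beta> h b) = \<beta> (g \<otimes>\<^bsub>G\<^esub> h) b"
  using group_action.composition_rule[OF action] by simp

lemma \<beta>_one [simp]: "b \<in> carrier B \<Longrightarrow> \<beta> \<one>\<^bsub>G\<^esub> b = b"
  using group_action.id_eq_one[OF action] by (metis restrict_apply')

lemma \<beta>_isometric: "\<lbrakk>g \<in> carrier G; b \<in> carrier B\<rbrakk> \<Longrightarrow> nrm B (\<beta> g b) = nrm B b"
  using cstar_hom.isometric[OF \<beta>_hom group_action.inj_prop[OF action]] by blast

lemma i_closed [simp]: "a \<in> carrier A \<Longrightarrow> i a \<in> carrier B"
  using cstar_hom.hom_closed[OF i_hom] .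

lemma i_isometric: "a \<in> carrier A \<Longrightarrow> nrm B (i a) = nrm A a"
  using cstar_hom.isometric[OF i_hom] minimal by (simp add: minimal_dilation_def)

lemma dilates: "\<lbrakk>s \<in> carrier S; a \<in> carrier A\<rbrakk> \<Longrightarrow> i (\<alpha> s a) = \<beta> (j s) (i a)"
  using minimal by (simp add: minimal_dilation_def dilates_def)

text \<open>Parametrises the dense union in the minimality condition by pairs (s, a). Such pairs
  make sense for every dilation of \<alpha>, so elements of two dilations can be compared through
  them.\<close>

definition \<kappa> :: "'s \<Rightarrow> 'a \<Rightarrow> 'b" where
  "\<kappa> s a = \<beta> (inv\<^bsub>G\<^esub> (j s)) (i a)"

lemma \<kappa>_closed [simp]: "\<lbrakk>s \<in> carrier S; a \<in> carrier A\<rbrakk> \<Longrightarrow> \<kappa> s a \<in> carrier B"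
  by (simp add: \<kappa>_def)

lemma \<kappa>_isometric [simp]: "\<lbrakk>s \<in> carrier S; a \<in> carrier A\<rbrakk> \<Longrightarrow> nrm B (\<kappa> s a) = nrm A a"
  by (simp add: \<kappa>_def \<beta>_isometric i_isometric)

lemma \<kappa>_hom:
  assumes "s \<in> carrier S"
  shows "cstar_hom A B (\<kappa> s)"
proof -
  interpret I: cstar_hom A B i
    by (rule i_hom)
  interpret H: cstar_hom B B "\<beta> (inv\<^bsub>G\<^esub> (j s))"
    using assms by (intro \<beta>_hom) simp
  show ?thesis
    using assms by unfold_locales
      (simp add: star_hom_def \<kappa>_def I.hom_add I.hom_mult I.hom_smult I.hom_star
        H.hom_add H.hom_mult H.hom_smult H.hom_star)
qed

text \<open>From b g = c s follows g s^-1 = b^-1 c. The new parameters b and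
  \<open>\<alpha> c a\<close> do not depend on B, so g moves corresponding elements of two dilations
  in the same way.\<close>

lemma \<kappa>_act:
  assumes "g \<in> carrier G" "s \<in> carrier S" "a \<in> carrier A" "b \<in> carrier S" "c \<in> carrier S"
    and e: "j b \<otimes>\<^bsub>G\<^esub> g = j c \<otimes>\<^bsub>G\<^esub> j s"
  shows "\<beta> g (\<kappa> s a) = \<kappa> b (\<alpha> c a)"
proof -
  have "g = inv\<^bsub>G\<^esub> (j b) \<otimes>\<^bsub>G\<^esub> (j c \<otimes>\<^bsub>G\<^esub> j s)"
    using assms G.inv_solve_left[of g "j b" "j c \<otimes>\<^bsub>G\<^esub> j s"] by simp
  then have "g \<otimes>\<^bsub>G\<^esub> inv\<^bsub>G\<^esub> (j s) = inv\<^bsub>G\<^esub> (j b) \<otimes>\<^bsub>G\<^esub> j c"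
    using assms by (simp add: G.m_assoc)
  then show ?thesis
    using assms by (simp add: \<kappa>_def \<beta>_\<beta> dilates)
qed

lemma \<kappa>_multiple:
  assumes "s \<in> carrier S" "p \<in> carrier S" "a \<in> carrier A"
  shows "\<kappa> (p \<otimes>\<^bsub>S\<^esub> s) (\<alpha> p a) = \<kappa> s a"
  using assms \<kappa>_act[of "\<one>\<^bsub>G\<^esub>" s a "p \<otimes>\<^bsub>S\<^esub> s" p] by (simp add: S.m_closed j_mult)

lemma \<kappa>_emb: "\<lbrakk>s \<in> carrier S; a \<in> carrier A\<rbrakk> \<Longrightarrow> \<kappa> s (\<alpha> s a) = i a"
  by (simp add: \<kappa>_def dilates \<beta>_\<beta>)

lemma dense:
  assumes b: "b \<in> carrier B" and e: "0 < e"
  obtains s a where "s \<in> carrier S" "a \<in> carrier A" "nrm B (b \<ominus>\<^bsub>B\<^esub> \<kappa> s a) \<le> e"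
proof -
  have "b \<in> B.met.mtopology closure_of
      (\<Union>s\<in>carrier S. {b \<in> carrier B. \<beta> (j s) b \<in> i ` carrier A})"
    using b minimal by (simp add: minimal_dilation_def minimal_system_def)
  then obtain s y where s: "s \<in> carrier S" and y: "y \<in> carrier B" "\<beta> (j s) y \<in> i ` carrier A"
    and d: "cstar_dist B b y < e"
    using e by (force simp: B.met.metric_closure_of)
  then obtain a where a: "a \<in> carrier A" "\<beta> (j s) y = i a"
    by blast
  have "\<kappa> s a = y"
    using s y by (simp add: \<kappa>_def \<beta>_\<beta> flip: a(2))
  then show thesis
    using that[OF s a(1)] d b y by (simp add: cstar_dist_def)
qed

end

section \<open>Comparison of two minimal dilations\<close>

locale dil_pair = D: minimal_dil S G A j \<alpha> B \<beta> i + D': minimal_dil S G A j \<alpha> B' \<beta>' i'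
  for S :: "('s, 'k) monoid_scheme" and G :: "('g, 'l) monoid_scheme"
    and A :: "('a, 'm) cstar_scheme" and j \<alpha>
    and B :: "('b, 'n) cstar_scheme" and \<beta> i and B' :: "('c, 'p) cstar_scheme" and \<beta>' i'
begin

text \<open>The graph of the isomorphism: the closure of the set of pairs of corresponding elements
  of the two dense subalgebras.\<close>

definition rel :: "'b \<Rightarrow> 'c \<Rightarrow> bool" where
  "rel b b' \<longleftrightarrow> b \<in> carrier B \<and> b' \<in> carrier B' \<and> (\<forall>e>0. \<exists>s\<in>carrier S. \<exists>a\<in>carrier A.
     nrm B (b \<ominus>\<^bsub>B\<^esub> D.\<kappa> s a) \<le> e \<and> nrm B' (b' \<ominus>\<^bsub>B'\<^esub> D'.\<kappa> s a) \<le> e)"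

lemma rel_closed: "rel b b' \<Longrightarrow> b \<in> carrier B" "rel b b' \<Longrightarrow> b' \<in> carrier B'"
  by (auto simp: rel_def)

lemma relE:
  assumes "rel b b'" "0 < e"
  obtains s a where "s \<in> carrier S" "a \<in> carrier A"
    "nrm B (b \<ominus>\<^bsub>B\<^esub> D.\<kappa> s a) \<le> e" "nrm B' (b' \<ominus>\<^bsub>B'\<^esub> D'.\<kappa> s a) \<le> e"
  using assms unfolding rel_def by blast

text \<open>A common multiple p s = q t brings both approximants to one index, where sums and
  products can be formed inside A.\<close>

lemma rel2E:
  assumes b: "rel b b'" and c: "rel c c'" and e: "0 < e"
  obtains s x y where "s \<in> carrier S" "x \<in> carrier A" "y \<in> carrier A"
    "nrm B (b \<ominus>\<^bsub>B\<^esub> D.\<kappa> s x) \<le> e" "nrm B' (b' \<ominus>\<^bsub>B'\<^esub> D'.\<kappa> s x) \<le> e"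
    "nrm B (c \<ominus>\<^bsub>B\<^esub> D.\<kappa> s y) \<le> e" "nrm B' (c' \<ominus>\<^bsub>B'\<^esub> D'.\<kappa> s y) \<le> e"
proof -
  obtain s x where s: "s \<in> carrier S" "x \<in> carrier A"
    "nrm B (b \<ominus>\<^bsub>B\<^esub> D.\<kappa> s x) \<le> e" "nrm B' (b' \<ominus>\<^bsub>B'\<^esub> D'.\<kappa> s x) \<le> e"
    using relE[OF b e] .
  obtain t y where t: "t \<in> carrier S" "y \<in> carrier A"
    "nrm B (c \<ominus>\<^bsub>B\<^esub> D.\<kappa> t y) \<le> e" "nrm B' (c' \<ominus>\<^bsub>B'\<^esub> D'.\<kappa> t y) \<le> e"
    using relE[OF c e] .
  obtain p q where pq: "p \<in> carrier S" "q \<in> carrier S" "p \<otimes>\<^bsub>S\<^esub> s = q \<otimes>\<^bsub>S\<^esub> t"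
    using D.common_multiple s t by blast
  have "D.\<kappa> (p \<otimes>\<^bsub>S\<^esub> s) (\<alpha> p x) = D.\<kappa> s x" "D'.\<kappa> (p \<otimes>\<^bsub>S\<^esub> s) (\<alpha> p x) = D'.\<kappa> s x"
    using s pq(1) by (simp_all add: D.\<kappa>_multiple D'.\<kappa>_multiple)
  moreover have "D.\<kappa> (p \<otimes>\<^bsub>S\<^esub> s) (\<alpha> q y) = D.\<kappa> t y" "D'.\<kappa> (p \<otimes>\<^bsub>S\<^esub> s) (\<alpha> q y) = D'.\<kappa> t y"
    unfolding pq(3) using t pq(2) by (simp_all add: D.\<kappa>_multiple D'.\<kappa>_multiple)
  ultimately show thesis
    using that[of "p \<otimes>\<^bsub>S\<^esub> s" "\<alpha> p x" "\<alpha> q y"] s t pq(1,2) by (simp add: D.S.m_closed)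
qed

text \<open>Both norms are within e/2 of ||a|| for a common approximating pair (s, a), as
  \<open>D.\<kappa> s\<close> and \<open>D'.\<kappa> s\<close> are isometric.\<close>

lemma rel_nrm:
  assumes "rel b b'"
  shows "nrm B b = nrm B' b'"
proof -
  have "\<bar>nrm B b - nrm B' b'\<bar> \<le> 0 + e" if "0 < e" for e
  proof -
    have "0 < e/2"
      using that by simp
    then obtain s a where s: "s \<in> carrier S" "a \<in> carrier A"
      "nrm B (b \<ominus>\<^bsub>B\<^esub> D.\<kappa> s a) \<le> e/2" "nrm B' (b' \<ominus>\<^bsub>B'\<^esub> D'.\<kappa> s a) \<le> e/2"
      by (rule relE[OF assms])
    then show ?thesis
      using D.B.nrm_triangle2[of b "D.\<kappa> s a"] D'.B.nrm_triangle2[of b' "D'.\<kappa> s a"]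
        rel_closed[OF assms] by simp
  qed
  then have "\<bar>nrm B b - nrm B' b'\<bar> \<le> 0"
    by (rule field_le_epsilon)
  then show ?thesis by simp
qed

lemma rel_add:
  assumes b: "rel b b'" and c: "rel c c'"
  shows "rel (b \<oplus>\<^bsub>B\<^esub> c) (b' \<oplus>\<^bsub>B'\<^esub> c')"
  unfolding rel_def
proof (intro conjI allI impI)
  fix e :: real assume "0 < e"
  then have e: "0 < e/2"
    by simp
  obtain s x y where s: "s \<in> carrier S" "x \<in> carrier A" "y \<in> carrier A"
    "nrm B (b \<ominus>\<^bsub>B\<^esub> D.\<kappa> s x) \<le> e/2" "nrm B' (b' \<ominus>\<^bsub>B'\<^esub> D'.\<kappa> s x) \<le> e/2"
    "nrm B (c \<ominus>\<^bsub>B\<^esub> D.\<kappa> s y) \<le> e/2" "nrm B' (c' \<ominus>\<^bsub>B'\<^esub> D'.\<kappa> s y) \<le> e/2"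
    using rel2E[OF b c e] .
  have "D.\<kappa> s (x \<oplus>\<^bsub>A\<^esub> y) = D.\<kappa> s x \<oplus>\<^bsub>B\<^esub> D.\<kappa> s y" "D'.\<kappa> s (x \<oplus>\<^bsub>A\<^esub> y) = D'.\<kappa> s x \<oplus>\<^bsub>B'\<^esub> D'.\<kappa> s y"
    using s by (simp_all add: cstar_hom.hom_add[OF D.\<kappa>_hom] cstar_hom.hom_add[OF D'.\<kappa>_hom])
  then have "nrm B ((b \<oplus>\<^bsub>B\<^esub> c) \<ominus>\<^bsub>B\<^esub> D.\<kappa> s (x \<oplus>\<^bsub>A\<^esub> y)) \<le> e"
    "nrm B' ((b' \<oplus>\<^bsub>B'\<^esub> c') \<ominus>\<^bsub>B'\<^esub> D'.\<kappa> s (x \<oplus>\<^bsub>A\<^esub> y)) \<le> e"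
    using D.B.nrm_add_minus_add_le[of b c "D.\<kappa> s x" "D.\<kappa> s y"]
      D'.B.nrm_add_minus_add_le[of b' c' "D'.\<kappa> s x" "D'.\<kappa> s y"] s
      rel_closed[OF b] rel_closed[OF c] by simp_all
  then show "\<exists>s\<in>carrier S. \<exists>a\<in>carrier A. nrm B ((b \<oplus>\<^bsub>B\<^esub> c) \<ominus>\<^bsub>B\<^esub> D.\<kappa> s a) \<le> e \<and>
      nrm B' ((b' \<oplus>\<^bsub>B'\<^esub> c') \<ominus>\<^bsub>B'\<^esub> D'.\<kappa> s a) \<le> e"
    using s by (intro bexI[of _ s] bexI[of _ "x \<oplus>\<^bsub>A\<^esub> y"]) auto
qed (use rel_closed[OF b] rel_closed[OF c] in auto)

lemma rel_mult:
  assumes b: "rel b b'" and c: "rel c c'"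
  shows "rel (b \<otimes>\<^bsub>B\<^esub> c) (b' \<otimes>\<^bsub>B'\<^esub> c')"
  unfolding rel_def
proof (intro conjI allI impI)
  fix e :: real assume e: "0 < e"
  define K where "K = nrm B b + nrm B c + 1"
  have K: "1 \<le> K"
    using D.B.nrm_nonneg rel_closed[OF b] rel_closed[OF c] by (simp add: K_def)
  define d where "d = min 1 (e / K)"
  have d: "0 < d" "d \<le> 1" "d \<le> e / K"
    using e K by (simp_all add: d_def)
  then have dK: "d * K \<le> e"
    using K pos_le_divide_eq[of K d e] by simp
  obtain s x y where s: "s \<in> carrier S" "x \<in> carrier A" "y \<in> carrier A"
    "nrm B (b \<ominus>\<^bsub>B\<^esub> D.\<kappa> s x) \<le> d" "nrm B' (b' \<ominus>\<^bsub>B'\<^esub> D'.\<kappa> s x) \<le> d"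
    "nrm B (c \<ominus>\<^bsub>B\<^esub> D.\<kappa> s y) \<le> d" "nrm B' (c' \<ominus>\<^bsub>B'\<^esub> D'.\<kappa> s y) \<le> d"
    using rel2E[OF b c d(1)] .
  have m: "D.\<kappa> s (x \<otimes>\<^bsub>A\<^esub> y) = D.\<kappa> s x \<otimes>\<^bsub>B\<^esub> D.\<kappa> s y" "D'.\<kappa> s (x \<otimes>\<^bsub>A\<^esub> y) = D'.\<kappa> s x \<otimes>\<^bsub>B'\<^esub> D'.\<kappa> s y"
    using s by (simp_all add: cstar_hom.hom_mult[OF D.\<kappa>_hom] cstar_hom.hom_mult[OF D'.\<kappa>_hom])
  have y: "nrm A y \<le> nrm B c + 1"
    using D.B.nrm_triangle2[of c "D.\<kappa> s y"] s d rel_closed[OF c] by simp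
  \<comment> \<open>One estimate serves both algebras: b and b' have the same norm, and the
    approximant at y has norm ||y|| in either.\<close>
  have bound: "nrm B b * u + v * nrm A y \<le> e" if "0 \<le> u" "u \<le> d" "v \<le> d" "0 \<le> v" for u v
  proof -
    have "nrm B b * u + v * nrm A y \<le> nrm B b * d + d * (nrm B c + 1)"
      using that y d D.A.nrm_nonneg[OF s(3)] D.B.nrm_nonneg[OF rel_closed(1)[OF b]]
      by (intro add_mono mult_mono) auto
    also have "\<dots> \<le> e"
      using dK by (simp add: K_def algebra_simps)
    finally show ?thesis .
  qed
  have "nrm B ((b \<otimes>\<^bsub>B\<^esub> c) \<ominus>\<^bsub>B\<^esub> D.\<kappa> s (x \<otimes>\<^bsub>A\<^esub> y)) \<le> e"
    using D.B.nrm_mult_minus_mult_le[of b c "D.\<kappa> s x" "D.\<kappa> s y"] s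
      bound[of "nrm B (c \<ominus>\<^bsub>B\<^esub> D.\<kappa> s y)" "nrm B (b \<ominus>\<^bsub>B\<^esub> D.\<kappa> s x)"]
      rel_closed[OF b] rel_closed[OF c] by (simp add: m D.B.nrm_nonneg)
  moreover have "nrm B' ((b' \<otimes>\<^bsub>B'\<^esub> c') \<ominus>\<^bsub>B'\<^esub> D'.\<kappa> s (x \<otimes>\<^bsub>A\<^esub> y)) \<le> e"
    using D'.B.nrm_mult_minus_mult_le[of b' c' "D'.\<kappa> s x" "D'.\<kappa> s y"] s
      bound[of "nrm B' (c' \<ominus>\<^bsub>B'\<^esub> D'.\<kappa> s y)" "nrm B' (b' \<ominus>\<^bsub>B'\<^esub> D'.\<kappa> s x)"]
      rel_closed[OF b] rel_closed[OF c] rel_nrm[OF b] by (simp add: m D'.B.nrm_nonneg)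
  ultimately show "\<exists>s\<in>carrier S. \<exists>a\<in>carrier A. nrm B ((b \<otimes>\<^bsub>B\<^esub> c) \<ominus>\<^bsub>B\<^esub> D.\<kappa> s a) \<le> e \<and>
      nrm B' ((b' \<otimes>\<^bsub>B'\<^esub> c') \<ominus>\<^bsub>B'\<^esub> D'.\<kappa> s a) \<le> e"
    using s D.A.mult_closed by (intro bexI[of _ s] bexI[of _ "x \<otimes>\<^bsub>A\<^esub> y"]) auto
qed (use rel_closed[OF b] rel_closed[OF c] D.B.mult_closed D'.B.mult_closed in auto)

lemma rel_smult:
  assumes b: "rel b b'"
  shows "rel (c \<odot>\<^bsub>B\<^esub> b) (c \<odot>\<^bsub>B'\<^esub> b')"
  unfolding rel_def
proof (intro conjI allI impI)
  fix e :: real assume e: "0 < e"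
  define d where "d = e / (cmod c + 1)"
  have d: "0 < d"
    unfolding d_def by (intro divide_pos_pos e add_nonneg_pos) auto
  have de: "cmod c * u \<le> e" if "u \<le> d" for u
  proof -
    have "cmod c * u \<le> cmod c * d"
      using that by (intro mult_left_mono) auto
    also have "\<dots> \<le> e"
      using e by (simp add: d_def divide_simps add_nonneg_pos)
    finally show ?thesis .
  qed
  obtain s x where s: "s \<in> carrier S" "x \<in> carrier A"
    "nrm B (b \<ominus>\<^bsub>B\<^esub> D.\<kappa> s x) \<le> d" "nrm B' (b' \<ominus>\<^bsub>B'\<^esub> D'.\<kappa> s x) \<le> d"
    using relE[OF b d] .
  have "D.\<kappa> s (c \<odot>\<^bsub>A\<^esub> x) = c \<odot>\<^bsub>B\<^esub> D.\<kappa> s x" "D'.\<kappa> s (c \<odot>\<^bsub>A\<^esub> x) = c \<odot>\<^bsub>B'\<^esub> D'.\<kappa> s x"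
    using s by (simp_all add: cstar_hom.hom_smult[OF D.\<kappa>_hom] cstar_hom.hom_smult[OF D'.\<kappa>_hom])
  then have "nrm B (c \<odot>\<^bsub>B\<^esub> b \<ominus>\<^bsub>B\<^esub> D.\<kappa> s (c \<odot>\<^bsub>A\<^esub> x)) \<le> e"
    "nrm B' (c \<odot>\<^bsub>B'\<^esub> b' \<ominus>\<^bsub>B'\<^esub> D'.\<kappa> s (c \<odot>\<^bsub>A\<^esub> x)) \<le> e"
    using s de rel_closed[OF b]
    by (simp_all add: D.B.smult_minus_smult D'.B.smult_minus_smult D.B.nrm_smult D'.B.nrm_smult)
  then show "\<exists>s\<in>carrier S. \<exists>a\<in>carrier A. nrm B (c \<odot>\<^bsub>B\<^esub> b \<ominus>\<^bsub>B\<^esub> D.\<kappa> s a) \<le> e \<and>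
      nrm B' (c \<odot>\<^bsub>B'\<^esub> b' \<ominus>\<^bsub>B'\<^esub> D'.\<kappa> s a) \<le> e"
    using s by (intro bexI[of _ s] bexI[of _ "c \<odot>\<^bsub>A\<^esub> x"]) auto
qed (use rel_closed[OF b] in auto)

lemma rel_star:
  assumes b: "rel b b'"
  shows "rel (star B b) (star B' b')"
  unfolding rel_def
proof (intro conjI allI impI)
  fix e :: real assume e: "0 < e"
  obtain s x where s: "s \<in> carrier S" "x \<in> carrier A"
    "nrm B (b \<ominus>\<^bsub>B\<^esub> D.\<kappa> s x) \<le> e" "nrm B' (b' \<ominus>\<^bsub>B'\<^esub> D'.\<kappa> s x) \<le> e"
    using relE[OF b e] .
  have "D.\<kappa> s (star A x) = star B (D.\<kappa> s x)" "D'.\<kappa> s (star A x) = star B' (D'.\<kappa> s x)"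
    using s by (simp_all add: cstar_hom.hom_star[OF D.\<kappa>_hom] cstar_hom.hom_star[OF D'.\<kappa>_hom])
  then have "nrm B (star B b \<ominus>\<^bsub>B\<^esub> D.\<kappa> s (star A x)) \<le> e"
    "nrm B' (star B' b' \<ominus>\<^bsub>B'\<^esub> D'.\<kappa> s (star A x)) \<le> e"
    using s rel_closed[OF b] by (simp_all add: D.B.star_minus_star D'.B.star_minus_star)
  then show "\<exists>s\<in>carrier S. \<exists>a\<in>carrier A. nrm B (star B b \<ominus>\<^bsub>B\<^esub> D.\<kappa> s a) \<le> e \<and>
      nrm B' (star B' b' \<ominus>\<^bsub>B'\<^esub> D'.\<kappa> s a) \<le> e"
    using s D.A.star_closed by (intro bexI[of _ s] bexI[of _ "star A x"]) auto
qed (use rel_closed[OF b] D.B.star_closed D'.B.star_closed in auto)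

lemma rel_act:
  assumes g: "g \<in> carrier G" and b: "rel b b'"
  shows "rel (\<beta> g b) (\<beta>' g b')"
  unfolding rel_def
proof (intro conjI allI impI)
  fix e :: real assume e: "0 < e"
  obtain s x where s: "s \<in> carrier S" "x \<in> carrier A"
    "nrm B (b \<ominus>\<^bsub>B\<^esub> D.\<kappa> s x) \<le> e" "nrm B' (b' \<ominus>\<^bsub>B'\<^esub> D'.\<kappa> s x) \<le> e"
    using relE[OF b e] .
  obtain t p where t: "t \<in> carrier S" "p \<in> carrier S" "j t \<otimes>\<^bsub>G\<^esub> g = j p \<otimes>\<^bsub>G\<^esub> j s"
    using D.translate_multiple[OF g s(1)] .
  have "\<beta> g b \<ominus>\<^bsub>B\<^esub> D.\<kappa> t (\<alpha> p x) = \<beta> g (b \<ominus>\<^bsub>B\<^esub> D.\<kappa> s x)"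
    using D.\<kappa>_act[OF g s(1,2) t] cstar_hom.hom_minus[OF D.\<beta>_hom[OF g]] s rel_closed[OF b] by simp
  moreover have "\<beta>' g b' \<ominus>\<^bsub>B'\<^esub> D'.\<kappa> t (\<alpha> p x) = \<beta>' g (b' \<ominus>\<^bsub>B'\<^esub> D'.\<kappa> s x)"
    using D'.\<kappa>_act[OF g s(1,2) t] cstar_hom.hom_minus[OF D'.\<beta>_hom[OF g]] s rel_closed[OF b] by simp
  ultimately have "nrm B (\<beta> g b \<ominus>\<^bsub>B\<^esub> D.\<kappa> t (\<alpha> p x)) \<le> e" "nrm B' (\<beta>' g b' \<ominus>\<^bsub>B'\<^esub> D'.\<kappa> t (\<alpha> p x)) \<le> e"
    using s g rel_closed[OF b] by (simp_all add: D.\<beta>_isometric D'.\<beta>_isometric)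
  then show "\<exists>s\<in>carrier S. \<exists>a\<in>carrier A. nrm B (\<beta> g b \<ominus>\<^bsub>B\<^esub> D.\<kappa> s a) \<le> e \<and>
      nrm B' (\<beta>' g b' \<ominus>\<^bsub>B'\<^esub> D'.\<kappa> s a) \<le> e"
    using s t by (intro bexI[of _ t] bexI[of _ "\<alpha> p x"]) auto
qed (use rel_closed[OF b] g in auto)

lemma rel_emb:
  assumes a: "a \<in> carrier A"
  shows "rel (i a) (i' a)"
proof -
  obtain s where s: "s \<in> carrier S"
    using D.S_nonempty by blast
  show ?thesis
    unfolding rel_def using a s D.\<kappa>_emb[OF s a] D'.\<kappa>_emb[OF s a]
    by (auto intro!: bexI[of _ s] bexI[of _ "\<alpha> s a"])
qed

text \<open>By linearity zero is related to x - y, and related elements have equal norm.\<close>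

lemma rel_unique:
  assumes "rel b x" "rel b y"
  shows "x = y"
proof -
  have "rel (b \<oplus>\<^bsub>B\<^esub> (-1) \<odot>\<^bsub>B\<^esub> b) (x \<oplus>\<^bsub>B'\<^esub> (-1) \<odot>\<^bsub>B'\<^esub> y)"
    by (intro rel_add rel_smult assms)
  then have "rel (b \<ominus>\<^bsub>B\<^esub> b) (x \<ominus>\<^bsub>B'\<^esub> y)"
    using rel_closed assms
    by (simp add: D.B.minus_eq_smult D'.B.minus_eq_smult del: D.B.minus_self)
  then have "nrm B' (x \<ominus>\<^bsub>B'\<^esub> y) = 0"
    using rel_nrm rel_closed assms by fastforce
  then show ?thesis
    using rel_closed assms by (simp add: D'.B.nrm_minus_eq_0)
qed

lemma nrm_\<kappa>_minus:
  assumes "s \<in> carrier S" "a \<in> carrier A" "t \<in> carrier S" "c \<in> carrier A"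
  shows "nrm B' (D'.\<kappa> s a \<ominus>\<^bsub>B'\<^esub> D'.\<kappa> t c) = nrm B (D.\<kappa> s a \<ominus>\<^bsub>B\<^esub> D.\<kappa> t c)"
proof -
  have k: "rel (D.\<kappa> u d) (D'.\<kappa> u d)" if "u \<in> carrier S" "d \<in> carrier A" for u d
    using that unfolding rel_def by (auto intro!: bexI[of _ u] bexI[of _ d])
  have "rel (D.\<kappa> s a \<oplus>\<^bsub>B\<^esub> (-1) \<odot>\<^bsub>B\<^esub> D.\<kappa> t c) (D'.\<kappa> s a \<oplus>\<^bsub>B'\<^esub> (-1) \<odot>\<^bsub>B'\<^esub> D'.\<kappa> t c)"
    by (intro rel_add rel_smult k assms)
  then show ?thesis
    using rel_nrm assms by (simp add: D.B.minus_eq_smult D'.B.minus_eq_smult)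
qed

text \<open>Approximants of b at rate (1/2)^n have counterparts in B' with the same mutual
  distances. These form a geometric Cauchy sequence, whose limit is the required element.\<close>

lemma rel_total:
  assumes b: "b \<in> carrier B"
  obtains b' where "rel b b'"
proof -
  have "\<exists>s a. s \<in> carrier S \<and> a \<in> carrier A \<and> nrm B (b \<ominus>\<^bsub>B\<^esub> D.\<kappa> s a) \<le> (1/2) ^ n" for n :: nat
    by (rule D.dense[OF b, of "(1/2) ^ n"]) auto
  then obtain s a where s: "\<And>n. s n \<in> carrier S" and a: "\<And>n. a n \<in> carrier A"
    and near: "\<And>n. nrm B (b \<ominus>\<^bsub>B\<^esub> D.\<kappa> (s n) (a n)) \<le> (1/2) ^ n"
    by metis
  have kc: "D'.\<kappa> (s n) (a n) \<in> carrier B'" for n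
    using s a by simp
  have step: "nrm B' (D'.\<kappa> (s (Suc n)) (a (Suc n)) \<ominus>\<^bsub>B'\<^esub> D'.\<kappa> (s n) (a n)) \<le> 2 * (1/2) ^ n" for n
  proof -
    have "nrm B (D.\<kappa> (s (Suc n)) (a (Suc n)) \<ominus>\<^bsub>B\<^esub> D.\<kappa> (s n) (a n)) \<le> (1/2) ^ Suc n + (1/2) ^ n"
      using D.B.nrm_minus_triangle[of "D.\<kappa> (s (Suc n)) (a (Suc n))" b "D.\<kappa> (s n) (a n)"]
        D.B.nrm_minus_commute[of b "D.\<kappa> (s (Suc n)) (a (Suc n))"] near[of n] near[of "Suc n"] b s a
      by simp
    also have "\<dots> \<le> 2 * (1/2) ^ n"
      by simp
    finally show ?thesis
      by (simp add: nrm_\<kappa>_minus s a)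
  qed
  have half: "0 \<le> (1/2 :: real)" "(1/2 :: real) < 1"
    by simp_all
  obtain b' where b': "b' \<in> carrier B'"
    and "D'.B.converges_to sequentially (\<lambda>n. D'.\<kappa> (s n) (a n)) b'"
    and lim: "\<And>n. nrm B' (D'.\<kappa> (s n) (a n) \<ominus>\<^bsub>B'\<^esub> b') \<le> 2 * (1/2) ^ n / (1 - 1/2)"
    by (rule D'.B.geometric_convergent[of "\<lambda>n. D'.\<kappa> (s n) (a n)", OF kc half step])
      (rule that, assumption, assumption, erule meta_spec)
  have "rel b b'"
    unfolding rel_def
  proof (intro conjI allI impI b b')
    fix e :: real assume "0 < e"
    \<comment> \<open>The constant 4 is 2 / (1 - 1/2), from the geometric error bound.\<close>
    have "(\<lambda>n. 4 * (1/2) ^ n :: real) \<longlonglongrightarrow> 0"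
      by (intro tendsto_mult_right_zero LIMSEQ_realpow_zero) auto
    then have "eventually (\<lambda>n. 4 * (1/2) ^ n < e) sequentially"
      using \<open>0 < e\<close> by (rule order_tendstoD(2))
    then obtain n where n: "4 * (1/2) ^ n < e"
      using eventually_happens by force
    have "0 \<le> (1/2 :: real) ^ n"
      by simp
    then have "nrm B (b \<ominus>\<^bsub>B\<^esub> D.\<kappa> (s n) (a n)) \<le> e"
      using n near[of n] by linarith
    moreover have "nrm B' (b' \<ominus>\<^bsub>B'\<^esub> D'.\<kappa> (s n) (a n)) \<le> e"
      using n lim[of n] D'.B.nrm_minus_commute[OF b' kc[of n]] by simp
    ultimately show "\<exists>s\<in>carrier S. \<exists>a\<in>carrier A.
        nrm B (b \<ominus>\<^bsub>B\<^esub> D.\<kappa> s a) \<le> e \<and> nrm B' (b' \<ominus>\<^bsub>B'\<^esub> D'.\<kappa> s a) \<le> e"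
      using s a by blast
  qed
  then show thesis
    by (rule that)
qed

text \<open>The relation is symmetric in the two dilations. Uniqueness and totality therefore give a
  function in each direction, and those of the exchanged pair make \<theta> bijective.\<close>

lemma isomorphic: "isomorphic_dilations G A B \<beta> i B' \<beta>' i'"
proof -
  interpret swap: dil_pair S G A j \<alpha> B' \<beta>' i' B \<beta> i ..
  have swap_rel: "swap.rel b' b \<longleftrightarrow> rel b b'" for b b'
    unfolding swap.rel_def rel_def by blast
  define \<theta> where "\<theta> b = (THE b'. rel b b')" for b
  have \<theta>I: "\<theta> b = b'" if "rel b b'" for b b'
    unfolding \<theta>_def using that rel_unique by (intro the_equality)
  have \<theta>: "rel b (\<theta> b)" if "b \<in> carrier B" for b
    using rel_total[OF that] \<theta>I by metis
  have "bij_betw \<theta> (carrier B) (carrier B')"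
    unfolding bij_betw_def
  proof
    show "inj_on \<theta> (carrier B)"
    proof (rule inj_onI)
      fix b c assume "b \<in> carrier B" "c \<in> carrier B" "\<theta> b = \<theta> c"
      then have "swap.rel (\<theta> b) b" "swap.rel (\<theta> b) c"
        using \<theta>[of b] \<theta>[of c] by (simp_all add: swap_rel)
      then show "b = c"
        by (rule swap.rel_unique)
    qed
    have "b' \<in> \<theta> ` carrier B" if b': "b' \<in> carrier B'" for b'
    proof -
      obtain b where "swap.rel b' b"
        using swap.rel_total[OF b'] .
      then have "rel b b'"
        by (simp add: swap_rel)
      then show ?thesis
        using \<theta>I rel_closed(1) by (metis imageI)
    qed
    then show "\<theta> ` carrier B = carrier B'"
      using \<theta> rel_closed(2) by blast
  qed
  moreover have "\<theta> \<in> star_hom B B'"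
    unfolding star_hom_def mem_Collect_eq Pi_iff
    using \<theta> rel_closed(2) by (intro conjI ballI allI \<theta>I rel_add rel_mult rel_smult rel_star) blast+
  moreover have "\<theta> (i a) = i' a" if "a \<in> carrier A" for a
    by (intro \<theta>I rel_emb that)
  moreover have "\<theta> (\<beta> g b) = \<beta>' g (\<theta> b)" if "g \<in> carrier G" "b \<in> carrier B" for g b
    by (intro \<theta>I rel_act \<theta> that)
  ultimately show ?thesis
    unfolding isomorphic_dilations_def by blast
qed

end

theorem theorem2p1p1:
  fixes S :: "'s monoid" and G :: "'g monoid" and j :: "'s \<Rightarrow> 'g"
    and A :: "'a cstar" and \<alpha> :: "'s \<Rightarrow> 'a \<Rightarrow> 'a"
  assumes "ore_semigroup S"
    and "enveloping_group S G j"
    and "unital_cstar_algebra A"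
    and "endomorphism_action S A \<alpha>"
    and "\<And>s. s \<in> carrier S \<Longrightarrow> inj_on (\<alpha> s) (carrier A)"
  shows "(\<exists>(B :: ('s \<Rightarrow> 'a) set cstar) \<beta> i. minimal_dilation S G j A \<alpha> B \<beta> i) \<and>
    (\<forall>(B :: 'b cstar) \<beta> i (B' :: 'c cstar) \<beta>' i'.
       minimal_dilation S G j A \<alpha> B \<beta> i \<longrightarrow> minimal_dilation S G j A \<alpha> B' \<beta>' i' \<longrightarrow>
       isomorphic_dilations G A B \<beta> i B' \<beta>' i')"
proof (intro conjI allI impI)
  have "Group.group G"
    using assms(2) by (simp add: enveloping_group_def)
  moreover have "cstar_algebra A"
    using assms(3) by (simp add: unital_cstar_algebra_def)
  ultimately have action: "ore_action S G A j \<alpha>"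
    using assms by (simp add: ore_action_def ore_action_axioms_def)
  show "\<exists>(B :: ('s \<Rightarrow> 'a) set cstar) \<beta> i. minimal_dilation S G j A \<alpha> B \<beta> i"
    using ore_action.dilation_exists[OF action] by blast
  fix B :: "'b cstar" and \<beta> i and B' :: "'c cstar" and \<beta>' i'
  assume "minimal_dilation S G j A \<alpha> B \<beta> i" "minimal_dilation S G j A \<alpha> B' \<beta>' i'"
  then have "dil_pair S G A j \<alpha> B \<beta> i B' \<beta>' i'"
    by (intro dil_pair.intro minimal_dil.intro minimal_dil_axioms.intro action)
  then show "isomorphic_dilations G A B \<beta> i B' \<beta>' i'"
    by (rule dil_pair.isomorphic)
qed

end
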